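(* Let $\lambda>0$, $a,b\in\mathbb{R}$ and $L>0$, and set $T_{opt}=\frac{2(\lambda+1)}{\lambda}L$. Consider the control system $$ \begin{cases} \partial_t y_1-\partial_x y_1+a y_2=0, & (t,x)\in(0,+\infty)\times(0,L),\\ \partial_t y_2+\lambda\,\partial_x y_2+b y_1=0, & (t,x)\in(0,+\infty)\times(0,L),\\ y_2(t,0)=y_1(t,0), & t\in(0,+\infty),\\ y_1(t,L)=U(t), & t\in(0,+\infty), \end{cases} $$ with measured output $y_2(t,L)$. There exists a boundary (output) feedback control law $U(t)$ such that for every initial datum $(y_1^0,y_2^0)\in L^2(0,L)\times L^2(0,L)$, the solution $(y_1,y_2)\in C^0([0,+\infty);L^2(0,L)\times L^2(0,L))$ of the resulting closed-loop system with $(y_1,y_2)(0,\cdot)=(y_1^0,y_2^0)$ satisfies $$(y_1(t,\cdot),y_2(t,\cdot))=0\quad\text{for all } t\ge T_{opt}.$$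
   Context: A boundary (output) feedback control law here means a rule, independent of the initial datum $(y_1^0,y_2^0)$, which determines $U(t)$ causally from the output history $\{y_2(\tau,L):\tau\in(0,t)\}$ only (for instance through the state of a dynamic observer driven by this output). Solutions are understood in the usual (mild/weak) $L^2$ sense. *)

theory Defs
  imports "HOL-Analysis.Analysis"
begin

(* Elements of L^2 are represented by functions; equality in L^2 is equality almost everywhere. *)

definition L2_on :: "real set \<Rightarrow> (real \<Rightarrow> real) set" where
  "L2_on A = {f. set_borel_measurable lborel A f \<and> set_integrable lborel A (\<lambda>x. (f x)\<^sup>2)}"

(* Square integrable on (0,T) for every finite T, i.e. up to and including the endpoint 0. *)
definition L2_loc :: "(real \<Rightarrow> real) set" where
  "L2_loc = {f. \<forall>T>0. f \<in> L2_on {0<..<T}}"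

(* The space C^0([0,oo); L^2(0,L)). *)
definition C0_L2 :: "real \<Rightarrow> (real \<Rightarrow> real \<Rightarrow> real) set" where
  "C0_L2 L = {y. (\<forall>t\<ge>0. y t \<in> L2_on {0<..<L}) \<and>
     (\<forall>s\<ge>0. ((\<lambda>t. LINT x:{0<..<L}|lborel. (y t x - y s x)\<^sup>2) \<longlongrightarrow> 0) (at s within {0..}))}"

(* phi is of class C^1 on the closed rectangle [0,T] x [0,L], with partial derivatives
   phi_t and phi_x (one-sided on the boundary). *)
definition C1_test ::
  "real \<Rightarrow> real \<Rightarrow> (real \<Rightarrow> real \<Rightarrow> real) \<Rightarrow> (real \<Rightarrow> real \<Rightarrow> real) \<Rightarrow> (real \<Rightarrow> real \<Rightarrow> real) \<Rightarrow> bool"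
where
  "C1_test T L \<phi> \<phi>\<^sub>t \<phi>\<^sub>x \<longleftrightarrow>
     (\<forall>t\<in>{0..T}. \<forall>x\<in>{0..L}.
        ((\<lambda>p. \<phi> (fst p) (snd p)) has_derivative (\<lambda>h. \<phi>\<^sub>t t x * fst h + \<phi>\<^sub>x t x * snd h))
          (at (t, x) within {0..T} \<times> {0..L})) \<and>
     continuous_on ({0..T} \<times> {0..L}) (\<lambda>p. \<phi>\<^sub>t (fst p) (snd p)) \<and>
     continuous_on ({0..T} \<times> {0..L}) (\<lambda>p. \<phi>\<^sub>x (fst p) (snd p))"

(* Weak form of  d_t y + c d_x y + f = 0  on (0,oo) x (0,L), with boundary traces
   y(.,0) = y0 and y(.,L) = yL: the equation is multiplied by a C^1 function phi, not
   required to vanish anywhere, and integrated by parts over (0,T) x (0,L).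
   As phi is free on the boundary, the identity determines the traces y0 and yL almost
   everywhere when c is nonzero. *)
definition weak_transport ::
  "real \<Rightarrow> real \<Rightarrow> (real \<Rightarrow> real \<Rightarrow> real) \<Rightarrow> (real \<Rightarrow> real \<Rightarrow> real) \<Rightarrow> (real \<Rightarrow> real) \<Rightarrow> (real \<Rightarrow> real) \<Rightarrow> bool"
where
  "weak_transport L c y f y0 yL \<longleftrightarrow>
     (\<forall>T>0. \<forall>\<phi> \<phi>\<^sub>t \<phi>\<^sub>x. C1_test T L \<phi> \<phi>\<^sub>t \<phi>\<^sub>x \<longrightarrow>
        (LINT x:{0<..<L}|lborel. y T x * \<phi> T x) - (LINT x:{0<..<L}|lborel. y 0 x * \<phi> 0 x)
        + c * (LINT t:{0<..<T}|lborel. yL t * \<phi> t L - y0 t * \<phi> t 0)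
        = (LINT t:{0<..<T}|lborel. LINT x:{0<..<L}|lborel.
             y t x * (\<phi>\<^sub>t t x + c * \<phi>\<^sub>x t x) - f t x * \<phi> t x))"

(* (y1, y2) is the state, U the control y1(.,L), Y the output y2(.,L),
   and (u1, u2) the initial datum. *)
definition open_loop_solution ::
  "real \<Rightarrow> real \<Rightarrow> real \<Rightarrow> real \<Rightarrow> (real \<Rightarrow> real) \<Rightarrow> (real \<Rightarrow> real) \<Rightarrow> (real \<Rightarrow> real) \<Rightarrow> (real \<Rightarrow> real) \<Rightarrow>
     (real \<Rightarrow> real \<Rightarrow> real) \<Rightarrow> (real \<Rightarrow> real \<Rightarrow> real) \<Rightarrow> bool"
where
  "open_loop_solution lam a b L u1 u2 U Y y1 y2 \<longleftrightarrow>
     y1 \<in> C0_L2 L \<and> y2 \<in> C0_L2 L \<and>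
     (AE x in lborel. x \<in> {0<..<L} \<longrightarrow> y1 0 x = u1 x \<and> y2 0 x = u2 x) \<and>
     U \<in> L2_loc \<and> Y \<in> L2_loc \<and>
     (\<exists>y1_0\<in>L2_loc. \<exists>y2_0\<in>L2_loc. \<exists>y1_L\<in>L2_loc.
        weak_transport L (- 1) y1 (\<lambda>t x. a * y2 t x) y1_0 y1_L \<and>
        weak_transport L lam y2 (\<lambda>t x. b * y1 t x) y2_0 Y \<and>
        (AE t in lborel. t > 0 \<longrightarrow> y2_0 t = y1_0 t) \<and>
        (AE t in lborel. t > 0 \<longrightarrow> y1_L t = U t))"

(* A feedback law maps an output signal Y to a control F Y; causality says that F Y t
   depends only on the class of Y in L^2(0,t). *)
definition output_feedback_law :: "((real \<Rightarrow> real) \<Rightarrow> real \<Rightarrow> real) \<Rightarrow> bool" where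
  "output_feedback_law F \<longleftrightarrow>
     (\<forall>Y\<in>L2_loc. F Y \<in> L2_loc) \<and>
     (\<forall>Y\<in>L2_loc. \<forall>Z\<in>L2_loc. \<forall>t>0.
        (AE s in lborel. s \<in> {0<..<t} \<longrightarrow> Y s = Z s) \<longrightarrow> F Y t = F Z t)"

definition closed_loop_solution ::
  "real \<Rightarrow> real \<Rightarrow> real \<Rightarrow> real \<Rightarrow> ((real \<Rightarrow> real) \<Rightarrow> real \<Rightarrow> real) \<Rightarrow> (real \<Rightarrow> real) \<Rightarrow> (real \<Rightarrow> real) \<Rightarrow>
     (real \<Rightarrow> real \<Rightarrow> real) \<Rightarrow> (real \<Rightarrow> real \<Rightarrow> real) \<Rightarrow> bool"
where
  "closed_loop_solution lam a b L F u1 u2 y1 y2 \<longleftrightarrow>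
     (\<exists>Y. open_loop_solution lam a b L u1 u2 (F Y) Y y1 y2)"

definition T_opt :: "real \<Rightarrow> real \<Rightarrow> real" where
  "T_opt lam L = 2 * (lam + 1) / lam * L"

end

theory Submission
  imports Defs
begin

text \<open>
  The idea is to exchange the roles of time and space. Since \<open>y1\<close> and \<open>y2\<close> agree at \<open>x = 0\<close>, every
  solution is determined by the single function \<open>g t = y1 t 0 = y2 t 0\<close>, and conversely any locally
  square-integrable \<open>g\<close> on the line produces a solution: the values at \<open>(t, x)\<close> are \<open>g (t + x)\<close> and
  \<open>g (t - x / lam)\<close> plus integrals of \<open>g\<close> over \<open>[t - x / lam, t + x]\<close> against an explicit kernel.
  Prescribing the initial state and the control is a Volterra equation for \<open>g\<close>, and cutting \<open>g\<close> off
  after time \<open>S + L\<close> leaves the control on \<open>(0, S)\<close> unchanged and makes the state vanish from time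
  \<open>S + \<tau>\<close> on, where \<open>\<tau> = L + L / lam\<close> is half of the optimal time. The adjoint system has the same
  structure, so this null controllability yields by duality both uniqueness for the weak problem and
  the fact that the output on \<open>(0, \<tau>)\<close> determines the state at time \<open>\<tau>\<close>. The feedback law therefore
  applies zero control while it observes the output during \<open>(0, \<tau>)\<close>, and then plays a control
  that steers to zero within a further time \<open>\<tau>\<close> some initial datum compatible with that output.
\<close>

section \<open>Square-integrable functions\<close>

text \<open>At \<open>x = 0\<close> both components are known once \<open>g\<close> is, so evolution
  in \<open>x\<close> is a pure Cauchy problem. Its Goursat kernel has a closed form through Bessel
  series, which makes every estimate explicit.

  The obstacle is regularity. Weak solutions may be tested only against C^1 functions, whereas the
  adjoint solutions needed for duality start from L^2 data, namely differences of two states.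
  Solving and testing therefore both rest on the continuity in L^2 of the maps from \<open>g\<close>
  to time slices and to traces at fixed \<open>x\<close>: polynomial \<open>g\<close> give classical
  solutions, and all identities pass to the limit.

  Any datum compatible with the output is good enough, because the state at a time
  \<open>T \<ge> \<tau>\<close> depends only on the output on \<open>(0, \<tau>)\<close> and the
  control on \<open>(0, T)\<close>; so the true and the compatible trajectory coincide from
  \<open>\<tau>\<close> on. The closed loop is not an implicit equation either: the control is zero
  on \<open>(0, \<tau>)\<close> whatever the output is, hence the output there, and with it the
  whole later control, is fixed by the initial datum.\<close>

lemma L2_on_mult_integrable:
  assumes "f \<in> L2_on S" "g \<in> L2_on S"
  shows "set_integrable lborel S (\<lambda>x. f x * g x)"
proof -
  have m: "(\<lambda>x. indicator S x *\<^sub>R f x) \<in> borel_measurable lborel"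
    "(\<lambda>x. indicator S x *\<^sub>R g x) \<in> borel_measurable lborel"
    using assms by (auto simp: L2_on_def set_borel_measurable_def)
  have "set_integrable lborel S (\<lambda>x. (f x)^2 + (g x)^2)"
    using assms by (intro set_integral_add) (auto simp: L2_on_def)
  then show ?thesis unfolding set_integrable_def
  proof (rule Bochner_Integration.integrable_bound)
    have "(\<lambda>x. (indicator S x *\<^sub>R f x) * (indicator S x *\<^sub>R g x)) \<in> borel_measurable lborel"
      using m by (rule borel_measurable_times)
    moreover have "(\<lambda>x. (indicator S x *\<^sub>R f x) * (indicator S x *\<^sub>R g x)) = (\<lambda>x. indicator S x *\<^sub>R (f x * g x))"
      by (auto simp: indicator_def fun_eq_iff)
    ultimately show "(\<lambda>x. indicator S x *\<^sub>R (f x * g x)) \<in> borel_measurable lborel" by simp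
    have "\<bar>u * v\<bar> \<le> \<bar>u^2 + v^2\<bar>" for u v :: real
    proof -
      have "2 * \<bar>u\<bar> * \<bar>v\<bar> \<le> \<bar>u\<bar>^2 + \<bar>v\<bar>^2" by (rule sum_squares_bound)
      moreover have "0 \<le> \<bar>u\<bar> * \<bar>v\<bar>" by simp
      ultimately have "\<bar>u\<bar> * \<bar>v\<bar> \<le> \<bar>u\<bar>^2 + \<bar>v\<bar>^2" by linarith
      then show ?thesis by (simp add: abs_mult)
    qed
    then show "AE x in lborel. norm (indicator S x *\<^sub>R (f x * g x)) \<le> norm (indicator S x *\<^sub>R ((f x)^2 + (g x)^2))"
      by (intro AE_I2) (simp add: indicator_def)
  qed
qed

lemma L2_on_add:
  assumes "f \<in> L2_on S" "g \<in> L2_on S"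
  shows "(\<lambda>x. f x + g x) \<in> L2_on S"
proof -
  have "set_integrable lborel S (\<lambda>x. (f x)^2 + (g x)^2 + 2 * (f x * g x))"
    using assms L2_on_mult_integrable[OF assms]
    by (intro set_integral_add set_integrable_mult_right) (auto simp: L2_on_def)
  moreover have "(\<lambda>x. (f x)^2 + (g x)^2 + 2 * (f x * g x)) = (\<lambda>x. (f x + g x)^2)"
    by (auto simp: power2_sum)
  moreover have "set_borel_measurable lborel S (\<lambda>x. f x + g x)"
    using assms unfolding L2_on_def set_borel_measurable_def scaleR_add_right
    by (auto intro!: borel_measurable_add)
  ultimately show ?thesis by (simp add: L2_on_def)
qed

lemma L2_on_cmult:
  assumes "f \<in> L2_on S"
  shows "(\<lambda>x. c * f x) \<in> L2_on S"
proof -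
  have "set_integrable lborel S (\<lambda>x. c^2 * (f x)^2)"
    using assms by (intro set_integrable_mult_right) (auto simp: L2_on_def)
  moreover have "(\<lambda>x. c * (indicator S x *\<^sub>R f x)) \<in> borel_measurable lborel"
    using assms by (intro borel_measurable_times) (auto simp: L2_on_def set_borel_measurable_def)
  then have "set_borel_measurable lborel S (\<lambda>x. c * f x)"
    by (simp add: set_borel_measurable_def mult.left_commute)
  ultimately show ?thesis by (simp add: L2_on_def power_mult_distrib)
qed

lemma L2_on_diff:
  assumes "f \<in> L2_on S" "g \<in> L2_on S"
  shows "(\<lambda>x. f x - g x) \<in> L2_on S"
  using L2_on_add[OF assms(1) L2_on_cmult[OF assms(2), of "-1"]] by simp

lemma L2_on_subset:
  assumes "f \<in> L2_on S" "S' \<subseteq> S" "S' \<in> sets borel"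
  shows "f \<in> L2_on S'"
proof -
  have "(\<lambda>x. indicator S' x * (indicator S x *\<^sub>R f x)) \<in> borel_measurable lborel"
    using assms by (intro borel_measurable_times) (auto simp: L2_on_def set_borel_measurable_def)
  moreover have "(\<lambda>x. indicator S' x * (indicator S x *\<^sub>R f x)) = (\<lambda>x. indicator S' x *\<^sub>R f x)"
    using assms(2) by (auto simp: indicator_def fun_eq_iff)
  ultimately have "set_borel_measurable lborel S' f"
    by (simp add: set_borel_measurable_def)
  moreover have "set_integrable lborel S' (\<lambda>x. (f x)^2)"
    by (rule set_integrable_subset[of lborel S]) (use assms in \<open>auto simp: L2_on_def\<close>)
  ultimately show ?thesis by (simp add: L2_on_def)
qed

text \<open>The integral of \<open>(r * f x + s * g x)^2\<close> is a nonnegative quadratic form in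
  \<open>r\<close> and \<open>s\<close>, so its discriminant has a sign.\<close>

lemma L2_on_Cauchy_Schwarz:
  assumes "f \<in> L2_on S" "g \<in> L2_on S"
  shows "\<bar>LBINT x:S. f x * g x\<bar> \<le> sqrt (LBINT x:S. (f x)^2) * sqrt (LBINT x:S. (g x)^2)"
proof -
  define F G H where "F = (LBINT x:S. (f x)^2)" and "G = (LBINT x:S. (g x)^2)"
    and "H = (LBINT x:S. f x * g x)"
  have int: "set_integrable lborel S (\<lambda>x. (f x)^2)" "set_integrable lborel S (\<lambda>x. (g x)^2)"
    "set_integrable lborel S (\<lambda>x. f x * g x)"
    using assms L2_on_mult_integrable by (auto simp: L2_on_def)
  have q: "0 \<le> F * r^2 + 2 * H * r * s + G * s^2" for r s
  proof -
    have "(\<lambda>x. (r * f x + s * g x)^2) =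
       (\<lambda>x. r^2 * (f x)^2 + (2 * r * s) * (f x * g x) + s^2 * (g x)^2)"
      by (rule ext) (simp add: power2_sum power_mult_distrib)
    then have "(LBINT x:S. (r * f x + s * g x)^2) =
       (LBINT x:S. r^2 * (f x)^2 + (2 * r * s) * (f x * g x) + s^2 * (g x)^2)"
      by simp
    also have "\<dots> = r^2 * F + (2 * r * s) * H + s^2 * G"
      using int by (simp add: F_def G_def H_def)
    finally have "(LBINT x:S. (r * f x + s * g x)^2) = r^2 * F + (2 * r * s) * H + s^2 * G" .
    moreover have "0 \<le> (LBINT x:S. (r * f x + s * g x)^2)"
      unfolding set_lebesgue_integral_def by (rule integral_nonneg_AE) auto
    ultimately show ?thesis by (simp add: algebra_simps)
  qed
  have FG: "0 \<le> F" "0 \<le> G" using q[of 1 0] q[of 0 1] by auto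
  have "H^2 \<le> F * G"
  proof (cases "G = 0")
    case True
    have "H = 0"
    proof (rule ccontr)
      assume "H \<noteq> 0"
      \<comment> \<open>With \<open>G = 0\<close> the form is affine in \<open>s\<close>, and this
        value of \<open>s\<close> makes it equal to \<open>-1\<close>.\<close>
      then show False using q[of 1 "- (F + 1) / (2 * H)"] True by simp
    qed
    then show ?thesis by (simp add: True)
  next
    case False
    then have "G > 0" using FG by simp
    have "F * G^2 + 2 * H * G * (- H) + G * (- H)^2 = G * (F * G - H^2)"
      by (simp add: power2_eq_square algebra_simps)
    then have "0 \<le> G * (F * G - H^2)" using q[of G "-H"] by simp
    then show ?thesis using \<open>G > 0\<close> by (simp add: zero_le_mult_iff)
  qed
  then have "\<bar>H\<bar> \<le> sqrt (F * G)"
    by (metis real_sqrt_abs real_sqrt_le_iff)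
  then show ?thesis by (simp add: F_def G_def H_def real_sqrt_mult)
qed

lemma L2_on_bounded:
  fixes f :: "real \<Rightarrow> real"
  assumes "set_borel_measurable lborel {a<..<b} f" "\<And>x. x \<in> {a<..<b} \<Longrightarrow> \<bar>f x\<bar> \<le> K"
  shows "f \<in> L2_on {a<..<b}"
proof -
  have "set_integrable lborel {a<..<b} (\<lambda>x. K^2)" 
    using borel_integrable_atLeastAtMost'[of a b "\<lambda>_. K^2"] by (rule set_integrable_subset) auto
  then have "set_integrable lborel {a<..<b} (\<lambda>x. (f x)^2)"
  proof (rule set_integrable_bound)
    have "(\<lambda>x. (indicator {a<..<b} x *\<^sub>R f x)^2) \<in> borel_measurable lborel"
      using assms(1) by (intro borel_measurable_power) (simp add: set_borel_measurable_def)
    moreover have "(\<lambda>x. (indicator {a<..<b} x *\<^sub>R f x)^2) = (\<lambda>x. indicator {a<..<b} x *\<^sub>R (f x)^2)"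
      by (auto simp: indicator_def fun_eq_iff)
    ultimately show "set_borel_measurable lborel {a<..<b} (\<lambda>x. (f x)^2)"
      by (simp add: set_borel_measurable_def)
    show "AE x in lborel. x \<in> {a<..<b} \<longrightarrow> norm ((f x)^2) \<le> norm (K^2)"
    proof (intro AE_I2 impI)
      fix x assume "x \<in> {a<..<b}"
      then have "\<bar>f x\<bar>^2 \<le> K^2" using assms(2) by (intro power_mono) auto
      then show "norm ((f x)^2) \<le> norm (K^2)" by simp
    qed
  qed
  then show ?thesis using assms(1) by (simp add: L2_on_def)
qed

lemma L2_on_continuous:
  fixes f :: "real \<Rightarrow> real"
  assumes "continuous_on {a..b} f"
  shows "f \<in> L2_on {a<..<b}"
proof -
  have "compact (f ` {a..b})" using assms by (intro compact_continuous_image) auto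
  then obtain K where "\<forall>x\<in>{a..b}. \<bar>f x\<bar> \<le> K" 
    by (metis compact_imp_bounded bounded_iff imageI real_norm_def)
  moreover have "set_borel_measurable borel {a<..<b} f"
    using assms by (intro set_measurable_continuous_on) (auto intro: continuous_on_subset)
  ultimately show ?thesis
    by (intro L2_on_bounded[of _ _ _ K]) (auto simp: set_borel_measurable_def)
qed

lemma L2_on_integrable:
  assumes "f \<in> L2_on {a<..<b}"
  shows "set_integrable lborel {a<..<b} f"
  using L2_on_mult_integrable[OF assms L2_on_continuous[of a b "\<lambda>_. 1"]] by simp

lemma L2_on_tendsto:
  assumes "\<And>n. f n \<in> L2_on S" "g \<in> L2_on S" "h \<in> L2_on S"
    and "(\<lambda>n. LBINT x:S. (f n x - g x)^2) \<longlonglongrightarrow> 0"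
  shows "(\<lambda>n. LBINT x:S. f n x * h x) \<longlonglongrightarrow> (LBINT x:S. g x * h x)"
proof -
  have "(\<lambda>n. (LBINT x:S. f n x * h x) - (LBINT x:S. g x * h x)) \<longlonglongrightarrow> 0"
  proof (rule Lim_null_comparison)
    show "\<forall>\<^sub>F n in sequentially. norm ((LBINT x:S. f n x * h x) - (LBINT x:S. g x * h x))
      \<le> sqrt (LBINT x:S. (f n x - g x)^2) * sqrt (LBINT x:S. (h x)^2)"
    proof (intro always_eventually allI)
      fix n
      have "(LBINT x:S. f n x * h x) - (LBINT x:S. g x * h x) = (LBINT x:S. (f n x - g x) * h x)"
        using L2_on_mult_integrable[OF assms(1,3), of n] L2_on_mult_integrable[OF assms(2,3)]
        by (simp add: left_diff_distrib)
      then show "norm ((LBINT x:S. f n x * h x) - (LBINT x:S. g x * h x))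
      \<le> sqrt (LBINT x:S. (f n x - g x)^2) * sqrt (LBINT x:S. (h x)^2)"
        using L2_on_Cauchy_Schwarz[OF L2_on_diff[OF assms(1,2)] assms(3), of n] by simp
    qed
    show "(\<lambda>n. sqrt (LBINT x:S. (f n x - g x)^2) * sqrt (LBINT x:S. (h x)^2)) \<longlonglongrightarrow> 0"
      using tendsto_mult_right[OF tendsto_real_sqrt[OF assms(4)], of "sqrt (LBINT x:S. (h x)^2)"] by simp
  qed
  then show ?thesis by (simp add: LIM_zero_iff)
qed

lemma L2_on_integral_nonneg: "0 \<le> (LBINT x:S. (f x :: real)^2)"
  unfolding set_lebesgue_integral_def by (rule integral_nonneg_AE) auto

lemma L2_on_zero:
  assumes "f \<in> L2_on S" "(LBINT x:S. (f x)^2) = 0"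
  shows "AE x in lborel. x \<in> S \<longrightarrow> f x = 0"
proof -
  have "integrable lborel (\<lambda>x. indicator S x *\<^sub>R (f x)^2)"
    using assms by (simp add: L2_on_def set_integrable_def)
  then have "AE x in lborel. indicator S x *\<^sub>R (f x)^2 = 0"
    using assms(2) by (subst integral_nonneg_eq_0_iff_AE[symmetric]) (auto simp: set_lebesgue_integral_def)
  then show ?thesis by eventually_elim (auto simp: indicator_def)
qed

lemma integral_square_sum_le:
  assumes "f \<in> L2_on S" "g \<in> L2_on S"
  shows "(LBINT x:S. (f x + g x)^2) \<le> 2 * (LBINT x:S. (f x)^2) + 2 * (LBINT x:S. (g x)^2)"
proof -
  have *: "set_integrable lborel S (\<lambda>x. 2 * (f x)^2)" "set_integrable lborel S (\<lambda>x. 2 * (g x)^2)"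
    using assms by (auto simp: L2_on_def)
  have "(LBINT x:S. (f x + g x)^2) \<le> (LBINT x:S. 2 * (f x)^2 + 2 * (g x)^2)"
  proof (rule set_integral_mono)
    show "set_integrable lborel S (\<lambda>x. (f x + g x)^2)"
      using L2_on_add[OF assms] by (simp add: L2_on_def)
    show "(f x + g x)^2 \<le> 2 * (f x)^2 + 2 * (g x)^2" for x
      using sum_squares_bound[of "f x" "g x"] by (simp add: power2_sum)
  qed (use * in \<open>rule set_integral_add(1)\<close>)
  also have "\<dots> = 2 * (LBINT x:S. (f x)^2) + 2 * (LBINT x:S. (g x)^2)"
    using * by (subst set_integral_add(2)) simp_all
  finally show ?thesis .
qed

lemma L2_on_AE_cong_integral:
  fixes f g h :: "real \<Rightarrow> real"
  assumes "AE x in lborel. x \<in> S \<longrightarrow> f x = g x" "f \<in> L2_on S" "g \<in> L2_on S" "h \<in> L2_on S"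
  shows "(LBINT x:S. f x * h x) = (LBINT x:S. g x * h x)"
  unfolding set_lebesgue_integral_def
proof (rule integral_cong_AE)
  show "AE x in lborel. indicator S x *\<^sub>R (f x * h x) = indicator S x *\<^sub>R (g x * h x)"
    using assms(1) by eventually_elim (auto simp: indicator_def)
qed (use L2_on_mult_integrable[OF assms(2,4)] L2_on_mult_integrable[OF assms(3,4)] in
   \<open>auto simp: set_integrable_def\<close>)

text \<open>The class of admissible traces. It lives on the whole line because the initial value of
  the second component is read off from \<open>g\<close> at negative times, and it asks for Borel
  measurability everywhere so that shifts and reflections stay in the class.\<close>

definition locsq :: "(real \<Rightarrow> real) \<Rightarrow> bool" where
  "locsq g \<longleftrightarrow> g \<in> borel_measurable borel \<and> (\<forall>R. g \<in> L2_on {-R<..<R})"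

section \<open>Density of continuous functions and of polynomials in L^2 of an interval\<close>

lemma borel_limit_of_continuous:
  fixes f :: "real \<Rightarrow> real"
  assumes "f \<in> borel_measurable borel"
  obtains g :: "nat \<Rightarrow> real \<Rightarrow> real" where "\<And>n. continuous_on UNIV (g n)" "AE x in lborel. (\<lambda>n. g n x) \<longlonglongrightarrow> f x"
proof -
  have "f \<in> borel_measurable lebesgue" using assms by (simp add: measurable_completion)
  then have "f measurable_on UNIV"
    by (intro lebesgue_measurable_imp_measurable_on) auto
  then have "\<exists>N. negligible N \<and> (\<exists>g. (\<forall>n. continuous_on UNIV (g n)) \<and> (\<forall>x. x \<notin> N \<longrightarrow> (\<lambda>n. g n x) \<longlonglongrightarrow> f x))"
    by (simp add: measurable_on_def)
  then obtain N and g :: "nat \<Rightarrow> real \<Rightarrow> real" where N: "negligible N"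
    and g: "\<forall>n. continuous_on UNIV (g n)" "\<forall>x. x \<notin> N \<longrightarrow> (\<lambda>n. g n x) \<longlonglongrightarrow> f x"
    by (elim exE conjE) (rule that)
  have "N \<in> null_sets lebesgue" using N by (simp add: negligible_iff_null_sets)
  then obtain N' where N': "N' \<in> null_sets lborel" "N \<subseteq> N'"
    unfolding null_sets_completion_iff2 by (elim bexE)
  have "AE x in lborel. (\<lambda>n. g n x) \<longlonglongrightarrow> f x"
    by (rule AE_I'[OF N'(1)]) (use g N'(2) in auto)
  with g(1) show ?thesis by (intro that) simp_all
qed

lemma L2_dense_bounded:
  fixes f :: "real \<Rightarrow> real"
  assumes [measurable]: "f \<in> borel_measurable borel" and K: "\<And>x. \<bar>f x\<bar> \<le> K" and e: "e > 0"
  obtains h where "continuous_on UNIV h" "(LBINT x:{a<..<b}. (f x - h x)^2) < e"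
proof -
  obtain g :: "nat \<Rightarrow> real \<Rightarrow> real" where g: "\<And>n. continuous_on UNIV (g n)"
    and lim: "AE x in lborel. (\<lambda>n. g n x) \<longlonglongrightarrow> f x"
    by (rule borel_limit_of_continuous[OF assms(1)]) metis
  \<comment> \<open>Clipping at the bound of \<open>f\<close> leaves the limit unchanged and
    provides the dominating constant.\<close>
  define h where "h n x = max (- K) (min K (g n x))" for n x
  have hc: "continuous_on UNIV (h n)" for n
    unfolding h_def using g by (intro continuous_intros) auto
  have [measurable]: "h n \<in> borel_measurable borel" for n
    using hc by (rule borel_measurable_continuous_onI)
  have hK: "\<bar>h n x\<bar> \<le> K" for n x using K[of x] by (auto simp: h_def)
  have "(\<lambda>n. LBINT x. indicator {a<..<b} x *\<^sub>R (f x - h n x)^2) \<longlonglongrightarrow> (\<integral>x. 0 \<partial>(lborel :: real measure))"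
  proof (rule integral_dominated_convergence[where w = "\<lambda>x. indicator {a<..<b} x *\<^sub>R (2 * K)^2"])
    have "set_integrable lborel {a<..<b} (\<lambda>_. (2 * K)^2)"
      using borel_integrable_atLeastAtMost'[of a b "\<lambda>_. (2*K)^2"] by (rule set_integrable_subset) auto
    then show "integrable lborel (\<lambda>x. indicator {a<..<b} x *\<^sub>R (2 * K)^2)"
      unfolding set_integrable_def .
    show "AE x in lborel. norm (indicator {a<..<b} x *\<^sub>R (f x - h n x)^2) \<le> indicator {a<..<b} x *\<^sub>R (2 * K)^2" for n
    proof (intro AE_I2)
      fix x
      have "\<bar>f x - h n x\<bar>^2 \<le> (2 * K)^2"
        using K[of x] hK[of n x] by (intro power_mono) auto
      then show "norm (indicator {a<..<b} x *\<^sub>R (f x - h n x)^2) \<le> indicator {a<..<b} x *\<^sub>R (2 * K)^2"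
        by (auto simp: indicator_def)
    qed
    show "AE x in lborel. (\<lambda>n. indicator {a<..<b} x *\<^sub>R (f x - h n x)^2) \<longlonglongrightarrow> 0"
      using lim
    proof eventually_elim
      case (elim x)
      have "(\<lambda>n. h n x) \<longlonglongrightarrow> max (- K) (min K (f x))"
        unfolding h_def by (intro tendsto_intros elim)
      moreover have "max (- K) (min K (f x)) = f x" using K[of x] by auto
      ultimately have "(\<lambda>n. h n x) \<longlonglongrightarrow> f x" by simp
      then have "(\<lambda>n. indicator {a<..<b} x *\<^sub>R (f x - h n x)^2) \<longlonglongrightarrow> indicator {a<..<b} x *\<^sub>R (f x - f x)^2"
        by (intro tendsto_intros)
      then show ?case by simp
    qed
  qed auto
  then have "(\<lambda>n. LBINT x:{a<..<b}. (f x - h n x)^2) \<longlonglongrightarrow> 0"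
    by (simp add: set_lebesgue_integral_def)
  then have "\<forall>\<^sub>F n in sequentially. (LBINT x:{a<..<b}. (f x - h n x)^2) < e"
    using e by (rule order_tendstoD(2))
  then obtain n where "(LBINT x:{a<..<b}. (f x - h n x)^2) < e"
    using eventually_happens' sequentially_bot by blast
  then show ?thesis using that hc by blast
qed

lemma L2_dense_continuous:
  fixes f :: "real \<Rightarrow> real"
  assumes [measurable]: "f \<in> borel_measurable borel" and f2: "f \<in> L2_on {a<..<b}" and e: "e > 0"
  obtains h where "continuous_on UNIV h" "(LBINT x:{a<..<b}. (f x - h x)^2) < e"
proof -
  \<comment> \<open>Clipping at height \<open>n\<close> reduces to bounded functions; the error is
    dominated by \<open>(f x)^2\<close> and is eventually zero at each point.\<close>
  define fK where "fK n x = max (- real n) (min (real n) (f x))" for n x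
  have [measurable]: "fK n \<in> borel_measurable borel" for n unfolding fK_def by measurable
  have "(\<lambda>n. LBINT x. indicator {a<..<b} x *\<^sub>R (f x - fK n x)^2) \<longlonglongrightarrow> (\<integral>x. 0 \<partial>(lborel :: real measure))"
  proof (rule integral_dominated_convergence[where w = "\<lambda>x. indicator {a<..<b} x *\<^sub>R (f x)^2"])
    show "integrable lborel (\<lambda>x. indicator {a<..<b} x *\<^sub>R (f x)^2)"
      using f2 by (auto simp: set_integrable_def L2_on_def)
    show "AE x in lborel. norm (indicator {a<..<b} x *\<^sub>R (f x - fK n x)^2) \<le> indicator {a<..<b} x *\<^sub>R (f x)^2" for n
    proof (intro AE_I2)
      fix x
      have "\<bar>f x - fK n x\<bar>^2 \<le> \<bar>f x\<bar>^2"
        by (intro power_mono) (auto simp: fK_def)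
      then show "norm (indicator {a<..<b} x *\<^sub>R (f x - fK n x)^2) \<le> indicator {a<..<b} x *\<^sub>R (f x)^2"
        by (auto simp: indicator_def)
    qed
    show "AE x in lborel. (\<lambda>n. indicator {a<..<b} x *\<^sub>R (f x - fK n x)^2) \<longlonglongrightarrow> 0"
    proof (intro AE_I2)
      fix x
      obtain m where m: "\<bar>f x\<bar> \<le> real m" using real_arch_simple by blast
      have "\<forall>\<^sub>F n in sequentially. indicator {a<..<b} x *\<^sub>R (f x - fK n x)^2 = 0"
        using eventually_ge_at_top[of m]
      proof eventually_elim
        case (elim n)
        then have "fK n x = f x" using m by (auto simp: fK_def)
        then show ?case by simp
      qed
      then show "(\<lambda>n. indicator {a<..<b} x *\<^sub>R (f x - fK n x)^2) \<longlonglongrightarrow> 0"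
        by (rule tendsto_eventually)
    qed
  qed auto
  then have "(\<lambda>n. LBINT x:{a<..<b}. (f x - fK n x)^2) \<longlonglongrightarrow> 0"
    by (simp add: set_lebesgue_integral_def)
  then have "\<forall>\<^sub>F n in sequentially. (LBINT x:{a<..<b}. (f x - fK n x)^2) < e/4"
    using e by (intro order_tendstoD(2)) auto
  then obtain n where n: "(LBINT x:{a<..<b}. (f x - fK n x)^2) < e/4"
    using eventually_happens' sequentially_bot by blast
  have bd: "\<bar>fK n x\<bar> \<le> real n" for x by (auto simp: fK_def)
  obtain h where h: "continuous_on UNIV h" "(LBINT x:{a<..<b}. (fK n x - h x)^2) < e/4"
    using L2_dense_bounded[of "fK n" "real n" "e/4" a b] bd e by auto
  have "fK n \<in> L2_on {a<..<b}"
    by (rule L2_on_bounded[of _ _ _ "real n"]) (use bd in \<open>auto simp: set_borel_measurable_def\<close>)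
  moreover have "h \<in> L2_on {a<..<b}"
    using h by (intro L2_on_continuous) (auto intro: continuous_on_subset)
  ultimately have "(LBINT x:{a<..<b}. ((f x - fK n x) + (fK n x - h x))^2)
     \<le> 2 * (LBINT x:{a<..<b}. (f x - fK n x)^2) + 2 * (LBINT x:{a<..<b}. (fK n x - h x)^2)"
    by (intro integral_square_sum_le L2_on_diff f2)
  also have "\<dots> < e" using n h(2) by simp
  finally show ?thesis using that h(1) by simp
qed

text \<open>Polynomials rather than continuous functions: a trace must be C^1 on the whole line for
  the wave formulas to be classical solutions.\<close>

lemma L2_dense_polynomial:
  fixes f :: "real \<Rightarrow> real"
  assumes [measurable]: "f \<in> borel_measurable borel" and f2: "f \<in> L2_on {a<..<b}" and e: "e > 0"
  obtains p where "real_polynomial_function p" "(LBINT x:{a<..<b}. (f x - p x)^2) < e"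
proof -
  obtain h where h: "continuous_on UNIV h" "(LBINT x:{a<..<b}. (f x - h x)^2) < e/4"
    by (rule L2_dense_continuous[OF assms(1) f2, of "e/4"]) (use e in auto)
  \<comment> \<open>The bound \<open>1\<close> gives \<open>d^2 \<le> d\<close>, and the summand
    \<open>1\<close> in the denominator avoids division by zero when \<open>a = b\<close>.\<close>
  define d where "d = min 1 (e / (4 * (\<bar>b - a\<bar> + 1)))"
  have d: "0 < d" "d \<le> 1" "d * (\<bar>b - a\<bar> + 1) \<le> e / 4"
  proof -
    have c: "0 < 4 * (\<bar>b - a\<bar> + 1)" by (simp add: add_nonneg_pos)
    show "0 < d" unfolding d_def using e divide_pos_pos[OF e c] by simp
    show "d \<le> 1" by (simp add: d_def)
    have "d \<le> e / (4 * (\<bar>b - a\<bar> + 1))" by (simp add: d_def)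
    then have "d * (4 * (\<bar>b - a\<bar> + 1)) \<le> e" using pos_le_divide_eq[OF c] by blast
    then show "d * (\<bar>b - a\<bar> + 1) \<le> e / 4" by (simp add: algebra_simps)
  qed
  obtain p where p: "real_polynomial_function p" "\<And>x. x \<in> {a..b} \<Longrightarrow> \<bar>h x - p x\<bar> < d"
    by (rule Stone_Weierstrass_real_polynomial_function[of "{a..b}" h d])
      (use h(1) d(1) in \<open>auto intro: continuous_on_subset\<close>)
  have pc: "continuous_on S p" for S
    using p(1) continuous_on_polymonial_function real_polynomial_function_eq by blast
  have hL: "h \<in> L2_on {a<..<b}" "p \<in> L2_on {a<..<b}"
    using h pc by (auto intro!: L2_on_continuous intro: continuous_on_subset)
  have "(LBINT x:{a<..<b}. (h x - p x)^2) \<le> (LBINT x:{a<..<b}. d)"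
  proof (rule set_integral_mono)
    show "set_integrable lborel {a<..<b} (\<lambda>x. (h x - p x)^2)"
      using L2_on_diff[OF hL] by (simp add: L2_on_def)
    show "set_integrable lborel {a<..<b} (\<lambda>x. d)"
      using borel_integrable_atLeastAtMost'[of a b "\<lambda>_. d"] by (rule set_integrable_subset) auto
    show "(h x - p x)^2 \<le> d" if "x \<in> {a<..<b}" for x
    proof -
      have "\<bar>h x - p x\<bar>^2 \<le> d^2" using p(2)[of x] that by (intro power_mono) auto
      also have "\<dots> \<le> d" using d by (simp add: power2_eq_square mult_left_le)
      finally show ?thesis by simp
    qed
  qed
  also have "\<dots> \<le> d * (\<bar>b - a\<bar> + 1)"
    using d(1) by (cases "a \<le> b") (simp_all add: set_lebesgue_integral_def)
  finally have hp: "(LBINT x:{a<..<b}. (h x - p x)^2) \<le> e / 4" using d(3) by simp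
  have "(LBINT x:{a<..<b}. ((f x - h x) + (h x - p x))^2)
     \<le> 2 * (LBINT x:{a<..<b}. (f x - h x)^2) + 2 * (LBINT x:{a<..<b}. (h x - p x)^2)"
    using hL by (intro integral_square_sum_le L2_on_diff f2)
  also have "\<dots> < e" using hp h(2) e by simp
  finally show ?thesis using that p(1) by simp
qed

abbreviation L2_lim :: "real \<Rightarrow> (nat \<Rightarrow> real \<Rightarrow> real) \<Rightarrow> (real \<Rightarrow> real) \<Rightarrow> bool" where
  "L2_lim R p g \<equiv> (\<lambda>n. LBINT s:{-R<..<R}. (g s - p n s)^2) \<longlonglongrightarrow> 0"

lemma locsq_approx:
  assumes "locsq g"
  obtains p where "\<And>n. real_polynomial_function (p n)"
    "L2_lim R p g"
proof -
  have "\<exists>p. real_polynomial_function p \<and> (LBINT x:{-R<..<R}. (g x - p x)^2) < 1 / real (Suc n)" for n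
  proof -
    have "g \<in> borel_measurable borel" "g \<in> L2_on {-R<..<R}" "0 < 1 / real (Suc n)"
      using assms by (auto simp: locsq_def)
    from L2_dense_polynomial[OF this] show ?thesis by blast
  qed
  then obtain p where p: "\<And>n. real_polynomial_function (p n)"
    "\<And>n. (LBINT x:{-R<..<R}. (g x - p n x)^2) < 1 / real (Suc n)" by metis
  have "(\<lambda>n. LBINT x:{-R<..<R}. (g x - p n x)^2) \<longlonglongrightarrow> 0"
  proof (rule Lim_null_comparison)
    show "\<forall>\<^sub>F n in sequentially. norm (LBINT x:{-R<..<R}. (g x - p n x)^2) \<le> 1 / real (Suc n)"
      using less_imp_le[OF p(2)] L2_on_integral_nonneg[of "{-R<..<R}"]
      by (intro always_eventually allI) (simp only: real_norm_def abs_of_nonneg)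
    show "(\<lambda>n. 1 / real (Suc n)) \<longlonglongrightarrow> 0" by (rule LIMSEQ_Suc[OF lim_1_over_n])
  qed
  then show ?thesis using that p(1) by blast
qed

section \<open>Sideways propagation with a Riemann function\<close>

text \<open>For \<open>z \<ge> 0\<close> this is the modified Bessel function of order 0 at
  \<open>2 * sqrt z\<close>. As a series in \<open>z\<close> it is entire, so both signs of
  \<open>A * B\<close> are covered at once.\<close>

definition J0 :: "real \<Rightarrow> real" where
  "J0 z = (\<Sum>n. 1 / (fact n)^2 * z ^ n)"

text \<open>For \<open>z > 0\<close> this is the modified Bessel function of order 1 at
  \<open>2 * sqrt z\<close>, divided by \<open>sqrt z\<close>; it is the derivative of
  \<open>J0\<close>.\<close>

definition J1 :: "real \<Rightarrow> real" where
  "J1 z = (\<Sum>n. 1 / (fact n * fact (Suc n)) * z ^ n)"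

lemma summable_fact_bound:
  fixes c :: "nat \<Rightarrow> real"
  assumes "\<And>n. \<bar>c n\<bar> \<le> 1 / fact n"
  shows "summable (\<lambda>n. c n * z ^ n)"
proof (rule summable_comparison_test')
  show "summable (\<lambda>n. inverse (fact n) * \<bar>z\<bar> ^ n)" by (rule summable_exp)
  show "norm (c n * z ^ n) \<le> inverse (fact n) * \<bar>z\<bar> ^ n" for n
    using mult_right_mono[OF assms[of n], of "\<bar>z\<bar> ^ n"]
    by (simp add: abs_mult power_abs inverse_eq_divide)
qed

lemma inverse_fact_products:
  "\<bar>1 / (fact n)^2 :: real\<bar> \<le> 1 / fact n" "\<bar>1 / (fact n * fact (Suc n)) :: real\<bar> \<le> 1 / fact n"
proof -
  have 1: "(1::real) \<le> fact m" for m by (rule fact_ge_1)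
  have "(fact n :: real) \<le> (fact n)^2" using mult_left_mono[OF 1[of n], of "fact n"] by (simp add: power2_eq_square)
  then show "\<bar>1 / (fact n)^2 :: real\<bar> \<le> 1 / fact n" by (simp add: frac_le)
  have "(fact n :: real) \<le> fact n * fact (Suc n)" using mult_left_mono[OF 1[of "Suc n"], of "fact n"] by simp
  then show "\<bar>1 / (fact n * fact (Suc n)) :: real\<bar> \<le> 1 / fact n" 
    by (simp add: frac_le del: fact_Suc)
qed

lemma J0_deriv: "(J0 has_real_derivative J1 z) (at z)"
proof -
  have "diffs (\<lambda>n. 1 / (fact n)^2) = (\<lambda>n. 1 / (fact n * fact (Suc n)) :: real)"
    by (rule ext) (simp add: diffs_def power2_eq_square divide_simps del: of_nat_Suc)
  moreover have "((\<lambda>x. \<Sum>n. (1 / (fact n)^2) * x ^ n) has_real_derivative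
      (\<Sum>n. diffs (\<lambda>n. 1 / (fact n)^2) n * z ^ n)) (at z)"
    by (rule termdiffs_strong_converges_everywhere)
      (rule summable_fact_bound, rule inverse_fact_products)
  ultimately show ?thesis by (simp add: J0_def[abs_def] J1_def)
qed

text \<open>The relation says that \<open>z * J1 z\<close> has derivative \<open>J0 z\<close>, which
  is Bessel's equation in first-order form. It is read off from the power series of
  \<open>z * J1 z\<close>.\<close>

lemma J1_deriv:
  obtains D where "(J1 has_real_derivative D) (at z)" "J1 z + z * D = J0 z"
proof -
  define c where "c n = 1 / (fact n * fact (Suc n) :: real)" for n
  \<comment> \<open>The coefficients of \<open>z * J1 z\<close>, that is, those of \<open>J1\<close>
    shifted by one.\<close>
  define d where "d n = (case n of 0 \<Rightarrow> 0 | Suc m \<Rightarrow> c m)" for n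
  have sc: "summable (\<lambda>n. c n * y ^ n)" for y
    unfolding c_def by (rule summable_fact_bound, rule inverse_fact_products)
  have sd: "summable (\<lambda>n. d n * y ^ n)" for y
    using summable_mult[OF sc, of y y] by (subst summable_Suc_iff[symmetric]) (simp add: d_def mult.left_commute)
  have E: "(\<Sum>n. d n * y ^ n) = y * J1 y" for y
  proof -
    have "(\<Sum>n. d n * y ^ n) = (\<Sum>n. d (Suc n) * y ^ Suc n)"
      using suminf_split_head[OF sd, of y] by (simp add: d_def)
    also have "\<dots> = y * (\<Sum>n. c n * y ^ n)"
      by (subst suminf_mult[OF sc, symmetric]) (simp add: d_def mult.left_commute)
    finally show ?thesis by (simp add: J1_def c_def)
  qed
  have "diffs d = (\<lambda>n. 1 / (fact n)^2)"
    by (rule ext) (simp add: diffs_def d_def c_def power2_eq_square divide_simps del: of_nat_Suc)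
  moreover have "((\<lambda>x. \<Sum>n. d n * x ^ n) has_real_derivative (\<Sum>n. diffs d n * z ^ n)) (at z)"
    by (rule termdiffs_strong_converges_everywhere) (rule sd)
  ultimately have D0: "((\<lambda>y. y * J1 y) has_real_derivative J0 z) (at z)"
    by (simp add: J0_def E)
  have "((\<lambda>x. \<Sum>n. c n * x ^ n) has_real_derivative (\<Sum>n. diffs c n * z ^ n)) (at z)"
    by (rule termdiffs_strong_converges_everywhere) (rule sc)
  then have J1: "(J1 has_real_derivative (\<Sum>n. diffs c n * z ^ n)) (at z)"
    by (simp add: J1_def[abs_def] c_def)
  have "((\<lambda>y. y * J1 y) has_real_derivative J1 z + z * (\<Sum>n. diffs c n * z ^ n)) (at z)"
    by (rule derivative_eq_intros J1 refl | simp)+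
  then have "J1 z + z * (\<Sum>n. diffs c n * z ^ n) = J0 z" using D0 by (rule DERIV_unique)
  with J1 show ?thesis by (rule that)
qed

text \<open>
  For slownesses \<open>s1\<close> and \<open>s2\<close> the functions \<open>wave_l\<close>, \<open>wave_r\<close> below solve
  \<open>P_x = s1 P_t + (s1 + s2) A Q\<close>, \<open>Q_x = - s2 Q_t + (s1 + s2) B P\<close>, \<open>P t 0 = Q t 0 = g t\<close>.
  In the characteristic coordinates \<open>p = s1 x - s\<close>, \<open>q = s2 x + s\<close>, where \<open>s\<close> is the shift of the
  argument of \<open>g\<close>, their kernels have to satisfy \<open>K1_q = A K2\<close>, \<open>K2_p = B K1\<close>, \<open>K1 p 0 = A\<close>,
  \<open>K2 0 q = B\<close>. The power series solution is \<open>K1 p q = ker A B p q\<close>, \<open>K2 p q = ker B A q p\<close>.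
\<close>

definition ker :: "real \<Rightarrow> real \<Rightarrow> real \<Rightarrow> real \<Rightarrow> real" where
  "ker A B p q = A * J0 (A * B * p * q) + A * B * q * J1 (A * B * p * q)"

text \<open>One Goursat equation gives both: the equation for \<open>K2\<close> in \<open>p\<close>
  is this one with \<open>A\<close>, \<open>B\<close> and \<open>p\<close>, \<open>q\<close>
  exchanged. The computation reduces to the relation between \<open>J1\<close> and
  \<open>J0\<close>.\<close>

lemma ker_deriv: "((\<lambda>q. ker A B p q) has_real_derivative A * ker B A q p) (at q)"
proof -
  define z where "z = A * B * p * q"
  obtain D where D: "(J1 has_real_derivative D) (at z)" "J1 z + z * D = J0 z" by (rule J1_deriv)
  have h: "((\<lambda>q. A * B * p * q) has_real_derivative A * B * p) (at q)"
    using DERIV_cmult_Id[of "A * B * p" q] by simp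
  have "((\<lambda>q. J0 (A * B * p * q)) has_real_derivative J1 z * (A * B * p)) (at q)"
    using DERIV_chain2[OF J0_deriv h] by (simp add: z_def)
  note 0 = DERIV_cmult[OF this, of A]
  have "((\<lambda>q. J1 (A * B * p * q)) has_real_derivative D * (A * B * p)) (at q)"
    using DERIV_chain2[OF _ h, of J1 D] D(1) by (simp add: z_def)
  note 1 = DERIV_mult[OF DERIV_cmult_Id[of "A * B" q] this]
  have "((\<lambda>q. ker A B p q) has_real_derivative
      A * (J1 z * (A * B * p)) + (A * B * J1 z + A * B * q * (D * (A * B * p)))) (at q)"
    using DERIV_add[OF 0 1] by (simp add: ker_def z_def algebra_simps)
  moreover have "A * (J1 z * (A * B * p)) + (A * B * J1 z + A * B * q * (D * (A * B * p)))
     = A * (J1 z * (A * B * p)) + A * B * (J1 z + z * D)"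
    by (simp add: z_def algebra_simps)
  moreover have "\<dots> = A * ker B A q p"
    by (simp only: D(2)) (simp add: ker_def z_def algebra_simps)
  ultimately show ?thesis by simp
qed

lemma ker_0_right [simp]: "ker A B p 0 = A"
proof -
  have "J0 0 = 1" unfolding J0_def by (subst powser_zero) simp
  then show ?thesis by (simp add: ker_def)
qed

lemma continuous_on_ker [continuous_intros]:
  assumes "continuous_on S f" "continuous_on S g"
  shows "continuous_on S (\<lambda>x. ker A B (f x) (g x))"
proof -
  have "continuous_on UNIV J0"
    by (intro continuous_at_imp_continuous_on ballI DERIV_isCont[OF J0_deriv])
  moreover have "continuous_on UNIV J1"
    by (intro continuous_at_imp_continuous_on ballI) (rule J1_deriv, rule DERIV_isCont)
  ultimately show ?thesis
    unfolding ker_def using assms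
    by (intro continuous_intros continuous_on_compose2[where f = "\<lambda>x. A * B * f x * g x"]) auto
qed

lemma borel_measurable_ker [measurable]:
  assumes [measurable]: "f \<in> borel_measurable M" "g \<in> borel_measurable M"
  shows "(\<lambda>x. ker A B (f x) (g x)) \<in> borel_measurable M"
proof -
  have "(\<lambda>z. ker A B (fst z) (snd z)) \<in> borel_measurable (borel :: (real \<times> real) measure)"
    by (intro borel_measurable_continuous_onI continuous_intros)
  then have "(\<lambda>x. (\<lambda>z. ker A B (fst z) (snd z)) (f x, g x)) \<in> borel_measurable M"
    by (rule measurable_compose[rotated]) measurable
  then show ?thesis by simp
qed

lemma ker_bound:
  obtains M where "M > 0" "\<And>p q. p \<in> {0..c} \<Longrightarrow> q \<in> {0..c} \<Longrightarrow> \<bar>ker A B p q\<bar> \<le> M"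
proof -
  have "compact ((\<lambda>z. ker A B (fst z) (snd z)) ` ({0..c} \<times> {0..c}))"
    by (intro compact_continuous_image continuous_intros compact_Times) auto
  then have "bounded ((\<lambda>z. ker A B (fst z) (snd z)) ` ({0..c} \<times> {0..c}))" by (rule compact_imp_bounded)
  then obtain M where "M > 0" "\<forall>y\<in>(\<lambda>z. ker A B (fst z) (snd z)) ` ({0..c} \<times> {0..c}). norm y \<le> M"
    unfolding bounded_pos by (elim exE conjE)
  then show ?thesis by (intro that[of M]) (simp_all add: ball_simps(9))
qed

section \<open>Interval integrals, the Leibniz rule with a moving endpoint, and C^1 test
  functions\<close>

lemma LINT_Ioo_eq_integral:
  fixes f :: "real \<Rightarrow> real"
  assumes "continuous_on {a..b} f"
  shows "(LBINT x:{a<..<b}. f x) = integral {a..b} f"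
proof -
  have "set_integrable lborel {a<..<b} f"
    using borel_integrable_atLeastAtMost'[OF assms] by (rule set_integrable_subset) auto
  then show ?thesis
    by (simp add: set_borel_integral_eq_integral(2) integral_open_interval_real)
qed

lemma LINT_Ioo_reflect:
  fixes f :: "real \<Rightarrow> real"
  shows "(LBINT p:{0<..<c}. f (c - p)) = (LBINT p:{0<..<c}. f p)"
  unfolding set_lebesgue_integral_def
  by (subst (2) lborel_integral_real_affine[where c = "-1" and t = c])
    (auto intro!: Bochner_Integration.integral_cong simp: indicator_def)

lemma LINT_Ioo_scale:
  fixes f :: "real \<Rightarrow> real"
  assumes "y \<ge> 0"
  shows "(LBINT p:{0<..<y}. f p) = y * (LBINT p:{0<..<1}. f (y * p))"
proof (cases "y = 0")
  case False
  then have y: "y > 0" using assms by simp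
  have "(LBINT p:{0<..<y}. f p) = \<bar>y\<bar> *\<^sub>R (LBINT p. indicator {0<..<y} (0 + y * p) *\<^sub>R f (0 + y * p))"
    unfolding set_lebesgue_integral_def by (rule lborel_integral_real_affine) (use y in auto)
  also have "(\<lambda>p. indicator {0<..<y} (0 + y * p) *\<^sub>R f (0 + y * p)) = (\<lambda>p. indicator {0<..<1} p *\<^sub>R f (y * p))"
    using y by (auto simp: indicator_def fun_eq_iff zero_less_mult_iff)
  finally show ?thesis using y by (simp add: set_lebesgue_integral_def)
qed (simp add: set_lebesgue_integral_def)

text \<open>The parameter \<open>z\<close> and the upper limit \<open>y\<close> are first treated as
  independent variables. The partial derivatives come from the Leibniz rule and the fundamental
  theorem, and composing with the map from \<open>x\<close> to \<open>(x, k * x)\<close> adds them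
  up.\<close>

lemma has_real_derivative_integral_variable_upper:
  fixes F Fz :: "real \<Rightarrow> real \<Rightarrow> real"
  assumes F: "continuous_on UNIV (\<lambda>(p, z). F p z)" and Fz: "continuous_on UNIV (\<lambda>(p, z). Fz p z)"
    and d: "\<And>p z. ((\<lambda>z. F p z) has_real_derivative Fz p z) (at z)"
    and k: "k > 0" and x: "x \<in> {0..X}"
  shows "((\<lambda>x. integral {0..k * x} (\<lambda>p. F p x)) has_real_derivative
     (k * F (k * x) x + integral {0..k * x} (\<lambda>p. Fz p x))) (at x within {0..X})"
proof -
  note cF = continuous_on_compose2[OF F, unfolded split_beta]
  note cFz = continuous_on_compose2[OF Fz, unfolded split_beta]
  have "((\<lambda>(z, y). integral {0..y} (\<lambda>p. F p z)) has_derivative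
     (\<lambda>(tz, ty). blinfun_mult_right (integral {0..k * x} (\<lambda>p. Fz p x)) tz + blinfun_mult_right (F (k * x) x) ty))
     (at (x, k * x) within UNIV \<times> {0..k * X})"
  proof (rule has_derivative_partialsI[where fy = "\<lambda>z y. blinfun_mult_right (F y z)"])
    show "((\<lambda>z. integral {0..k * x} (\<lambda>p. F p z)) has_derivative
        blinfun_mult_right (integral {0..k * x} (\<lambda>p. Fz p x))) (at x within UNIV)"
      unfolding has_field_derivative_eq_has_derivative_blinfun[symmetric] box_real(2)[symmetric]
    proof (rule leibniz_rule_field_derivative)
      show "((\<lambda>z. F t z) has_real_derivative Fz t z) (at z within UNIV)" for z t
        using d by simp
      show "(\<lambda>p. F p z) integrable_on cbox 0 (k * x)" for z
        by (rule integrable_continuous) (rule cF[of _ "\<lambda>p. (p, z)", simplified], intro continuous_intros)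
      show "continuous_on (UNIV \<times> cbox 0 (k * x)) (\<lambda>(z, t). Fz t z)"
        unfolding split_beta by (rule cFz[of _ "\<lambda>w. (snd w, fst w)", simplified]) (intro continuous_intros)
    qed auto
    show "((\<lambda>y. integral {0..y} (\<lambda>p. F p z)) has_derivative blinfun_mult_right (F y z)) (at y within {0..k * X})"
      if "y \<in> {0..k * X}" for z y
      unfolding has_field_derivative_eq_has_derivative_blinfun[symmetric]
      by (rule integral_has_real_derivative[OF _ that])
        (rule cF[of _ "\<lambda>p. (p, z)", simplified], intro continuous_intros)
    have "continuous_on UNIV (\<lambda>w. F (snd w) (fst w))"
      by (rule cF[of _ "\<lambda>w. (snd w, fst w)", simplified]) (intro continuous_intros)
    then have "continuous_on UNIV (\<lambda>(z, y). blinfun_mult_right (F y z))"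
      unfolding split_beta by (intro continuous_intros)
    then show "continuous (at (x, k * x) within UNIV \<times> {0..k * X}) (\<lambda>(z, y). blinfun_mult_right (F y z))"
      by (metis UNIV_I continuous_on_eq_continuous_within continuous_on_subset top_greatest UNIV_Times_UNIV
          continuous_within_subset)
  qed (use x k in auto)
  then have D: "((\<lambda>(z, y). integral {0..y} (\<lambda>p. F p z)) has_derivative
     (\<lambda>(tz, ty). blinfun_mult_right (integral {0..k * x} (\<lambda>p. Fz p x)) tz + blinfun_mult_right (F (k * x) x) ty))
     (at (x, k * x) within (\<lambda>x. (x, k * x)) ` {0..X})"
    by (rule has_derivative_subset) (use k in auto)
  have "((\<lambda>x. (x, k * x)) has_derivative (\<lambda>h. (h, k * h))) (at x within {0..X})"
    by (auto intro!: derivative_eq_intros)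
  from has_derivative_in_compose[OF this D]
  have "((\<lambda>x. integral {0..k * x} (\<lambda>p. F p x)) has_derivative
     (\<lambda>h. h * integral {0..k * x} (\<lambda>p. Fz p x) + k * h * F (k * x) x)) (at x within {0..X})"
    by (simp add: mult.commute)
  moreover have "(\<lambda>h. h * integral {0..k * x} (\<lambda>p. Fz p x) + k * h * F (k * x) x)
     = (*) (k * F (k * x) x + integral {0..k * x} (\<lambda>p. Fz p x))"
    by (auto simp: fun_eq_iff algebra_simps)
  ultimately show ?thesis by (simp add: has_field_derivative_def)
qed

text \<open>Total differentiability on the closed rectangle, edges and corners included, follows
  from the two one-variable derivatives and the continuity of \<open>\<phi>x\<close>.\<close>

lemma C1_testI:
  assumes T: "\<And>t x. t \<in> {0..T} \<Longrightarrow> x \<in> {0..L} \<Longrightarrow> ((\<lambda>t. \<phi> t x) has_real_derivative \<phi>t t x) (at t within {0..T})"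
    and X: "\<And>t x. t \<in> {0..T} \<Longrightarrow> x \<in> {0..L} \<Longrightarrow> ((\<lambda>x. \<phi> t x) has_real_derivative \<phi>x t x) (at x within {0..L})"
    and ct: "continuous_on ({0..T} \<times> {0..L}) (\<lambda>p. \<phi>t (fst p) (snd p))"
    and cx: "continuous_on ({0..T} \<times> {0..L}) (\<lambda>p. \<phi>x (fst p) (snd p))"
  shows "C1_test T L \<phi> \<phi>t \<phi>x"
  unfolding C1_test_def
proof (intro conjI ballI ct cx)
  fix t x assume tx: "t \<in> {0..T}" "x \<in> {0..L}"
  have "((\<lambda>(t, x). \<phi> t x) has_derivative
     (\<lambda>(tt, tx). (\<lambda>h. \<phi>t t x * h) tt + blinfun_mult_right (\<phi>x t x) tx)) (at (t, x) within {0..T} \<times> {0..L})"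
  proof (rule has_derivative_partialsI[where fy = "\<lambda>t x. blinfun_mult_right (\<phi>x t x)"])
    show "((\<lambda>t. \<phi> t x) has_derivative (\<lambda>h. \<phi>t t x * h)) (at t within {0..T})"
      using T[OF tx] by (simp add: has_field_derivative_def)
    show "((\<lambda>x. \<phi> t x) has_derivative blinfun_mult_right (\<phi>x t x)) (at x within {0..L})"
      if "t \<in> {0..T}" "x \<in> {0..L}" for t x
      using X[OF that] by (simp add: has_field_derivative_def)
    have "continuous_on ({0..T} \<times> {0..L}) (\<lambda>(t, x). blinfun_mult_right (\<phi>x t x))"
      unfolding split_beta by (intro continuous_intros cx)
    then show "continuous (at (t, x) within {0..T} \<times> {0..L}) (\<lambda>(t, x). blinfun_mult_right (\<phi>x t x))"
      using tx by (simp add: continuous_on_eq_continuous_within)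
  qed (use tx in auto)
  then show "((\<lambda>p. \<phi> (fst p) (snd p)) has_derivative (\<lambda>h. \<phi>t t x * fst h + \<phi>x t x * snd h))
     (at (t, x) within {0..T} \<times> {0..L})"
    by (simp add: case_prod_unfold)
qed

section \<open>The wave formulas as classical solutions of the sideways system\<close>

definition wave_l :: "real \<Rightarrow> real \<Rightarrow> real \<Rightarrow> real \<Rightarrow> (real \<Rightarrow> real) \<Rightarrow> real \<Rightarrow> real \<Rightarrow> real" where
  "wave_l s1 s2 A B g t x = g (t + s1 * x) +
     (LBINT p:{0<..<(s1 + s2) * x}. ker A B p ((s1 + s2) * x - p) * g (t + s1 * x - p))"

text \<open>Reversing time exchanges the two components.\<close>

definition wave_r :: "real \<Rightarrow> real \<Rightarrow> real \<Rightarrow> real \<Rightarrow> (real \<Rightarrow> real) \<Rightarrow> real \<Rightarrow> real \<Rightarrow> real" where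
  "wave_r s1 s2 A B g t x = wave_l s2 s1 B A (\<lambda>s. g (- s)) (- t) x"

text \<open>Here the integral runs over the same variable \<open>p\<close> as in
  \<open>wave_l\<close>; this is the integral that appears when the kernel of \<open>wave_l\<close>
  is differentiated in \<open>x\<close>.\<close>

lemma wave_r_altdef:
  "wave_r s1 s2 A B g t x = g (t - s2 * x) +
     (LBINT p:{0<..<(s1 + s2) * x}. ker B A ((s1 + s2) * x - p) p * g (t + s1 * x - p))"
proof -
  have "(LBINT p:{0<..<(s1 + s2) * x}. ker B A ((s1 + s2) * x - p) p * g (t + s1 * x - p))
      = (LBINT p:{0<..<(s1 + s2) * x}. ker B A p ((s1 + s2) * x - p) * g (- (- t + s2 * x - p)))"
    by (subst LINT_Ioo_reflect[symmetric]) (simp add: algebra_simps)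
  then show ?thesis by (simp add: wave_r_def wave_l_def add.commute)
qed

lemma wave_l_uminus: "wave_l s1 s2 A B (\<lambda>s. - g s) t x = - wave_l s1 s2 A B g t x"
  by (simp add: wave_l_def set_lebesgue_integral_def)

text \<open>Rescaling the integral to \<open>(0, 1)\<close> moves the dependence on \<open>x\<close>
  from the domain into the integrand.\<close>

lemma continuous_on_wave_l:
  assumes g: "continuous_on UNIV g" and k: "s1 + s2 > 0"
  shows "continuous_on (UNIV \<times> {0..}) (\<lambda>w. wave_l s1 s2 A B g (fst w) (snd w))"
proof -
  define k where "k = s1 + s2"
  define F where "F w \<theta> = ker A B (k * snd w * \<theta>) (k * snd w - k * snd w * \<theta>) *
     g (fst w + s1 * snd w - k * snd w * \<theta>)" for w :: "real \<times> real" and \<theta>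
  have cF: "continuous_on UNIV (\<lambda>(w, \<theta>). F w \<theta>)"
    unfolding F_def split_beta
    by (intro continuous_intros continuous_on_compose2[OF g]) auto
  have cF1: "continuous_on S (F w)" for w S
    unfolding F_def by (intro continuous_intros continuous_on_compose2[OF g]) auto
  have "continuous_on UNIV (\<lambda>w. integral (cbox 0 1) (F w))"
    by (rule integral_continuous_on_param) (use cF continuous_on_subset in blast)
  then have "continuous_on (UNIV \<times> {0..}) (\<lambda>w. g (fst w + s1 * snd w) + k * snd w * integral {0..1} (F w))"
    unfolding box_real(2)
    by (intro continuous_intros continuous_on_compose2[OF g]) (auto intro: continuous_on_subset)
  moreover have "wave_l s1 s2 A B g (fst w) (snd w) = g (fst w + s1 * snd w) + k * snd w * integral {0..1} (F w)"
    if "w \<in> UNIV \<times> {0..}" for w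
    unfolding wave_l_def
    by (subst LINT_Ioo_scale) (use that k in \<open>auto simp: k_def[symmetric] LINT_Ioo_eq_integral[OF cF1, symmetric] F_def\<close>)
  ultimately show ?thesis by (subst continuous_on_cong[OF refl]) auto
qed

lemma continuous_on_wave_r:
  assumes g: "continuous_on UNIV g" and k: "s1 + s2 > 0"
  shows "continuous_on (UNIV \<times> {0..}) (\<lambda>w. wave_r s1 s2 A B g (fst w) (snd w))"
proof -
  have "continuous_on UNIV (\<lambda>s. g (- s))"
    by (intro continuous_on_compose2[OF g] continuous_intros) auto
  from continuous_on_wave_l[OF this, of s2 s1 B A]
  have "continuous_on (UNIV \<times> {0..}) (\<lambda>w. wave_l s2 s1 B A (\<lambda>s. g (- s)) (fst w) (snd w))"
    using k by (simp add: add.commute)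
  moreover have "continuous_on (UNIV \<times> {0..}) (\<lambda>w::real \<times> real. (- fst w, snd w))"
    by (intro continuous_intros)
  moreover have "(\<lambda>w::real \<times> real. (- fst w, snd w)) ` (UNIV \<times> {0..}) \<subseteq> UNIV \<times> {0..}" by auto
  ultimately show ?thesis
    unfolding wave_r_def using continuous_on_compose2 by fastforce
qed

lemma wave_l_continuous_integrand:
  assumes "continuous_on UNIV g"
  shows "continuous_on S (\<lambda>p. ker A B p (c - p) * g (d - p))"
    and "continuous_on S (\<lambda>p. ker A B (c - p) p * g (d - p))"
  by (intro continuous_intros continuous_on_compose2[OF assms]; simp)+

lemma wave_l_dt:
  assumes g: "\<And>s. (g has_real_derivative g' s) (at s)" and g': "continuous_on UNIV g'"
  shows "((\<lambda>t. wave_l s1 s2 A B g t x) has_real_derivative wave_l s1 s2 A B g' t x) (at t)"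
proof -
  define c where "c = (s1 + s2) * x"
  have cg: "continuous_on UNIV g"
    by (intro continuous_at_imp_continuous_on ballI DERIV_isCont[OF g])
  have shift: "((\<lambda>t. g (t + d)) has_real_derivative g' (t + d)) (at t)" for t d
  proof -
    have "((\<lambda>t. t + d) has_real_derivative 1) (at t)" by (auto intro!: derivative_eq_intros)
    from DERIV_chain2[OF g this] show ?thesis by simp
  qed
  have "((\<lambda>t. integral (cbox 0 c) (\<lambda>p. ker A B p (c - p) * g (t + (s1 * x - p)))) has_real_derivative
     integral (cbox 0 c) (\<lambda>p. ker A B p (c - p) * g' (t + (s1 * x - p)))) (at t within UNIV)"
  proof (rule leibniz_rule_field_derivative)
    show "((\<lambda>t. ker A B p (c - p) * g (t + (s1 * x - p))) has_real_derivative ker A B p (c - p) * g' (t + (s1 * x - p))) (at t within UNIV)" for t p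
      using DERIV_cmult[OF shift] by simp
    show "(\<lambda>p. ker A B p (c - p) * g (t + (s1 * x - p))) integrable_on cbox 0 c" for t
      by (intro integrable_continuous continuous_intros continuous_on_compose2[OF cg]) auto
    show "continuous_on (UNIV \<times> cbox 0 c) (\<lambda>(t, p). ker A B p (c - p) * g' (t + (s1 * x - p)))"
      unfolding split_beta by (intro continuous_intros continuous_on_compose2[OF g']) auto
  qed auto
  from DERIV_add[OF shift[of "s1 * x" t] this]
  show ?thesis
    unfolding wave_l_def c_def[symmetric]
    by (simp add: LINT_Ioo_eq_integral[OF wave_l_continuous_integrand(1)[OF cg]]
        LINT_Ioo_eq_integral[OF wave_l_continuous_integrand(1)[OF g']] add_diff_eq)
qed

text \<open>Three contributions: the shift of \<open>g\<close> gives the term with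
  \<open>g'\<close>, the second argument of the kernel turns into the kernel of
  \<open>wave_r\<close> by \<open>ker_deriv\<close>, and the moving endpoint supplies the leading
  term of \<open>wave_r\<close>. The first kernel argument stays fixed under the integral.\<close>

lemma wave_l_dx:
  assumes g: "\<And>s. (g has_real_derivative g' s) (at s)" and g': "continuous_on UNIV g'"
    and k: "s1 + s2 > 0" and x: "x \<in> {0..X}"
  shows "((\<lambda>x. wave_l s1 s2 A B g t x) has_real_derivative
     s1 * wave_l s1 s2 A B g' t x + (s1 + s2) * A * wave_r s1 s2 A B g t x) (at x within {0..X})"
proof -
  define k where "k = s1 + s2"
  have kpos: "k > 0" using k by (simp add: k_def)
  have cg: "continuous_on UNIV g"
    by (intro continuous_at_imp_continuous_on ballI DERIV_isCont[OF g])
  define F where "F p z = ker A B p (k * z - p) * g (t + s1 * z - p)" for p z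
  define Fz where "Fz p z = A * ker B A (k * z - p) p * k * g (t + s1 * z - p)
      + ker A B p (k * z - p) * (g' (t + s1 * z - p) * s1)" for p z
  have "((\<lambda>x. integral {0..k * x} (\<lambda>p. F p x)) has_real_derivative
     (k * F (k * x) x + integral {0..k * x} (\<lambda>p. Fz p x))) (at x within {0..X})"
  proof (rule has_real_derivative_integral_variable_upper[OF _ _ _ kpos x])
    show "continuous_on UNIV (\<lambda>(p, z). F p z)"
      unfolding split_beta F_def by (intro continuous_intros continuous_on_compose2[OF cg]) auto
    show "continuous_on UNIV (\<lambda>(p, z). Fz p z)"
      unfolding split_beta Fz_def
      by (intro continuous_intros continuous_on_compose2[OF cg] continuous_on_compose2[OF g']) auto
    show "((\<lambda>z. F p z) has_real_derivative Fz p z) (at z)" for p z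
    proof -
      have 1: "((\<lambda>z. k * z - p) has_real_derivative k) (at z)" by (auto intro!: derivative_eq_intros)
      have 2: "((\<lambda>z. t + s1 * z - p) has_real_derivative s1) (at z)" by (auto intro!: derivative_eq_intros)
      show ?thesis
        unfolding F_def Fz_def
        using DERIV_mult[OF DERIV_chain2[OF ker_deriv 1] DERIV_chain2[OF g 2], of A B p]
        by (simp add: algebra_simps)
    qed
  qed
  moreover have "((\<lambda>x. g (t + s1 * x)) has_real_derivative g' (t + s1 * x) * s1) (at x within {0..X})"
    by (rule has_field_derivative_at_within, rule DERIV_chain2[OF g]) (auto intro!: derivative_eq_intros)
  ultimately have "((\<lambda>x. g (t + s1 * x) + integral {0..k * x} (\<lambda>p. F p x)) has_real_derivative
     g' (t + s1 * x) * s1 + (k * F (k * x) x + integral {0..k * x} (\<lambda>p. Fz p x))) (at x within {0..X})"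
    by (rule DERIV_add[rotated])
  moreover have "g (t + s1 * x) + integral {0..k * x} (\<lambda>p. F p x) = wave_l s1 s2 A B g t x" for x
    by (simp add: wave_l_def k_def[symmetric] F_def LINT_Ioo_eq_integral[OF wave_l_continuous_integrand(1)[OF cg]])
  moreover have "g' (t + s1 * x) * s1 + (k * F (k * x) x + integral {0..k * x} (\<lambda>p. Fz p x))
     = s1 * wave_l s1 s2 A B g' t x + k * A * wave_r s1 s2 A B g t x"
  proof -
    have "integral {0..k * x} (\<lambda>p. Fz p x) =
       integral {0..k * x} (\<lambda>p. (k * A) * (ker B A (k * x - p) p * g (t + s1 * x - p)) + 
          s1 * (ker A B p (k * x - p) * g' (t + s1 * x - p)))"
      by (simp add: Fz_def algebra_simps)
    also have "\<dots> = (k * A) * integral {0..k * x} (\<lambda>p. ker B A (k * x - p) p * g (t + s1 * x - p))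
        + s1 * integral {0..k * x} (\<lambda>p. ker A B p (k * x - p) * g' (t + s1 * x - p))"
      by (subst integral_add)
        (simp_all add: integrable_continuous_real wave_l_continuous_integrand[OF cg] wave_l_continuous_integrand[OF g'] continuous_intros)
    finally have *: "integral {0..k * x} (\<lambda>p. Fz p x) =
       (k * A) * (LBINT p:{0<..<k * x}. ker B A (k * x - p) p * g (t + s1 * x - p))
        + s1 * (LBINT p:{0<..<k * x}. ker A B p (k * x - p) * g' (t + s1 * x - p))"
      by (simp only: LINT_Ioo_eq_integral[OF wave_l_continuous_integrand(1)[OF g']]
         LINT_Ioo_eq_integral[OF wave_l_continuous_integrand(2)[OF cg]])
    \<comment> \<open>At the endpoint \<open>p = k * x\<close> the kernel has second argument 0 and
      value \<open>A\<close>, while \<open>g\<close> is evaluated at the foot of the other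
      characteristic.\<close>
    have "t + s1 * x - k * x = t - s2 * x" by (simp add: k_def algebra_simps)
    from arg_cong[OF this, of g] have "F (k * x) x = A * g (t - s2 * x)" by (simp add: F_def)
    then show ?thesis
      unfolding wave_l_def wave_r_altdef k_def[symmetric] *
      by (simp only:) (simp only: distrib_left mult.assoc mult.commute mult.left_commute add.assoc add.commute add.left_commute)
  qed
  ultimately show ?thesis by (simp add: k_def)
qed

lemma reflected_derivative:
  assumes g: "\<And>s. (g has_real_derivative g' s) (at s)"
  shows "((\<lambda>s. g (- s)) has_real_derivative - g' (- s)) (at s)"
  using DERIV_chain2[OF g DERIV_minus[OF DERIV_ident], of s] by simp

lemma wave_r_dt:
  assumes g: "\<And>s. (g has_real_derivative g' s) (at s)" and g': "continuous_on UNIV g'"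
  shows "((\<lambda>t. wave_r s1 s2 A B g t x) has_real_derivative wave_r s1 s2 A B g' t x) (at t)"
proof -
  have c: "continuous_on UNIV (\<lambda>s. - g' (- s))"
    by (intro continuous_intros continuous_on_compose2[OF g']) auto
  from DERIV_chain2[OF wave_l_dt[OF reflected_derivative[OF g] c] DERIV_minus[OF DERIV_ident], of s2 s1 B A x t]
  show ?thesis by (simp add: wave_r_def wave_l_uminus)
qed

lemma wave_r_dx:
  assumes g: "\<And>s. (g has_real_derivative g' s) (at s)" and g': "continuous_on UNIV g'"
    and k: "s1 + s2 > 0" and x: "x \<in> {0..X}"
  shows "((\<lambda>x. wave_r s1 s2 A B g t x) has_real_derivative
     - s2 * wave_r s1 s2 A B g' t x + (s1 + s2) * B * wave_l s1 s2 A B g t x) (at x within {0..X})"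
proof -
  have c: "continuous_on UNIV (\<lambda>s. - g' (- s))"
    by (intro continuous_intros continuous_on_compose2[OF g']) auto
  have k': "s2 + s1 > 0" using k by simp
  from wave_l_dx[OF reflected_derivative[OF g] c k' x, of B A "- t"]
  show ?thesis by (simp add: wave_r_def wave_l_uminus add.commute)
qed

section \<open>The weak formulation and its validity for classical solutions\<close>

definition weak_identity ::
  "real \<Rightarrow> real \<Rightarrow> real \<Rightarrow> (real \<Rightarrow> real \<Rightarrow> real) \<Rightarrow> (real \<Rightarrow> real \<Rightarrow> real) \<Rightarrow> (real \<Rightarrow> real) \<Rightarrow> (real \<Rightarrow> real) \<Rightarrow>
     (real \<Rightarrow> real \<Rightarrow> real) \<Rightarrow> (real \<Rightarrow> real \<Rightarrow> real) \<Rightarrow> (real \<Rightarrow> real \<Rightarrow> real) \<Rightarrow> bool" where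
  "weak_identity T L c y f y0 yL \<phi> \<phi>t \<phi>x \<longleftrightarrow>
        (LBINT x:{0<..<L}. y T x * \<phi> T x) - (LBINT x:{0<..<L}. y 0 x * \<phi> 0 x)
        + c * (LBINT t:{0<..<T}. yL t * \<phi> t L - y0 t * \<phi> t 0)
        = (LBINT t:{0<..<T}. LBINT x:{0<..<L}.
             y t x * (\<phi>t t x + c * \<phi>x t x) - f t x * \<phi> t x)"

text \<open>Isolating a single test function allows \<open>T\<close> and \<open>\<phi>\<close> to be
  fixed while a sequence of solutions converges.\<close>

lemma weak_transport_iff:
  "weak_transport L c y f y0 yL \<longleftrightarrow>
     (\<forall>T>0. \<forall>\<phi> \<phi>t \<phi>x. C1_test T L \<phi> \<phi>t \<phi>x \<longrightarrow> weak_identity T L c y f y0 yL \<phi> \<phi>t \<phi>x)"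
  by (simp add: weak_transport_def weak_identity_def)

lemma C1_test_continuous:
  assumes "C1_test T L \<phi> \<phi>t \<phi>x"
  shows "continuous_on ({0..T} \<times> {0..L}) (\<lambda>w. \<phi> (fst w) (snd w))"
    "continuous_on ({0..T} \<times> {0..L}) (\<lambda>w. \<phi>t (fst w) (snd w))"
    "continuous_on ({0..T} \<times> {0..L}) (\<lambda>w. \<phi>x (fst w) (snd w))"
proof -
  show "continuous_on ({0..T} \<times> {0..L}) (\<lambda>w. \<phi> (fst w) (snd w))"
  proof (rule has_derivative_continuous_on)
    fix w assume "w \<in> {0..T} \<times> {0..L}"
    then show "((\<lambda>w. \<phi> (fst w) (snd w)) has_derivative (\<lambda>h. \<phi>t (fst w) (snd w) * fst h + \<phi>x (fst w) (snd w) * snd h))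
        (at w within {0..T} \<times> {0..L})"
      using assms by (cases w) (auto simp: C1_test_def)
  qed
qed (use assms in \<open>auto simp: C1_test_def\<close>)

lemma C1_test_partials:
  assumes "C1_test T L \<phi> \<phi>t \<phi>x" and tx: "t \<in> {0..T}" "x \<in> {0..L}"
  shows "((\<lambda>t. \<phi> t x) has_real_derivative \<phi>t t x) (at t within {0..T})"
    and "((\<lambda>x. \<phi> t x) has_real_derivative \<phi>x t x) (at x within {0..L})"
proof -
  have d: "((\<lambda>w. \<phi> (fst w) (snd w)) has_derivative (\<lambda>h. \<phi>t t x * fst h + \<phi>x t x * snd h))
        (at (t, x) within {0..T} \<times> {0..L})"
    using assms by (auto simp: C1_test_def)
  have st: "(\<lambda>t. (t, x)) ` {0..T} \<subseteq> {0..T} \<times> {0..L}"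
    and sx: "(\<lambda>x. (t, x)) ` {0..L} \<subseteq> {0..T} \<times> {0..L}" using tx by auto
  have "((\<lambda>t. (t, x)) has_derivative (\<lambda>h. (h, 0))) (at t within {0..T})"
    by (auto intro!: derivative_eq_intros)
  from has_derivative_in_compose[OF this has_derivative_subset[OF d st]]
  have "((\<lambda>t. \<phi> t x) has_derivative (\<lambda>h. \<phi>t t x * h)) (at t within {0..T})" by simp
  then show "((\<lambda>t. \<phi> t x) has_real_derivative \<phi>t t x) (at t within {0..T})"
    by (simp add: has_field_derivative_def)
  have "((\<lambda>x. (t, x)) has_derivative (\<lambda>h. (0, h))) (at x within {0..L})"
    by (auto intro!: derivative_eq_intros)
  from has_derivative_in_compose[OF this has_derivative_subset[OF d sx]]
  have "((\<lambda>x. \<phi> t x) has_derivative (\<lambda>h. \<phi>x t x * h)) (at x within {0..L})" by simp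
  then show "((\<lambda>x. \<phi> t x) has_real_derivative \<phi>x t x) (at x within {0..L})"
    by (simp add: has_field_derivative_def)
qed

lemma continuous_on_rectangle_slices:
  fixes v :: "real \<Rightarrow> real \<Rightarrow> real"
  assumes "continuous_on (S \<times> S') (\<lambda>w. v (fst w) (snd w))"
  shows "x \<in> S' \<Longrightarrow> continuous_on S (\<lambda>t. v t x)" and "t \<in> S \<Longrightarrow> continuous_on S' (v t)"
proof -
  show "continuous_on S (\<lambda>t. v t x)" if "x \<in> S'"
    by (rule continuous_on_compose2[OF assms, of S "\<lambda>t. (t, x)", unfolded fst_conv snd_conv])
      (use that in \<open>auto intro!: continuous_intros\<close>)
  show "continuous_on S' (v t)" if "t \<in> S"
    by (rule continuous_on_compose2[OF assms, of S' "\<lambda>x. (t, x)", unfolded fst_conv snd_conv])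
      (use that in \<open>auto intro!: continuous_intros\<close>)
qed

lemma continuous_on_rectangle_integral:
  fixes v :: "real \<Rightarrow> real \<Rightarrow> real"
  assumes "continuous_on (S \<times> {a..b}) (\<lambda>w. v (fst w) (snd w))"
  shows "continuous_on S (\<lambda>t. LBINT x:{a<..<b}. v t x)"
proof -
  have "continuous_on S (\<lambda>t. integral (cbox a b) (v t))"
    by (rule integral_continuous_on_param) (use assms in \<open>simp add: split_beta\<close>)
  then show ?thesis
    by (subst continuous_on_cong[OF refl LINT_Ioo_eq_integral])
      (auto intro: continuous_on_rectangle_slices(2)[OF assms])
qed

text \<open>The fundamental theorem of calculus in each variable, with the order of integration
  exchanged for the continuous integrand \<open>vt\<close>.\<close>

lemma Green_rectangle:
  fixes v vt vx :: "real \<Rightarrow> real \<Rightarrow> real"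
  assumes T: "T \<ge> 0" and L: "L \<ge> 0"
    and dt: "\<And>t x. t \<in> {0..T} \<Longrightarrow> x \<in> {0..L} \<Longrightarrow> ((\<lambda>t. v t x) has_real_derivative vt t x) (at t within {0..T})"
    and dx: "\<And>t x. t \<in> {0..T} \<Longrightarrow> x \<in> {0..L} \<Longrightarrow> ((\<lambda>x. v t x) has_real_derivative vx t x) (at x within {0..L})"
    and cv: "continuous_on ({0..T} \<times> {0..L}) (\<lambda>w. v (fst w) (snd w))"
    and ct: "continuous_on ({0..T} \<times> {0..L}) (\<lambda>w. vt (fst w) (snd w))"
    and cx: "continuous_on ({0..T} \<times> {0..L}) (\<lambda>w. vx (fst w) (snd w))"
  shows "(LBINT x:{0<..<L}. v T x) - (LBINT x:{0<..<L}. v 0 x)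
        + c * (LBINT t:{0<..<T}. v t L - v t 0)
        = (LBINT t:{0<..<T}. LBINT x:{0<..<L}. vt t x + c * vx t x)"
proof -
  have slice: "continuous_on {0..L} (v T)" "continuous_on {0..L} (v 0)"
    "continuous_on {0..T} (\<lambda>t. v t L)" "continuous_on {0..T} (\<lambda>t. v t 0)"
    using T L by (auto intro: continuous_on_rectangle_slices[OF cv])
  have ft: "integral {0..T} (\<lambda>t. vt t x) = v T x - v 0 x" if "x \<in> {0..L}" for x
    using T that by (intro integral_unique fundamental_theorem_of_calculus)
      (auto simp: has_real_derivative_iff_has_vector_derivative[symmetric] intro!: dt)
  have fx: "integral {0..L} (vx t) = v t L - v t 0" if "t \<in> {0..T}" for t
    using L that by (intro integral_unique fundamental_theorem_of_calculus)
      (auto simp: has_real_derivative_iff_has_vector_derivative[symmetric] intro!: dx)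
  have intt: "continuous_on {0..T} (\<lambda>t. integral {0..L} (vt t))" "continuous_on {0..T} (\<lambda>t. integral {0..L} (vx t))"
    using integral_continuous_on_param[of "{0..T}" 0 L vt] integral_continuous_on_param[of "{0..T}" 0 L vx] ct cx
    by (simp_all add: split_beta)
  have "(LBINT x:{0<..<L}. v T x) - (LBINT x:{0<..<L}. v 0 x) = integral {0..L} (\<lambda>x. v T x - v 0 x)"
    using slice by (simp add: LINT_Ioo_eq_integral integral_diff integrable_continuous_real)
  also have "\<dots> = integral {0..L} (\<lambda>x. integral {0..T} (\<lambda>t. vt t x))"
    by (rule integral_cong) (simp add: ft)
  also have "\<dots> = integral {0..T} (\<lambda>t. integral {0..L} (vt t))"
    using integral_swap_continuous[of 0 0 T L vt] ct
    by (simp add: cbox_Pair_eq split_beta)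
  finally have 1: "(LBINT x:{0<..<L}. v T x) - (LBINT x:{0<..<L}. v 0 x) = integral {0..T} (\<lambda>t. integral {0..L} (vt t))" .
  have "(LBINT t:{0<..<T}. v t L - v t 0) = integral {0..T} (\<lambda>t. v t L - v t 0)"
    using slice by (intro LINT_Ioo_eq_integral continuous_intros)
  also have "\<dots> = integral {0..T} (\<lambda>t. integral {0..L} (vx t))"
    by (rule integral_cong) (simp add: fx)
  finally have 2: "(LBINT t:{0<..<T}. v t L - v t 0) = integral {0..T} (\<lambda>t. integral {0..L} (vx t))" .
  have "(LBINT t:{0<..<T}. LBINT x:{0<..<L}. vt t x + c * vx t x)
     = integral {0..T} (\<lambda>t. LBINT x:{0<..<L}. vt t x + c * vx t x)"
    by (intro LINT_Ioo_eq_integral continuous_on_rectangle_integral continuous_intros ct cx)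
  also have "\<dots> = integral {0..T} (\<lambda>t. integral {0..L} (vt t) + c * integral {0..L} (vx t))"
  proof (rule integral_cong)
    fix t assume t: "t \<in> {0..T}"
    have s: "continuous_on {0..L} (vt t)" "continuous_on {0..L} (vx t)"
      using t by (auto intro: continuous_on_rectangle_slices(2)[OF ct] continuous_on_rectangle_slices(2)[OF cx])
    have "(LBINT x:{0<..<L}. vt t x + c * vx t x) = integral {0..L} (\<lambda>x. vt t x + c * vx t x)"
      using s by (intro LINT_Ioo_eq_integral continuous_intros)
    also have "\<dots> = integral {0..L} (vt t) + c * integral {0..L} (vx t)"
      using s by (subst integral_add) (auto intro!: integrable_continuous_real continuous_intros)
    finally show "(LBINT x:{0<..<L}. vt t x + c * vx t x) = integral {0..L} (vt t) + c * integral {0..L} (vx t)" .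
  qed
  also have "\<dots> = integral {0..T} (\<lambda>t. integral {0..L} (vt t)) + c * integral {0..T} (\<lambda>t. integral {0..L} (vx t))"
    using intt by (subst integral_add) (auto intro!: integrable_continuous_real continuous_intros)
  finally show ?thesis using 1 2 by simp
qed

text \<open>\<open>Green_rectangle\<close> for the product of \<open>y\<close> and
  \<open>\<phi>\<close>; the differential equation then replaces the derivatives of \<open>y\<close>
  by \<open>f\<close>.\<close>

lemma classical_weak_identity:
  assumes T: "T \<ge> 0" and L: "L \<ge> 0" and y: "C1_test T L y yt yx" and \<phi>: "C1_test T L \<phi> \<phi>t \<phi>x"
    and eq: "\<And>t x. t \<in> {0..T} \<Longrightarrow> x \<in> {0..L} \<Longrightarrow> yt t x + c * yx t x + f t x = 0"
  shows "weak_identity T L c y f (\<lambda>t. y t 0) (\<lambda>t. y t L) \<phi> \<phi>t \<phi>x"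
proof -
  note cont = C1_test_continuous[OF y] C1_test_continuous[OF \<phi>]
  have "(LBINT x:{0<..<L}. y T x * \<phi> T x) - (LBINT x:{0<..<L}. y 0 x * \<phi> 0 x)
        + c * (LBINT t:{0<..<T}. y t L * \<phi> t L - y t 0 * \<phi> t 0)
        = (LBINT t:{0<..<T}. LBINT x:{0<..<L}.
             (yt t x * \<phi> t x + y t x * \<phi>t t x) + c * (yx t x * \<phi> t x + y t x * \<phi>x t x))"
  proof (rule Green_rectangle[OF T L])
    fix t x assume tx: "t \<in> {0..T}" "x \<in> {0..L}"
    show "((\<lambda>t. y t x * \<phi> t x) has_real_derivative yt t x * \<phi> t x + y t x * \<phi>t t x) (at t within {0..T})"
      using DERIV_mult'[OF C1_test_partials(1)[OF y tx] C1_test_partials(1)[OF \<phi> tx]] by (simp add: add.commute)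
    show "((\<lambda>x. y t x * \<phi> t x) has_real_derivative yx t x * \<phi> t x + y t x * \<phi>x t x) (at x within {0..L})"
      using DERIV_mult'[OF C1_test_partials(2)[OF y tx] C1_test_partials(2)[OF \<phi> tx]] by (simp add: add.commute)
  qed (intro continuous_intros cont)+
  also have "\<dots> = (LBINT t:{0<..<T}. LBINT x:{0<..<L}.
             y t x * (\<phi>t t x + c * \<phi>x t x) - f t x * \<phi> t x)"
  proof (intro set_lebesgue_integral_cong allI impI)
    fix t x assume tx: "t \<in> {0<..<T}" "x \<in> {0<..<L}"
    have *: "f t x = - (yt t x + c * yx t x)" using eq[of t x] tx by simp
    show "(yt t x * \<phi> t x + y t x * \<phi>t t x) + c * (yx t x * \<phi> t x + y t x * \<phi>x t x) =
       y t x * (\<phi>t t x + c * \<phi>x t x) - f t x * \<phi> t x"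
      unfolding * by (simp add: algebra_simps)
  qed auto
  finally show ?thesis by (simp add: weak_identity_def)
qed

section \<open>Square-integrable traces\<close>

lemma locsq_reflect: "locsq g \<Longrightarrow> locsq (\<lambda>s. g (- s))"
  and L2_integral_reflect: "(LBINT s:{-R<..<R}. (g (- s) :: real)^2) = (LBINT s:{-R<..<R}. (g s)^2)"
proof -
  have i: "indicator {-R<..<R} (- x) = (indicator {-R<..<R} x :: real)" for R x :: real
    by (auto simp: indicator_def)
  show "(LBINT s:{-R<..<R}. (g (- s))^2) = (LBINT s:{-R<..<R}. (g s)^2)"
    unfolding set_lebesgue_integral_def
    using lborel_integral_real_affine[of "-1" "\<lambda>s. indicator {-R<..<R} s *\<^sub>R (g s)^2" 0] by (simp add: i)
  show "locsq (\<lambda>s. g (- s))" if "locsq g"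
    unfolding locsq_def
  proof (intro conjI allI)
    have [measurable]: "g \<in> borel_measurable borel" using that by (simp add: locsq_def)
    show "(\<lambda>s. g (- s)) \<in> borel_measurable borel" by measurable
    fix R
    have "integrable lborel (\<lambda>s. indicator {-R<..<R} s *\<^sub>R (g s)^2)"
      using that by (simp add: locsq_def L2_on_def set_integrable_def)
    from lborel_integrable_real_affine[OF this, of "-1" 0]
    have "integrable lborel (\<lambda>s. indicator {-R<..<R} s *\<^sub>R (g (- s))^2)" by (simp add: i)
    then show "(\<lambda>s. g (- s)) \<in> L2_on {-R<..<R}"
      by (simp add: L2_on_def set_integrable_def set_borel_measurable_def)
  qed
qed

lemma locsq_diff: "locsq g \<Longrightarrow> locsq h \<Longrightarrow> locsq (\<lambda>s. g s - h s)"
  by (auto simp: locsq_def intro: L2_on_diff borel_measurable_diff)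

lemma locsq_continuous: "continuous_on UNIV g \<Longrightarrow> locsq g"
  by (auto simp: locsq_def intro: borel_measurable_continuous_onI L2_on_continuous continuous_on_subset)

text \<open>The last estimate is Cauchy-Schwarz against the constant 1. It lets the L^2 norm of
  \<open>g\<close> control the integral part of the wave formulas, which is bounded by an L^1
  norm.\<close>

lemma locsq_truncate:
  assumes "locsq g"
  shows "integrable lborel (\<lambda>s. indicator {-R<..<R} s * g s)"
    and "integrable lborel (\<lambda>s. (indicator {-R<..<R} s * g s)^2)"
    and "(LBINT s. (indicator {-R<..<R} s * g s)^2) = (LBINT s:{-R<..<R}. (g s)^2)"
    and "R > 0 \<Longrightarrow> (LBINT s. \<bar>indicator {-R<..<R} s * g s\<bar>)^2 \<le> 2 * R * (LBINT s:{-R<..<R}. (g s)^2)"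
proof -
  have L: "g \<in> L2_on {-R<..<R}" using assms by (simp add: locsq_def)
  have sq: "(\<lambda>s. (indicator {-R<..<R} s * g s)^2) = (\<lambda>s. indicator {-R<..<R} s *\<^sub>R (g s)^2)"
    by (auto simp: indicator_def fun_eq_iff)
  have ab: "(\<lambda>s. \<bar>indicator {-R<..<R} s * g s\<bar>) = (\<lambda>s. indicator {-R<..<R} s *\<^sub>R (1 * \<bar>g s\<bar>))"
    by (auto simp: indicator_def fun_eq_iff)
  show "integrable lborel (\<lambda>s. indicator {-R<..<R} s * g s)"
    using L2_on_integrable[OF L] by (simp add: set_integrable_def)
  show "integrable lborel (\<lambda>s. (indicator {-R<..<R} s * g s)^2)"
    unfolding sq using L by (simp add: L2_on_def set_integrable_def)
  show "(LBINT s. (indicator {-R<..<R} s * g s)^2) = (LBINT s:{-R<..<R}. (g s)^2)"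
    unfolding sq by (simp add: set_lebesgue_integral_def)
  assume R: "R > 0"
  have La: "(\<lambda>s. \<bar>g s\<bar>) \<in> L2_on {-R<..<R}"
  proof -
    have "(\<lambda>s. \<bar>indicator {-R<..<R} s *\<^sub>R g s\<bar>) \<in> borel_measurable lborel"
      using L by (intro borel_measurable_abs) (simp add: L2_on_def set_borel_measurable_def)
    then have "set_borel_measurable lborel {-R<..<R} (\<lambda>s. \<bar>g s\<bar>)"
      by (simp add: set_borel_measurable_def abs_mult)
    then show ?thesis using L by (simp add: L2_on_def)
  qed
  have one: "(\<lambda>_. 1) \<in> L2_on {-R<..<R}" by (intro L2_on_continuous continuous_intros)
  have "(LBINT s:{-R<..<R}. (1::real)^2) = 2 * R"
    using R by (simp add: set_lebesgue_integral_def)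
  with L2_on_Cauchy_Schwarz[OF one La]
  have "\<bar>LBINT s:{-R<..<R}. 1 * \<bar>g s\<bar>\<bar> \<le> sqrt (2 * R) * sqrt (LBINT s:{-R<..<R}. (g s)^2)" by simp
  then have "\<bar>LBINT s:{-R<..<R}. 1 * \<bar>g s\<bar>\<bar>^2 \<le> (sqrt (2 * R) * sqrt (LBINT s:{-R<..<R}. (g s)^2))^2"
    by (intro power_mono) auto
  then show "(LBINT s. \<bar>indicator {-R<..<R} s * g s\<bar>)^2 \<le> 2 * R * (LBINT s:{-R<..<R}. (g s)^2)"
    unfolding ab using R L2_on_integral_nonneg[of "{-R<..<R}" g]
    by (simp add: set_lebesgue_integral_def power_mult_distrib)
qed

text \<open>The hypothesis has the shape of a wave along a line: a transported copy of the trace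
  plus a uniformly bounded integral. The factors come from
  \<open>(u + v)^2 \<le> 2 * u^2 + 2 * v^2\<close> and from the substitution with slope
  \<open>d\<close>.\<close>

lemma L2_on_affine_bound:
  fixes f G :: "real \<Rightarrow> real"
  assumes [measurable]: "f \<in> borel_measurable borel" and G: "integrable lborel (\<lambda>s. (G s)^2)"
    and K: "\<And>x. x \<in> {a<..<b} \<Longrightarrow> \<bar>f x\<bar> \<le> \<bar>G (c + d * x)\<bar> + K" and d: "d > 0" and ab: "a \<le> b"
  shows "f \<in> L2_on {a<..<b}"
    and "(LBINT x:{a<..<b}. (f x)^2) \<le> 2 / d * (LBINT s. (G s)^2) + 2 * K^2 * (b - a)"
proof -
  have iG: "integrable lborel (\<lambda>x. (G (c + d * x))^2)"
    using lborel_integrable_real_affine[OF G] d by simp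
  have i1: "integrable lborel (\<lambda>x. 2 * (G (c + d * x))^2)" using iG by simp
  have "set_integrable lborel {a<..<b} (\<lambda>_. 2 * K^2)"
    using borel_integrable_atLeastAtMost'[of a b "\<lambda>_. 2 * K^2"] by (rule set_integrable_subset) auto
  then have i2: "integrable lborel (\<lambda>x. indicator {a<..<b} x *\<^sub>R (2 * K^2))"
    by (simp only: set_integrable_def)
  let ?w = "\<lambda>x. 2 * (G (c + d * x))^2 + indicator {a<..<b} x *\<^sub>R (2 * K^2)"
  have iw: "integrable lborel ?w" using i1 i2 by (rule Bochner_Integration.integrable_add)
  have bd: "indicator {a<..<b} x *\<^sub>R (f x)^2 \<le> ?w x" for x
  proof (cases "x \<in> {a<..<b}")
    case True
    have "\<bar>f x\<bar>^2 \<le> (\<bar>G (c + d * x)\<bar> + K)^2" using K[OF True] by (intro power_mono) auto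
    also have "\<dots> \<le> 2 * \<bar>G (c + d * x)\<bar>^2 + 2 * K^2"
      using sum_squares_bound[of "\<bar>G (c + d * x)\<bar>" K] by (simp add: power2_sum)
    finally show ?thesis using True by simp
  qed simp
  have i: "integrable lborel (\<lambda>x. indicator {a<..<b} x *\<^sub>R (f x)^2)"
    by (rule Bochner_Integration.integrable_bound[OF iw]) (use bd in \<open>auto intro!: AE_I2 simp: abs_le_iff\<close>)
  then show "f \<in> L2_on {a<..<b}"
    by (simp add: L2_on_def set_integrable_def set_borel_measurable_def)
  have "(LBINT x:{a<..<b}. (f x)^2) \<le> (LBINT x. ?w x)"
    unfolding set_lebesgue_integral_def using i iw bd by (intro integral_mono)
  also have "\<dots> = 2 * (LBINT x. (G (c + d * x))^2) + 2 * K^2 * (b - a)"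
    using i1 i2 iG ab by (subst Bochner_Integration.integral_add) auto
  also have "(LBINT x. (G (c + d * x))^2) = 1 / d * (LBINT s. (G s)^2)"
    using lborel_integral_real_affine[of d "\<lambda>s. (G s)^2" c] d by simp
  finally show "(LBINT x:{a<..<b}. (f x)^2) \<le> 2 / d * (LBINT s. (G s)^2) + 2 * K^2 * (b - a)"
    by simp
qed

text \<open>The domain of dependence is half-open: the leading term samples
  \<open>t + s1 * x\<close>, the integral only the open interval below it. For \<open>wave_r\<close>
  the other endpoint is the sampled one. Cutting a trace off at a point has to respect both.\<close>

lemma wave_l_cong:
  assumes "\<And>s. t - s2 * x < s \<Longrightarrow> s \<le> t + s1 * x \<Longrightarrow> g s = h s" "(s1 + s2) * x > 0"
  shows "wave_l s1 s2 A B g t x = wave_l s1 s2 A B h t x"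
proof -
  have "(LBINT p:{0<..<(s1 + s2) * x}. ker A B p ((s1 + s2) * x - p) * g (t + s1 * x - p))
     = (LBINT p:{0<..<(s1 + s2) * x}. ker A B p ((s1 + s2) * x - p) * h (t + s1 * x - p))"
  proof (intro set_lebesgue_integral_cong allI impI)
    fix p assume "p \<in> {0<..<(s1 + s2) * x}"
    then have "g (t + s1 * x - p) = h (t + s1 * x - p)"
      by (intro assms(1)) (auto simp: algebra_simps)
    then show "ker A B p ((s1 + s2) * x - p) * g (t + s1 * x - p) = ker A B p ((s1 + s2) * x - p) * h (t + s1 * x - p)"
      by simp
  qed simp
  moreover have "g (t + s1 * x) = h (t + s1 * x)"
    using assms by (simp add: algebra_simps)
  ultimately show ?thesis by (simp add: wave_l_def)
qed

lemma wave_r_cong: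
  assumes "\<And>s. t - s2 * x \<le> s \<Longrightarrow> s < t + s1 * x \<Longrightarrow> g s = h s" "(s1 + s2) * x > 0"
  shows "wave_r s1 s2 A B g t x = wave_r s1 s2 A B h t x"
  unfolding wave_r_def using assms by (intro wave_l_cong) (auto simp: add.commute)

lemma wave_l_measurable [measurable]:
  assumes [measurable]: "g \<in> borel_measurable borel" "u \<in> borel_measurable M" "v \<in> borel_measurable M"
  shows "(\<lambda>w. wave_l s1 s2 A B g (u w) (v w)) \<in> borel_measurable M"
proof -
  have "(\<lambda>w. g (u w + s1 * v w) + (LBINT p. (if 0 < p \<and> p < (s1 + s2) * v w then
     ker A B p ((s1 + s2) * v w - p) * g (u w + s1 * v w - p) else 0))) \<in> borel_measurable M"
    by measurable
  also have "(\<lambda>w. g (u w + s1 * v w) + (LBINT p. (if 0 < p \<and> p < (s1 + s2) * v w then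
     ker A B p ((s1 + s2) * v w - p) * g (u w + s1 * v w - p) else 0))) = 
    (\<lambda>w. wave_l s1 s2 A B g (u w) (v w))"
    unfolding wave_l_def set_lebesgue_integral_def
    by (intro ext arg_cong2[where f="(+)"] Bochner_Integration.integral_cong) (auto simp: indicator_def)
  finally show ?thesis .
qed

text \<open>Every argument of \<open>g\<close> in the formula lies in \<open>{-R<..<R}\<close>, so
  \<open>g\<close> may be replaced by its globally integrable truncation \<open>G\<close>. The
  resulting bound on the integral does not depend on \<open>t\<close> and \<open>x\<close>.\<close>

lemma wave_l_integrand:
  assumes g: "locsq g" and k: "s1 > 0" "s2 > 0" and x: "0 \<le> x" "x \<le> L"
    and M: "\<And>p q. p \<in> {0..(s1 + s2) * L} \<Longrightarrow> q \<in> {0..(s1 + s2) * L} \<Longrightarrow> \<bar>ker A B p q\<bar> \<le> M"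
    and R: "\<bar>t\<bar> + (s1 + s2) * L < R"
  defines "G \<equiv> \<lambda>s. indicator {-R<..<R} s * g s"
  shows "set_integrable lborel {0<..<(s1 + s2) * x} (\<lambda>p. ker A B p ((s1 + s2) * x - p) * g (t + s1 * x - p))"
    and "\<bar>LBINT p:{0<..<(s1 + s2) * x}. ker A B p ((s1 + s2) * x - p) * g (t + s1 * x - p)\<bar> \<le> M * (LBINT s. \<bar>G s\<bar>)"
    and "g (t + s1 * x) = G (t + s1 * x)"
proof -
  have [measurable]: "g \<in> borel_measurable borel" using g by (simp add: locsq_def)
  define c where "c = (s1 + s2) * x"
  have c: "0 \<le> c" "c \<le> (s1 + s2) * L" using k x by (auto simp: c_def)
  have ax: "0 \<le> s1 * x" "s1 * x \<le> c" "0 \<le> s2 * x" using k x by (auto simp: c_def distrib_right)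
  show "g (t + s1 * x) = G (t + s1 * x)" using R c ax by (auto simp: G_def indicator_def)
  have iG: "integrable lborel (\<lambda>p. M * \<bar>G (t + s1 * x + (-1) * p)\<bar>)"
    using lborel_integrable_real_affine[OF locsq_truncate(1)[OF g, of R], of "-1" "t + s1 * x"]
    unfolding G_def by (intro integrable_mult_right integrable_abs) auto
  let ?f = "\<lambda>p. indicator {0<..<c} p *\<^sub>R (ker A B p (c - p) * g (t + s1 * x - p))"
  have bd: "\<bar>?f p\<bar> \<le> M * \<bar>G (t + s1 * x + (-1) * p)\<bar>" for p
  proof (cases "p \<in> {0<..<c}")
    case True
    have "t + s1 * x - p \<in> {-R<..<R}" using True R c ax by auto
    then have "G (t + s1 * x + (-1) * p) = g (t + s1 * x - p)" by (simp add: G_def)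
    moreover have "\<bar>ker A B p (c - p)\<bar> \<le> M" using True c by (intro M) auto
    ultimately show ?thesis using True by (simp add: abs_mult mult_right_mono)
  next
    case False
    have "0 \<le> M" using M[of 0 0] c by auto
    then show ?thesis using False by simp
  qed
  have i: "integrable lborel ?f"
    by (rule Bochner_Integration.integrable_bound[OF iG])
      (use bd in \<open>auto intro!: AE_I2 intro: order_trans[OF _ abs_ge_self]\<close>)
  then show "set_integrable lborel {0<..<(s1 + s2) * x} (\<lambda>p. ker A B p ((s1 + s2) * x - p) * g (t + s1 * x - p))"
    by (simp add: set_integrable_def c_def)
  have "\<bar>LBINT p. ?f p\<bar> \<le> (LBINT p. M * \<bar>G (t + s1 * x + (-1) * p)\<bar>)"
    using i iG bd by (intro order_trans[OF integral_abs_bound] integral_mono integrable_abs)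
  also have "\<dots> = M * (LBINT s. \<bar>G s\<bar>)"
    using lborel_integral_real_affine[of "-1" "\<lambda>s. \<bar>G s\<bar>" "t + s1 * x"] by simp
  finally show "\<bar>LBINT p:{0<..<(s1 + s2) * x}. ker A B p ((s1 + s2) * x - p) * g (t + s1 * x - p)\<bar> \<le> M * (LBINT s. \<bar>G s\<bar>)"
    by (simp add: set_lebesgue_integral_def c_def)
qed

lemma wave_l_diff:
  assumes g: "locsq g" "locsq h" and k: "s1 > 0" "s2 > 0" and x: "0 \<le> x"
  shows "wave_l s1 s2 A B (\<lambda>s. g s - h s) t x = wave_l s1 s2 A B g t x - wave_l s1 s2 A B h t x"
proof -
  obtain M where M: "\<And>p q. p \<in> {0..(s1 + s2) * x} \<Longrightarrow> q \<in> {0..(s1 + s2) * x} \<Longrightarrow> \<bar>ker A B p q\<bar> \<le> M"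
    using ker_bound[of "(s1 + s2) * x" A B] by metis
  have R: "\<bar>t\<bar> + (s1 + s2) * x < \<bar>t\<bar> + (s1 + s2) * x + 1" by simp
  show ?thesis
    using wave_l_integrand(1)[OF g(1) k x order_refl M R] wave_l_integrand(1)[OF g(2) k x order_refl M R]
    by (simp add: wave_l_def right_diff_distrib)
qed

lemma wave_r_diff:
  assumes g: "locsq g" "locsq h" and k: "s1 > 0" "s2 > 0" and x: "0 \<le> x"
  shows "wave_r s1 s2 A B (\<lambda>s. g s - h s) t x = wave_r s1 s2 A B g t x - wave_r s1 s2 A B h t x"
  unfolding wave_r_def by (rule wave_l_diff[OF locsq_reflect[OF g(1)] locsq_reflect[OF g(2)] k(2,1) x])

text \<open>Continuity of the linear map \<open>W\<close> in L^2, both into slices at fixed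
  \<open>t\<close> and into traces at fixed \<open>x\<close>, with one constant for all of them. The
  window \<open>R\<close> exceeds \<open>T\<close> because of the domain of dependence.\<close>

definition L2_bounded_traces ::
  "real \<Rightarrow> real \<Rightarrow> real \<Rightarrow> ((real \<Rightarrow> real) \<Rightarrow> real \<Rightarrow> real \<Rightarrow> real) \<Rightarrow> real \<Rightarrow> bool" where
  "L2_bounded_traces T L R W C \<longleftrightarrow>
     (\<forall>g t. locsq g \<longrightarrow> \<bar>t\<bar> \<le> T \<longrightarrow> W g t \<in> L2_on {0<..<L} \<and>
       (LBINT x:{0<..<L}. (W g t x)^2) \<le> C * (LBINT s:{-R<..<R}. (g s)^2)) \<and>
     (\<forall>g x. locsq g \<longrightarrow> x \<in> {0..L} \<longrightarrow> (\<lambda>t. W g t x) \<in> L2_on {-T<..<T} \<and>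
       (LBINT t:{-T<..<T}. (W g t x)^2) \<le> C * (LBINT s:{-R<..<R}. (g s)^2))"

lemma wave_l_L2_bound:
  assumes k: "s1 > 0" "s2 > 0" and L: "L > 0" and T: "T > 0"
  defines "R \<equiv> T + (s1 + s2) * L + 1"
  shows "\<exists>C. L2_bounded_traces T L R (wave_l s1 s2 A B) C"
proof -
  obtain M where M: "M > 0" "\<And>p q. p \<in> {0..(s1 + s2) * L} \<Longrightarrow> q \<in> {0..(s1 + s2) * L} \<Longrightarrow> \<bar>ker A B p q\<bar> \<le> M"
    using ker_bound[of "(s1 + s2) * L" A B] by metis
  have kL: "(s1 + s2) * L > 0" using k L by simp
  have R: "R > 0" "\<And>t. \<bar>t\<bar> \<le> T \<Longrightarrow> \<bar>t\<bar> + (s1 + s2) * L < R" using kL T by (auto simp: R_def)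
  \<comment> \<open>The first two terms bound \<open>2 / d\<close> for slope \<open>d = s1\<close>
    (slices) and \<open>d = 1\<close> (traces). The third comes from the squared integral part, at
    most \<open>M^2 * 2 * R\<close> times the energy, integrated over a length \<open>L\<close> or
    \<open>2 * T\<close>.\<close>
  define C where "C = 2 / s1 + 2 + 4 * M^2 * R * (L + 2 * T)"
  have pt: "\<bar>wave_l s1 s2 A B g t x\<bar> \<le> \<bar>indicator {-R<..<R} (t + s1 * x) * g (t + s1 * x)\<bar>
       + M * (LBINT s. \<bar>indicator {-R<..<R} s * g s\<bar>)"
    if "locsq g" "\<bar>t\<bar> \<le> T" "x \<in> {0..L}" for g t x
  proof -
    have x: "0 \<le> x" "x \<le> L" using that by auto
    note b = wave_l_integrand(2,3)[OF that(1) k x M(2) R(2)[OF that(2)]]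
    show ?thesis
      unfolding wave_l_def
      by (rule order_trans[OF abs_triangle_ineq add_mono[OF eq_refl[OF arg_cong[OF b(2), of abs]] b(1)]])
  qed
  have fin: "2 / d * (LBINT s. (indicator {-R<..<R} s * g s)^2)
       + 2 * (M * (LBINT s. \<bar>indicator {-R<..<R} s * g s\<bar>))^2 * w
       \<le> C * (LBINT s:{-R<..<R}. (g s)^2)" if "locsq g" "d = s1 \<and> w = L \<or> d = 1 \<and> w = 2 * T" for g d w
  proof -
    let ?E = "LBINT s:{-R<..<R}. (g s)^2"
    have E: "?E \<ge> 0" by (rule L2_on_integral_nonneg)
    have w: "w \<ge> 0" using that L T by auto
    have "2 * (M * (LBINT s. \<bar>indicator {-R<..<R} s * g s\<bar>))^2 * w \<le> 2 * M^2 * w * (2 * R * ?E)"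
      using mult_left_mono[OF locsq_truncate(4)[OF that(1) R(1)], of "2 * M^2 * w"] w
      by (simp add: power_mult_distrib mult_ac)
    moreover have "2 / d \<le> 2 / s1 + 2" using that k by auto
    then have "2 / d * ?E \<le> (2 / s1 + 2) * ?E" using E by (rule mult_right_mono)
    moreover have "2 * M^2 * w * (2 * R * ?E) \<le> 4 * M^2 * R * (L + 2 * T) * ?E"
    proof -
      have "w \<le> L + 2 * T" using that L T by auto
      from mult_left_mono[OF this, of "4 * M^2 * R * ?E"] show ?thesis
        using R(1) E by (simp add: mult_ac)
    qed
    ultimately show ?thesis unfolding locsq_truncate(3)[OF that(1)] C_def by (simp add: algebra_simps)
  qed
  have "(\<lambda>x. wave_l s1 s2 A B g t x) \<in> L2_on {0<..<L} \<and>
       (LBINT x:{0<..<L}. (wave_l s1 s2 A B g t x)^2) \<le> C * (LBINT s:{-R<..<R}. (g s)^2)"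
    if g: "locsq g" and t: "\<bar>t\<bar> \<le> T" for g t
  proof -
    have [measurable]: "g \<in> borel_measurable borel" using g by (simp add: locsq_def)
    have m: "(\<lambda>x. wave_l s1 s2 A B g t x) \<in> borel_measurable borel" by measurable
    have "\<bar>wave_l s1 s2 A B g t x\<bar> \<le> \<bar>indicator {-R<..<R} (t + s1 * x) * g (t + s1 * x)\<bar>
       + M * (LBINT s. \<bar>indicator {-R<..<R} s * g s\<bar>)" if "x \<in> {0<..<L}" for x
      using pt[OF g t] that by auto
    note L2_on_affine_bound[OF m locsq_truncate(2)[OF g, of R] this k(1) less_imp_le[OF L]]
    then show ?thesis using fin[OF g, of s1 L] by auto
  qed
  moreover have "(\<lambda>t. wave_l s1 s2 A B g t x) \<in> L2_on {-T<..<T} \<and>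
       (LBINT t:{-T<..<T}. (wave_l s1 s2 A B g t x)^2) \<le> C * (LBINT s:{-R<..<R}. (g s)^2)"
    if g: "locsq g" and x: "x \<in> {0..L}" for g x
  proof -
    have [measurable]: "g \<in> borel_measurable borel" using g by (simp add: locsq_def)
    have m: "(\<lambda>t. wave_l s1 s2 A B g t x) \<in> borel_measurable borel" by measurable
    have "\<bar>wave_l s1 s2 A B g t x\<bar> \<le> \<bar>indicator {-R<..<R} (s1 * x + 1 * t) * g (s1 * x + 1 * t)\<bar>
       + M * (LBINT s. \<bar>indicator {-R<..<R} s * g s\<bar>)" if "t \<in> {-T<..<T}" for t
      using pt[OF g _ x, of t] that by (auto simp: add.commute)
    note b = L2_on_affine_bound[of _ _ "-T" T, OF m locsq_truncate(2)[OF g, of R] this zero_less_one]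
    show ?thesis
    proof
      show "(\<lambda>t. wave_l s1 s2 A B g t x) \<in> L2_on {-T<..<T}" by (rule b(1)) (use T in auto)
      have "(LBINT t:{-T<..<T}. (wave_l s1 s2 A B g t x)^2) \<le> 2 / 1 * (LBINT s. (indicator {-R<..<R} s * g s)^2)
       + 2 * (M * (LBINT s. \<bar>indicator {-R<..<R} s * g s\<bar>))^2 * (T - - T)"
        by (rule b(2)) (use T in auto)
      then show "(LBINT t:{-T<..<T}. (wave_l s1 s2 A B g t x)^2) \<le> C * (LBINT s:{-R<..<R}. (g s)^2)"
        using fin[OF g, of 1 "2 * T"] by simp
    qed
  qed
  ultimately show ?thesis unfolding L2_bounded_traces_def by blast
qed

lemma wave_r_L2_bound:
  assumes k: "s1 > 0" "s2 > 0" and L: "L > 0" and T: "T > 0"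
  defines "R \<equiv> T + (s1 + s2) * L + 1"
  shows "\<exists>C. L2_bounded_traces T L R (wave_r s1 s2 A B) C"
proof -
  have R: "R = T + (s2 + s1) * L + 1" by (simp add: R_def add.commute)
  obtain C where C: "L2_bounded_traces T L R (wave_l s2 s1 B A) C"
    unfolding R using wave_l_L2_bound[OF k(2,1) L T, of B A] by (elim exE)
  note C = C[unfolded L2_bounded_traces_def, THEN conjunct1, rule_format]
    C[unfolded L2_bounded_traces_def, THEN conjunct2, rule_format]
  have "L2_bounded_traces T L R (wave_r s1 s2 A B) C"
    unfolding L2_bounded_traces_def
  proof (intro conjI[of "\<forall>g t. _ g t"] allI impI)
    fix g t assume g: "locsq g" and t: "\<bar>t\<bar> \<le> T"
    show "wave_r s1 s2 A B g t \<in> L2_on {0<..<L} \<and>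
       (LBINT x:{0<..<L}. (wave_r s1 s2 A B g t x)^2) \<le> C * (LBINT s:{-R<..<R}. (g s)^2)"
      using C(1)[OF locsq_reflect[OF g], of "- t"] t by (simp add: wave_r_def[abs_def] L2_integral_reflect)
  next
    fix g x assume g: "locsq g" and x: "x \<in> {0..L}"
    have i: "indicator {-T<..<T} (- x) = (indicator {-T<..<T} x :: real)" for x :: real
      by (auto simp: indicator_def)
    note b = C(2)[OF locsq_reflect[OF g] x]
    have [measurable]: "g \<in> borel_measurable borel" using g by (simp add: locsq_def)
    have "integrable lborel (\<lambda>t. indicator {-T<..<T} t *\<^sub>R (wave_l s2 s1 B A (\<lambda>s. g (- s)) t x)^2)"
      using b by (simp add: L2_on_def set_integrable_def)
    from lborel_integrable_real_affine[OF this, of "-1" 0]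
    have "integrable lborel (\<lambda>t. indicator {-T<..<T} t *\<^sub>R (wave_r s1 s2 A B g t x)^2)" by (simp add: i wave_r_def)
    moreover have "(\<lambda>t. wave_r s1 s2 A B g t x) \<in> borel_measurable borel" unfolding wave_r_def by measurable
    ultimately have "(\<lambda>t. wave_r s1 s2 A B g t x) \<in> L2_on {-T<..<T}"
      by (simp add: L2_on_def set_integrable_def set_borel_measurable_def)
    moreover have "(LBINT t:{-T<..<T}. (wave_r s1 s2 A B g t x)^2)
       = (LBINT t:{-T<..<T}. (wave_l s2 s1 B A (\<lambda>s. g (- s)) t x)^2)"
      unfolding wave_r_def by (rule L2_integral_reflect)
    ultimately show "(\<lambda>t. wave_r s1 s2 A B g t x) \<in> L2_on {-T<..<T} \<and>
       (LBINT t:{-T<..<T}. (wave_r s1 s2 A B g t x)^2) \<le> C * (LBINT s:{-R<..<R}. (g s)^2)"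
      using b by (simp add: L2_integral_reflect)
  qed
  then show ?thesis by (rule exI)
qed

section \<open>Passage to the limit in the weak formulation\<close>

lemma continuous_on_Icc_bounded:
  fixes f :: "real \<Rightarrow> real"
  assumes "continuous_on {a..b} f"
  obtains K where "\<And>t. t \<in> {a..b} \<Longrightarrow> \<bar>f t\<bar> \<le> K"
proof -
  have "bounded (f ` {a..b})"
    using assms by (intro compact_imp_bounded compact_continuous_image) auto
  then obtain K where "\<forall>y\<in>f ` {a..b}. norm y \<le> K" unfolding bounded_iff by (elim exE)
  then show ?thesis by (intro that[of K]) simp
qed

text \<open>The error \<open>e n\<close> is uniform in \<open>t\<close>. This makes the limit a
  continuous curve in L^2 and allows integration of the error over time.\<close>

definition L2_approx :: "real \<Rightarrow> real \<Rightarrow> (nat \<Rightarrow> real \<Rightarrow> real \<Rightarrow> real) \<Rightarrow> (real \<Rightarrow> real \<Rightarrow> real) \<Rightarrow> bool" where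
  "L2_approx T L yn y \<longleftrightarrow>
     (\<forall>n. continuous_on ({0..T} \<times> {0..L}) (\<lambda>w. yn n (fst w) (snd w))) \<and>
     (\<forall>t\<in>{0..T}. y t \<in> L2_on {0<..<L}) \<and>
     (\<exists>e. e \<longlonglongrightarrow> 0 \<and> (\<forall>n. \<forall>t\<in>{0..T}. (LBINT x:{0<..<L}. (yn n t x - y t x)^2) \<le> e n))"

lemma L2_approx_slice:
  assumes "L2_approx T L yn y" "t \<in> {0..T}"
  shows "yn n t \<in> L2_on {0<..<L}" "y t \<in> L2_on {0<..<L}"
    "(\<lambda>n. LBINT x:{0<..<L}. (yn n t x - y t x)^2) \<longlonglongrightarrow> 0"
proof -
  show "yn n t \<in> L2_on {0<..<L}"
    using assms by (intro L2_on_continuous continuous_on_rectangle_slices(2)) (auto simp: L2_approx_def)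
  show "y t \<in> L2_on {0<..<L}" using assms by (auto simp: L2_approx_def)
  obtain e where e: "e \<longlonglongrightarrow> 0" "\<And>n. (LBINT x:{0<..<L}. (yn n t x - y t x)^2) \<le> e n"
    using assms unfolding L2_approx_def by blast
  show "(\<lambda>n. LBINT x:{0<..<L}. (yn n t x - y t x)^2) \<longlonglongrightarrow> 0"
    by (rule Lim_null_comparison[OF _ e(1)], intro always_eventually allI)
      (simp only: real_norm_def abs_of_nonneg L2_on_integral_nonneg e(2))
qed

text \<open>A locally uniform limit of continuous curves in L^2 is continuous.\<close>

lemma L2_approx_C0_L2:
  assumes "\<And>T. T > 0 \<Longrightarrow> \<exists>yn. L2_approx T L yn y"
  shows "y \<in> C0_L2 L"
  unfolding C0_L2_def
proof (intro CollectI conjI allI impI)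
  show "y t \<in> L2_on {0<..<L}" if "t \<ge> 0" for t
    using assms[of "t + 1"] L2_approx_slice(2)[of "t + 1" L _ y t] that by auto
  fix s :: real assume s: "s \<ge> 0"
  define T where "T = s + 1"
  obtain yn where yn: "L2_approx T L yn y" using assms[of T] s by (auto simp: T_def)
  then obtain e where e: "e \<longlonglongrightarrow> 0"
    "\<And>n t. t \<in> {0..T} \<Longrightarrow> (LBINT x:{0<..<L}. (yn n t x - y t x)^2) \<le> e n"
    unfolding L2_approx_def by blast
  have sT: "s \<in> {0..T}" using s by (simp add: T_def)
  show "((\<lambda>t. LBINT x:{0<..<L}. (y t x - y s x)^2) \<longlongrightarrow> 0) (at s within {0..})"
  proof (rule tendstoI)
    fix \<epsilon> :: real assume "\<epsilon> > 0"
    \<comment> \<open>Two applications of \<open>integral_square_sum_le\<close> below lead to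
      \<open>8 * e n + 2 * h t\<close>, whence the fractions 1/16 here and 1/4 for
      \<open>h\<close>.\<close>
    then have "\<forall>\<^sub>F n in sequentially. e n < \<epsilon> / 16" using e(1) by (intro order_tendstoD(2)) auto
    then obtain n where n: "e n < \<epsilon> / 16" using eventually_happens' sequentially_bot by blast
    define h where "h t = (LBINT x:{0<..<L}. (yn n t x - yn n s x)^2)" for t
    have cyn: "continuous_on ({0..T} \<times> {0..L}) (\<lambda>w. yn n (fst w) (snd w))" using yn by (auto simp: L2_approx_def)
    have "continuous_on {0..L} (yn n s)" by (rule continuous_on_rectangle_slices(2)[OF cyn sT])
    then have "continuous_on ({0..T} \<times> {0..L}) (\<lambda>w. yn n s (snd w))"
      by (rule continuous_on_compose2) (auto intro!: continuous_intros)
    then have "continuous_on ({0..T} \<times> {0..L}) (\<lambda>w. (yn n (fst w) (snd w) - yn n s (snd w))^2)"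
      by (intro continuous_on_power continuous_on_diff cyn)
    then have "continuous_on {0..T} h"
      unfolding h_def by (rule continuous_on_rectangle_integral[where v = "\<lambda>t x. (yn n t x - yn n s x)^2"])
    then have "(h \<longlongrightarrow> h s) (at s within {0..T})" using sT by (simp add: continuous_on_def)
    moreover have "h s = 0" by (simp add: h_def set_lebesgue_integral_def)
    moreover have "at s within {0..T} = at s within {0..}"
    proof (rule at_within_nhd[of s "{s - 1<..<T}"])
      show "{0..T} \<inter> {s - 1<..<T} - {s} = {0..} \<inter> {s - 1<..<T} - {s}" by auto
    qed (auto simp: T_def)
    ultimately have "(h \<longlongrightarrow> 0) (at s within {0..})" by simp
    then have "\<forall>\<^sub>F t in at s within {0..}. h t < \<epsilon> / 4"
      using \<open>\<epsilon> > 0\<close> by (intro order_tendstoD(2)) auto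
    moreover have "\<forall>\<^sub>F t in at s within {0..}. t \<in> {0..T}"
      unfolding eventually_at by (intro exI[of _ 1]) (auto simp: T_def dist_real_def)
    ultimately show "\<forall>\<^sub>F t in at s within {0..}. dist (LBINT x:{0<..<L}. (y t x - y s x)^2) 0 < \<epsilon>"
    proof eventually_elim
      case (elim t)
      note tT = elim(2)
      note m = L2_approx_slice(1,2)[OF yn tT] L2_approx_slice(1,2)[OF yn sT]
      have "(LBINT x:{0<..<L}. (y t x - y s x)^2) =
        (LBINT x:{0<..<L}. ((((-1) * (yn n t x - y t x)) + (yn n s x - y s x)) + (yn n t x - yn n s x))^2)"
        by (simp add: algebra_simps)
      also have "\<dots> \<le> 2 * (LBINT x:{0<..<L}. (((-1) * (yn n t x - y t x)) + (yn n s x - y s x))^2) + 2 * h t"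
        unfolding h_def by (intro integral_square_sum_le L2_on_add L2_on_diff L2_on_cmult m)
      also have "(LBINT x:{0<..<L}. (((-1) * (yn n t x - y t x)) + (yn n s x - y s x))^2)
         \<le> 2 * (LBINT x:{0<..<L}. ((-1) * (yn n t x - y t x))^2) + 2 * (LBINT x:{0<..<L}. (yn n s x - y s x)^2)"
        by (intro integral_square_sum_le L2_on_diff L2_on_cmult m)
      also have "\<dots> \<le> 2 * e n + 2 * e n"
        using e(2)[OF tT, of n] e(2)[OF sT, of n] by (simp add: power2_commute)
      finally have "(LBINT x:{0<..<L}. (y t x - y s x)^2) < \<epsilon>" using n elim(1) by simp
      then show ?case using L2_on_integral_nonneg[of "{0<..<L}" "\<lambda>x. y t x - y s x"] by simp
    qed
  qed
qed

text \<open>The limit \<open>y\<close> is controlled only slice by slice. Measurability in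
  \<open>t\<close> of its inner integral is obtained from the continuous inner integrals of
  \<open>yn\<close>, which converge uniformly by Cauchy-Schwarz.\<close>

lemma L2_approx_double_integral:
  assumes T: "T > 0" and L: "L > 0" and y: "L2_approx T L yn y"
    and \<psi>: "continuous_on ({0..T} \<times> {0..L}) (\<lambda>w. \<psi> (fst w) (snd w))"
  shows "(\<lambda>t. LBINT x:{0<..<L}. y t x * \<psi> t x) \<in> L2_on {0<..<T}"
    and "(\<lambda>n. LBINT t:{0<..<T}. (LBINT x:{0<..<L}. yn n t x * \<psi> t x) - (LBINT x:{0<..<L}. y t x * \<psi> t x)) \<longlonglongrightarrow> 0"
proof -
  define G where "G t = (LBINT x:{0<..<L}. y t x * \<psi> t x)" for t
  define Gn where "Gn n t = (LBINT x:{0<..<L}. yn n t x * \<psi> t x)" for n t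
  obtain e where e: "e \<longlonglongrightarrow> 0"
    "\<And>n t. t \<in> {0..T} \<Longrightarrow> (LBINT x:{0<..<L}. (yn n t x - y t x)^2) \<le> e n"
    using y unfolding L2_approx_def by blast
  have e0: "e n \<ge> 0" for n
    using e(2)[of 0 n] T L2_on_integral_nonneg[of "{0<..<L}" "\<lambda>x. yn n 0 x - y 0 x"] by simp
  have c2: "continuous_on {0..T} (\<lambda>t. LBINT x:{0<..<L}. (\<psi> t x)^2)"
    by (intro continuous_on_rectangle_integral continuous_intros \<psi>)
  obtain K where K: "\<And>t. t \<in> {0..T} \<Longrightarrow> (LBINT x:{0<..<L}. (\<psi> t x)^2) \<le> K"
    by (rule continuous_on_Icc_bounded[OF c2], rule that) (auto dest: abs_le_D1)
  have \<psi>L: "\<psi> t \<in> L2_on {0<..<L}" if "t \<in> {0..T}" for t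
    by (rule L2_on_continuous[OF continuous_on_rectangle_slices(2)[OF \<psi> that]])
  have diff: "\<bar>Gn n t - G t\<bar> \<le> sqrt (e n) * sqrt K" if t: "t \<in> {0..T}" for n t
  proof -
    note m = L2_approx_slice(1,2)[OF y t]
    have "Gn n t - G t = (LBINT x:{0<..<L}. (yn n t x - y t x) * \<psi> t x)"
      unfolding Gn_def G_def
      using L2_on_mult_integrable[OF m(1) \<psi>L[OF t], of n] L2_on_mult_integrable[OF m(2) \<psi>L[OF t]]
      by (simp add: left_diff_distrib)
    also have "\<bar>\<dots>\<bar> \<le> sqrt (LBINT x:{0<..<L}. (yn n t x - y t x)^2) * sqrt (LBINT x:{0<..<L}. (\<psi> t x)^2)"
      by (intro L2_on_Cauchy_Schwarz L2_on_diff m \<psi>L t)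
    also have "\<dots> \<le> sqrt (e n) * sqrt K"
      using e(2)[OF t] K[OF t] e0 by (intro mult_mono real_sqrt_le_mono) (auto simp: L2_on_integral_nonneg)
    finally show ?thesis .
  qed
  have cGn: "continuous_on {0..T} (Gn n)" for n
    unfolding Gn_def using y by (intro continuous_on_rectangle_integral continuous_intros \<psi>) (auto simp: L2_approx_def)
  have lim: "(\<lambda>n. Gn n t) \<longlonglongrightarrow> G t" if t: "t \<in> {0..T}" for t
  proof -
    have "(\<lambda>n. Gn n t - G t) \<longlonglongrightarrow> 0"
      by (rule Lim_null_comparison[where g = "\<lambda>n. sqrt (e n) * sqrt K"])
        (use diff[OF t] e(1) in \<open>auto intro!: always_eventually tendsto_mult_left_zero tendsto_eq_intros\<close>)
    then show ?thesis by (simp add: LIM_zero_iff)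
  qed
  have mG: "set_borel_measurable lborel {0<..<T} G"
    unfolding set_borel_measurable_def
  proof (rule borel_measurable_LIMSEQ_real)
    show "(\<lambda>n. indicator {0<..<T} t *\<^sub>R Gn n t) \<longlonglongrightarrow> indicator {0<..<T} t *\<^sub>R G t" for t
      using lim[of t] by (cases "t \<in> {0<..<T}") auto
    show "(\<lambda>t. indicator {0<..<T} t *\<^sub>R Gn n t) \<in> borel_measurable lborel" for n
      using L2_on_continuous[OF cGn] by (simp add: L2_on_def set_borel_measurable_def)
  qed
  obtain B where B: "\<And>t. t \<in> {0..T} \<Longrightarrow> \<bar>Gn 0 t\<bar> \<le> B"
    by (rule continuous_on_Icc_bounded[OF cGn[of 0]], rule that) blast
  have GL: "G \<in> L2_on {0<..<T}"
  proof (rule L2_on_bounded[OF mG])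
    fix t assume "t \<in> {0<..<T}"
    then show "\<bar>G t\<bar> \<le> B + sqrt (e 0) * sqrt K" using diff[of t 0] B[of t] by simp
  qed
  then show "(\<lambda>t. LBINT x:{0<..<L}. y t x * \<psi> t x) \<in> L2_on {0<..<T}" by (simp only: G_def[abs_def])
  have "(\<lambda>n. LBINT t:{0<..<T}. Gn n t - G t) \<longlonglongrightarrow> 0"
  proof (rule Lim_null_comparison)
    show "\<forall>\<^sub>F n in sequentially. norm (LBINT t:{0<..<T}. Gn n t - G t) \<le> T * (sqrt (e n) * sqrt K)"
    proof (intro always_eventually allI)
      fix n
      have i: "set_integrable lborel {0<..<T} (\<lambda>t. Gn n t - G t)"
        by (intro L2_on_integrable L2_on_diff L2_on_continuous cGn GL)
      have c: "set_integrable lborel {0<..<T} (\<lambda>t. c)" for c :: real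
        by (intro L2_on_integrable L2_on_continuous continuous_intros)
      have "(LBINT t:{0<..<T}. Gn n t - G t) \<le> (LBINT t:{0<..<T}. sqrt (e n) * sqrt K)"
        using diff by (intro set_integral_mono i c) (auto simp: abs_le_iff)
      moreover have "(LBINT t:{0<..<T}. - (sqrt (e n) * sqrt K)) \<le> (LBINT t:{0<..<T}. Gn n t - G t)"
      proof (intro set_integral_mono i c)
        fix t assume "t \<in> {0<..<T}"
        then show "- (sqrt (e n) * sqrt K) \<le> Gn n t - G t" using diff[of t n] by (simp only: abs_le_iff) auto
      qed
      ultimately show "norm (LBINT t:{0<..<T}. Gn n t - G t) \<le> T * (sqrt (e n) * sqrt K)"
        using T by (simp add: set_lebesgue_integral_def abs_le_iff mult_ac)
    qed
    have "(\<lambda>n. T * (sqrt (e n) * sqrt K)) \<longlonglongrightarrow> T * (sqrt 0 * sqrt K)"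
      by (intro tendsto_intros e)
    then show "(\<lambda>n. T * (sqrt (e n) * sqrt K)) \<longlonglongrightarrow> 0" by simp
  qed
  then show "(\<lambda>n. LBINT t:{0<..<T}. (LBINT x:{0<..<L}. yn n t x * \<psi> t x) - (LBINT x:{0<..<L}. y t x * \<psi> t x)) \<longlonglongrightarrow> 0"
    by (simp only: G_def Gn_def)
qed

text \<open>Each term of the identity is an inner product with a fixed continuous factor, so L^2
  convergence of states, sources and boundary traces suffices.\<close>

lemma L2_approx_weak_identity:
  assumes T: "T > 0" and L: "L > 0" and y: "L2_approx T L yn y" and f: "L2_approx T L fn f"
    and y0: "\<And>n. y0n n \<in> L2_on {0<..<T}" "y0 \<in> L2_on {0<..<T}"
      "(\<lambda>n. LBINT t:{0<..<T}. (y0n n t - y0 t)^2) \<longlonglongrightarrow> 0"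
    and yL: "\<And>n. yLn n \<in> L2_on {0<..<T}" "yL \<in> L2_on {0<..<T}"
      "(\<lambda>n. LBINT t:{0<..<T}. (yLn n t - yL t)^2) \<longlonglongrightarrow> 0"
    and \<phi>: "C1_test T L \<phi> \<phi>t \<phi>x"
    and eq: "\<And>n. weak_identity T L c (yn n) (fn n) (y0n n) (yLn n) \<phi> \<phi>t \<phi>x"
  shows "weak_identity T L c y f y0 yL \<phi> \<phi>t \<phi>x"
proof -
  note c\<phi> = C1_test_continuous[OF \<phi>]
  define \<psi> where "\<psi> t x = \<phi>t t x + c * \<phi>x t x" for t x
  have c\<psi>: "continuous_on ({0..T} \<times> {0..L}) (\<lambda>w. \<psi> (fst w) (snd w))"
    unfolding \<psi>_def by (intro continuous_intros c\<phi>)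
  have sl: "\<eta> t \<in> L2_on {0<..<L}" if "t \<in> {0..T}" "continuous_on ({0..T} \<times> {0..L}) (\<lambda>w. \<eta> (fst w) (snd w))"
    for t and \<eta> :: "real \<Rightarrow> real \<Rightarrow> real"
    by (rule L2_on_continuous[OF continuous_on_rectangle_slices(2)[OF that(2,1)]])
  have b: "(\<lambda>t. \<phi> t x) \<in> L2_on {0<..<T}" if "x \<in> {0..L}" for x
    by (rule L2_on_continuous[OF continuous_on_rectangle_slices(1)[OF c\<phi>(1) that]])
  have 1: "(\<lambda>n. LBINT x:{0<..<L}. yn n t x * \<phi> t x) \<longlonglongrightarrow> (LBINT x:{0<..<L}. y t x * \<phi> t x)"
    if t: "t \<in> {0..T}" for t
    by (rule L2_on_tendsto[OF L2_approx_slice(1,2)[OF y t] sl[OF t c\<phi>(1)] L2_approx_slice(3)[OF y t]])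
  have bd: "(LBINT t:{0<..<T}. zL t * \<phi> t L - z0 t * \<phi> t 0) =
      (LBINT t:{0<..<T}. zL t * \<phi> t L) - (LBINT t:{0<..<T}. z0 t * \<phi> t 0)"
    if "zL \<in> L2_on {0<..<T}" "z0 \<in> L2_on {0<..<T}" for zL z0
    using L2_on_mult_integrable[OF that(1) b[of L]] L2_on_mult_integrable[OF that(2) b[of 0]] L by simp
  have 2: "(\<lambda>n. LBINT t:{0<..<T}. yLn n t * \<phi> t L - y0n n t * \<phi> t 0) \<longlonglongrightarrow>
     (LBINT t:{0<..<T}. yL t * \<phi> t L - y0 t * \<phi> t 0)"
    unfolding bd[OF yL(1) y0(1)] bd[OF yL(2) y0(2)]
    using L by (intro tendsto_diff L2_on_tendsto y0 yL b) auto
  have inner: "(LBINT x:{0<..<L}. z t x * \<psi> t x - h t x * \<phi> t x) =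
      (LBINT x:{0<..<L}. z t x * \<psi> t x) - (LBINT x:{0<..<L}. h t x * \<phi> t x)"
    if "t \<in> {0..T}" "z t \<in> L2_on {0<..<L}" "h t \<in> L2_on {0<..<L}" for z h :: "real \<Rightarrow> real \<Rightarrow> real" and t
    using L2_on_mult_integrable[OF that(2) sl[OF that(1) c\<psi>]] L2_on_mult_integrable[OF that(3) sl[OF that(1) c\<phi>(1)]] by simp
  have iG: "set_integrable lborel {0<..<T} (\<lambda>t. LBINT x:{0<..<L}. y t x * \<psi> t x)"
      "set_integrable lborel {0<..<T} (\<lambda>t. LBINT x:{0<..<L}. f t x * \<phi> t x)"
    by (intro L2_on_integrable L2_approx_double_integral(1)[OF T L y c\<psi>] L2_approx_double_integral(1)[OF T L f c\<phi>(1)])+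
  have iGn: "set_integrable lborel {0<..<T} (\<lambda>t. LBINT x:{0<..<L}. yn n t x * \<psi> t x)"
      "set_integrable lborel {0<..<T} (\<lambda>t. LBINT x:{0<..<L}. fn n t x * \<phi> t x)" for n
    using y f by (auto intro!: L2_on_integrable L2_on_continuous continuous_on_rectangle_integral continuous_intros c\<phi> c\<psi> simp: L2_approx_def)
  have outer: "(LBINT t:{0<..<T}. LBINT x:{0<..<L}. z t x * \<psi> t x - h t x * \<phi> t x) =
      (LBINT t:{0<..<T}. LBINT x:{0<..<L}. z t x * \<psi> t x) -
      (LBINT t:{0<..<T}. LBINT x:{0<..<L}. h t x * \<phi> t x)"
    if "\<And>t. t \<in> {0..T} \<Longrightarrow> z t \<in> L2_on {0<..<L}" "\<And>t. t \<in> {0..T} \<Longrightarrow> h t \<in> L2_on {0<..<L}"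
      "set_integrable lborel {0<..<T} (\<lambda>t. LBINT x:{0<..<L}. z t x * \<psi> t x)"
      "set_integrable lborel {0<..<T} (\<lambda>t. LBINT x:{0<..<L}. h t x * \<phi> t x)"
    for z h :: "real \<Rightarrow> real \<Rightarrow> real"
  proof -
    have "(LBINT t:{0<..<T}. LBINT x:{0<..<L}. z t x * \<psi> t x - h t x * \<phi> t x) =
      (LBINT t:{0<..<T}. (LBINT x:{0<..<L}. z t x * \<psi> t x) - (LBINT x:{0<..<L}. h t x * \<phi> t x))"
      using that(1,2) by (intro set_lebesgue_integral_cong allI impI inner) auto
    then show ?thesis using that(3,4) by simp
  qed
  have 3: "(\<lambda>n. LBINT t:{0<..<T}. LBINT x:{0<..<L}. yn n t x * \<psi> t x - fn n t x * \<phi> t x) \<longlonglongrightarrow>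
     (LBINT t:{0<..<T}. LBINT x:{0<..<L}. y t x * \<psi> t x - f t x * \<phi> t x)"
  proof -
    have o1: "(LBINT t:{0<..<T}. LBINT x:{0<..<L}. yn n t x * \<psi> t x - fn n t x * \<phi> t x) =
      (LBINT t:{0<..<T}. LBINT x:{0<..<L}. yn n t x * \<psi> t x) -
      (LBINT t:{0<..<T}. LBINT x:{0<..<L}. fn n t x * \<phi> t x)" for n
      by (rule outer[of "yn n" "fn n"]) (intro L2_approx_slice(1)[OF y] L2_approx_slice(1)[OF f] iGn | assumption)+
    have o2: "(LBINT t:{0<..<T}. LBINT x:{0<..<L}. y t x * \<psi> t x - f t x * \<phi> t x) =
      (LBINT t:{0<..<T}. LBINT x:{0<..<L}. y t x * \<psi> t x) -
      (LBINT t:{0<..<T}. LBINT x:{0<..<L}. f t x * \<phi> t x)"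
      by (rule outer[of y f]) (intro L2_approx_slice(2)[OF y] L2_approx_slice(2)[OF f] iG | assumption)+
    have "(\<lambda>n. LBINT t:{0<..<T}. LBINT x:{0<..<L}. yn n t x * \<psi> t x) \<longlonglongrightarrow>
        (LBINT t:{0<..<T}. LBINT x:{0<..<L}. y t x * \<psi> t x)"
      using L2_approx_double_integral(2)[OF T L y c\<psi>]
      by (simp only: set_integral_diff(2)[OF iGn(1) iG(1)] LIM_zero_iff)
    moreover have "(\<lambda>n. LBINT t:{0<..<T}. LBINT x:{0<..<L}. fn n t x * \<phi> t x) \<longlonglongrightarrow>
        (LBINT t:{0<..<T}. LBINT x:{0<..<L}. f t x * \<phi> t x)"
      using L2_approx_double_integral(2)[OF T L f c\<phi>(1)]
      by (simp only: set_integral_diff(2)[OF iGn(2) iG(2)] LIM_zero_iff)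
    ultimately show ?thesis unfolding o1 o2 by (rule tendsto_diff)
  qed
  have "(\<lambda>n. (LBINT x:{0<..<L}. yn n T x * \<phi> T x) - (LBINT x:{0<..<L}. yn n 0 x * \<phi> 0 x)
        + c * (LBINT t:{0<..<T}. yLn n t * \<phi> t L - y0n n t * \<phi> t 0)) \<longlonglongrightarrow>
      (LBINT x:{0<..<L}. y T x * \<phi> T x) - (LBINT x:{0<..<L}. y 0 x * \<phi> 0 x)
        + c * (LBINT t:{0<..<T}. yL t * \<phi> t L - y0 t * \<phi> t 0)"
    using T by (intro tendsto_intros 1 2) auto
  then show ?thesis
    using LIMSEQ_unique[OF _ 3] eq unfolding weak_identity_def \<psi>_def[symmetric] by simp
qed

lemma L2_on_integral_mono_set:
  assumes "f \<in> L2_on S'" "S \<subseteq> S'" "S \<in> sets borel"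
  shows "(LBINT x:S. (f x)^2) \<le> (LBINT x:S'. (f x)^2)"
  unfolding set_lebesgue_integral_def
proof (rule integral_mono)
  show "integrable lborel (\<lambda>x. indicator S x *\<^sub>R (f x)^2)"
    using L2_on_subset[OF assms] by (simp add: L2_on_def set_integrable_def)
  show "integrable lborel (\<lambda>x. indicator S' x *\<^sub>R (f x)^2)"
    using assms(1) by (simp add: L2_on_def set_integrable_def)
  show "indicator S x *\<^sub>R (f x)^2 \<le> indicator S' x *\<^sub>R (f x)^2" for x
    using assms(2) by (auto simp: indicator_def)
qed

lemma wave_at_0 [simp]: "wave_l s1 s2 A B g t 0 = g t" "wave_r s1 s2 A B g t 0 = g t"
  by (simp_all add: wave_l_def wave_r_def set_lebesgue_integral_def)

lemma locsq_shift:
  assumes "locsq g"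
  shows "locsq (\<lambda>s. g (c + s))"
proof -
  have [measurable]: "g \<in> borel_measurable borel" using assms by (simp add: locsq_def)
  have m: "(\<lambda>s. g (c + s)) \<in> borel_measurable borel" by measurable
  have "(\<lambda>s. g (c + s)) \<in> L2_on {-R<..<R}" for R
  proof (cases "R \<ge> 0")
    case True
    let ?G = "\<lambda>s. indicator {-(R + \<bar>c\<bar>)<..<R + \<bar>c\<bar>} s * g s"
    show ?thesis
    proof (rule L2_on_affine_bound(1)[OF m locsq_truncate(2)[OF assms]])
      show "\<bar>g (c + x)\<bar> \<le> \<bar>?G (c + 1 * x)\<bar> + 0" if "x \<in> {-R<..<R}" for x
      proof -
        have "c + x \<in> {-(R + \<bar>c\<bar>)<..<R + \<bar>c\<bar>}" using that by auto
        then show ?thesis by simp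
      qed
    qed (use True in auto)
  next
    case False
    then have "{-R<..<R} = {}" by auto
    then show ?thesis by (simp add: L2_on_def set_borel_measurable_def)
  qed
  then show ?thesis using m by (simp add: locsq_def)
qed

text \<open>By linearity the error of the wave is the wave of the error, to which
  \<open>L2_bounded_traces\<close> applies. The variable \<open>W\<close> covers both components in
  one proof.\<close>

lemma wave_limit:
  assumes k: "s1 > 0" "s2 > 0" and L: "L > 0" and T: "T > 0" and g: "locsq g" and p: "\<And>n. locsq (p n)"
    and lim: "L2_lim (T + (s1 + s2) * L + 1) p g"
    and W: "W = wave_l s1 s2 A B \<or> W = wave_r s1 s2 A B"
  shows "\<exists>e. e \<longlonglongrightarrow> 0 \<and> (\<forall>n t. \<bar>t\<bar> \<le> T \<longrightarrow> (LBINT x:{0<..<L}. (W (p n) t x - W g t x)^2) \<le> e n)"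
    and "x \<in> {0..L} \<Longrightarrow> (\<lambda>n. LBINT t:{0<..<T}. (W (p n) t x - W g t x)^2) \<longlonglongrightarrow> 0"
    and "\<bar>t\<bar> \<le> T \<Longrightarrow> W g t \<in> L2_on {0<..<L}"
    and "x \<in> {0..L} \<Longrightarrow> (\<lambda>t. W g t x) \<in> L2_on {0<..<T}"
proof -
  define R where "R = T + (s1 + s2) * L + 1"
  obtain C where C: "L2_bounded_traces T L R W C"
    using W wave_l_L2_bound[OF k L T, of A B] wave_r_L2_bound[OF k L T, of A B] unfolding R_def by blast
  note C1 = C[unfolded L2_bounded_traces_def, THEN conjunct1, rule_format]
    and C2 = C[unfolded L2_bounded_traces_def, THEN conjunct2, rule_format]
  have diff: "W (\<lambda>s. g s - p n s) t x = W g t x - W (p n) t x" if "0 \<le> x" for n t x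
    using W wave_l_diff[OF g p k that] wave_r_diff[OF g p k that] by auto
  define e where "e n = C * (LBINT s:{-R<..<R}. (g s - p n s)^2)" for n
  have e: "e \<longlonglongrightarrow> 0" unfolding e_def using tendsto_mult_right_zero[OF lim, of C] by (simp add: R_def)
  have "(LBINT x:{0<..<L}. (W (p n) t x - W g t x)^2) \<le> e n" if "\<bar>t\<bar> \<le> T" for n t
  proof -
    have "(LBINT x:{0<..<L}. (W (p n) t x - W g t x)^2) = (LBINT x:{0<..<L}. (W (\<lambda>s. g s - p n s) t x)^2)"
      by (intro set_lebesgue_integral_cong) (auto simp: diff power2_commute)
    then show ?thesis using C1[OF locsq_diff[OF g p] that, of n] by (simp add: e_def)
  qed
  with e show "\<exists>e. e \<longlonglongrightarrow> 0 \<and> (\<forall>n t. \<bar>t\<bar> \<le> T \<longrightarrow> (LBINT x:{0<..<L}. (W (p n) t x - W g t x)^2) \<le> e n)"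
    by blast
  show "W g t \<in> L2_on {0<..<L}" if "\<bar>t\<bar> \<le> T" using C1[OF g that] by simp
  show "(\<lambda>t. W g t x) \<in> L2_on {0<..<T}" if "x \<in> {0..L}"
    using C2[OF g that] T by (auto intro: L2_on_subset)
  show "(\<lambda>n. LBINT t:{0<..<T}. (W (p n) t x - W g t x)^2) \<longlonglongrightarrow> 0" if x: "x \<in> {0..L}"
  proof (rule Lim_null_comparison[OF _ e], intro always_eventually allI)
    fix n
    note c = C2[OF locsq_diff[OF g p] x, of n]
    have "(LBINT t:{0<..<T}. (W (p n) t x - W g t x)^2) = (LBINT t:{0<..<T}. (W (\<lambda>s. g s - p n s) t x)^2)"
      using x by (intro set_lebesgue_integral_cong) (auto simp: diff power2_commute)
    also have "\<dots> \<le> (LBINT t:{-T<..<T}. (W (\<lambda>s. g s - p n s) t x)^2)"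
      using c T by (intro L2_on_integral_mono_set) auto
    also have "\<dots> \<le> e n" using c by (simp add: e_def)
    finally show "norm (LBINT t:{0<..<T}. (W (p n) t x - W g t x)^2) \<le> e n"
      by (simp only: real_norm_def abs_of_nonneg L2_on_integral_nonneg)
  qed
qed

section \<open>Square-integrable traces generate weak solutions\<close>

lemma real_polynomial_function_C1:
  assumes "real_polynomial_function p"
  obtains p' where "\<And>s. (p has_real_derivative p' s) (at s)" "continuous_on UNIV p'" "continuous_on UNIV p"
proof -
  have c: "continuous_on UNIV q" if "real_polynomial_function q" for q :: "real \<Rightarrow> real"
    using that continuous_on_polymonial_function[of q UNIV] by (simp add: real_polynomial_function_eq)
  obtain p' where "real_polynomial_function p'" "\<forall>s. (p has_real_derivative p' s) (at s)"
    using has_real_derivative_polynomial_function[OF assms] by (elim exE conjE)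
  with c assms show ?thesis by (intro that[of p']) auto
qed

lemma C1_test_wave:
  assumes g: "\<And>s. (g has_real_derivative g' s) (at s)" and g': "continuous_on UNIV g'"
    and k: "s1 + s2 > 0"
  shows "C1_test T L (wave_l s1 s2 A B g) (wave_l s1 s2 A B g')
      (\<lambda>t x. s1 * wave_l s1 s2 A B g' t x + (s1 + s2) * A * wave_r s1 s2 A B g t x)"
    and "C1_test T L (wave_r s1 s2 A B g) (wave_r s1 s2 A B g')
      (\<lambda>t x. - s2 * wave_r s1 s2 A B g' t x + (s1 + s2) * B * wave_l s1 s2 A B g t x)"
proof -
  have g0: "continuous_on UNIV g"
    by (intro continuous_at_imp_continuous_on ballI DERIV_isCont[OF g])
  have c: "continuous_on ({0..T} \<times> {0..L}) (\<lambda>w. wave_l s1 s2 A B h (fst w) (snd w))"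
    "continuous_on ({0..T} \<times> {0..L}) (\<lambda>w. wave_r s1 s2 A B h (fst w) (snd w))" if "continuous_on UNIV h" for h
    by (rule continuous_on_subset[OF continuous_on_wave_l[OF that k]], force,
        rule continuous_on_subset[OF continuous_on_wave_r[OF that k]], force)
  show "C1_test T L (wave_l s1 s2 A B g) (wave_l s1 s2 A B g')
      (\<lambda>t x. s1 * wave_l s1 s2 A B g' t x + (s1 + s2) * A * wave_r s1 s2 A B g t x)"
    by (rule C1_testI) (auto intro!: continuous_intros c g0 g' has_field_derivative_at_within[OF wave_l_dt[OF g g']] wave_l_dx[OF g g' k])
  show "C1_test T L (wave_r s1 s2 A B g) (wave_r s1 s2 A B g')
      (\<lambda>t x. - s2 * wave_r s1 s2 A B g' t x + (s1 + s2) * B * wave_l s1 s2 A B g t x)"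
  proof (rule C1_testI)
    show "((\<lambda>x. wave_r s1 s2 A B g t x) has_real_derivative
       - s2 * wave_r s1 s2 A B g' t x + (s1 + s2) * B * wave_l s1 s2 A B g t x) (at x within {0..L})" if "x \<in> {0..L}" for t x
      by (rule wave_r_dx[OF g g' k that])
  qed (auto intro!: continuous_intros c g0 g' has_field_derivative_at_within[OF wave_r_dt[OF g g']])
qed

lemma C1_test_cmult:
  assumes "C1_test T L \<phi> \<phi>t \<phi>x"
  shows "C1_test T L (\<lambda>t x. c * \<phi> t x) (\<lambda>t x. c * \<phi>t t x) (\<lambda>t x. c * \<phi>x t x)"
  by (rule C1_testI)
    (use C1_test_partials[OF assms] C1_test_continuous[OF assms] in \<open>auto intro!: DERIV_cmult continuous_intros\<close>)

lemma L2_approx_cmult: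
  assumes "L2_approx T L yn y"
  shows "L2_approx T L (\<lambda>n t x. c * yn n t x) (\<lambda>t x. c * y t x)"
proof -
  obtain e where e: "e \<longlonglongrightarrow> 0" "\<And>n t. t \<in> {0..T} \<Longrightarrow> (LBINT x:{0<..<L}. (yn n t x - y t x)^2) \<le> e n"
    using assms unfolding L2_approx_def by blast
  have eq: "(c * u - c * v)^2 = c^2 * (u - v)^2" for u v :: real
    by (simp add: power_mult_distrib flip: right_diff_distrib)
  have "(\<lambda>n. c^2 * e n) \<longlonglongrightarrow> 0" using tendsto_mult_right_zero[OF e(1)] .
  moreover have "(LBINT x:{0<..<L}. (c * yn n t x - c * y t x)^2) \<le> c^2 * e n" if "t \<in> {0..T}" for n t
    unfolding eq using mult_left_mono[OF e(2)[OF that], of "c^2" n] by simp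
  ultimately have "\<exists>e. e \<longlonglongrightarrow> 0 \<and> (\<forall>n. \<forall>t\<in>{0..T}. (LBINT x:{0<..<L}. (c * yn n t x - c * y t x)^2) \<le> e n)"
    by blast
  then show ?thesis
    using assms unfolding L2_approx_def by (auto intro!: continuous_intros L2_on_cmult)
qed

lemma wave_L2_approx:
  assumes k: "s1 > 0" "s2 > 0" and L: "L > 0" and T: "T > 0" and g: "locsq g" and p: "\<And>n. real_polynomial_function (p n)"
    and lim: "L2_lim (T + (s1 + s2) * L + 1) p g"
    and W: "W = wave_l s1 s2 A B \<or> W = wave_r s1 s2 A B"
  shows "L2_approx T L (\<lambda>n. W (p n)) (W g)"
proof -
  have pc: "continuous_on UNIV (p n)" for n by (rule real_polynomial_function_C1[OF p])
  note lims = wave_limit[OF k L T g locsq_continuous[OF pc] lim W]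
  have "continuous_on ({0..T} \<times> {0..L}) (\<lambda>w. W (p n) (fst w) (snd w))" for n
    using W
  proof
    assume *: "W = wave_l s1 s2 A B"
    show ?thesis
      unfolding * by (rule continuous_on_subset[OF continuous_on_wave_l[OF pc]]) (use k in auto)
  next
    assume *: "W = wave_r s1 s2 A B"
    show ?thesis
      unfolding * by (rule continuous_on_subset[OF continuous_on_wave_r[OF pc]]) (use k in auto)
  qed
  moreover obtain e where "e \<longlonglongrightarrow> 0" "\<forall>n t. \<bar>t\<bar> \<le> T \<longrightarrow> (LBINT x:{0<..<L}. (W (p n) t x - W g t x)^2) \<le> e n"
    using lims(1) by (elim exE conjE) (rule that)
  ultimately show ?thesis
    unfolding L2_approx_def using lims(3) by (intro conjI allI ballI exI[of _ e]) auto
qed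

text \<open>Solving the sideways equations for the time derivatives gives the speeds
  \<open>- 1 / s1\<close> and \<open>1 / s2\<close> and these coupling constants. Polynomial traces
  satisfy the equations classically; a general trace is their L^2 limit.\<close>

lemma wave_weak_transport:
  assumes k: "s1 > 0" "s2 > 0" and L: "L > 0" and g: "locsq g"
  shows "weak_transport L (- 1 / s1) (wave_l s1 s2 A B g) (\<lambda>t x. ((s1 + s2) * A / s1) * wave_r s1 s2 A B g t x) g (\<lambda>t. wave_l s1 s2 A B g t L)"
    and "weak_transport L (1 / s2) (wave_r s1 s2 A B g) (\<lambda>t x. (- (s1 + s2) * B / s2) * wave_l s1 s2 A B g t x) g (\<lambda>t. wave_r s1 s2 A B g t L)"
proof -
  let ?P = "wave_l s1 s2 A B" and ?Q = "wave_r s1 s2 A B"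
  have ends: "0 \<in> {0..L}" "L \<in> {0..L}" using L by auto
  have kk: "s1 + s2 > 0" using k by simp
  have "weak_identity T L (- 1 / s1) (?P g) (\<lambda>t x. ((s1 + s2) * A / s1) * ?Q g t x) g (\<lambda>t. ?P g t L) \<phi> \<phi>t \<phi>x \<and>
     weak_identity T L (1 / s2) (?Q g) (\<lambda>t x. (- (s1 + s2) * B / s2) * ?P g t x) g (\<lambda>t. ?Q g t L) \<phi> \<phi>t \<phi>x"
    if T: "T > 0" and \<phi>: "C1_test T L \<phi> \<phi>t \<phi>x" for T \<phi> \<phi>t \<phi>x
  proof -
    obtain p where p: "\<And>n. real_polynomial_function (p n)"
      and lim: "L2_lim (T + (s1 + s2) * L + 1) p g"
      by (rule locsq_approx[OF g, of "T + (s1 + s2) * L + 1"], rule that[rotated], assumption) simp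
    have "\<exists>p'. (\<forall>s. (p n has_real_derivative p' s) (at s)) \<and> continuous_on UNIV p' \<and> continuous_on UNIV (p n)" for n
      by (rule real_polynomial_function_C1[OF p[of n]]) blast
    then obtain p' where p': "\<And>n s. (p n has_real_derivative p' n s) (at s)" "\<And>n. continuous_on UNIV (p' n)"
      and pc: "\<And>n. continuous_on UNIV (p n)" by metis
    note pl = locsq_continuous[OF pc]
    note apP = wave_L2_approx[OF k L T g p lim disjI1[OF refl[of ?P]]]
    note apQ = wave_L2_approx[OF k L T g p lim disjI2[OF refl[of ?Q]]]
    note bdP = wave_limit(2)[OF k L T g pl lim disjI1[OF refl[of ?P]]]
      wave_limit(4)[OF k L T g pl lim disjI1[OF refl[of ?P]]]
      wave_limit(4)[OF k L T pl pl _ disjI1[OF refl[of ?P]]]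
    note bdQ = wave_limit(2)[OF k L T g pl lim disjI2[OF refl[of ?Q]]]
      wave_limit(4)[OF k L T g pl lim disjI2[OF refl[of ?Q]]]
      wave_limit(4)[OF k L T pl pl _ disjI2[OF refl[of ?Q]]]
    \<comment> \<open>A constant sequence converges to itself; with it \<open>wave_limit\<close>
      yields square integrability of the boundary traces of each polynomial wave.\<close>
    have z: "(\<lambda>n. LBINT s:S. (p m s - p m s)^2) \<longlonglongrightarrow> 0" for S m
      by (simp add: set_lebesgue_integral_def)
    have "weak_identity T L (- 1 / s1) (?P g) (\<lambda>t x. ((s1 + s2) * A / s1) * ?Q g t x) (\<lambda>t. ?P g t 0) (\<lambda>t. ?P g t L) \<phi> \<phi>t \<phi>x"
    proof (rule L2_approx_weak_identity[OF T L apP L2_approx_cmult[OF apQ] bdP(3)[OF z ends(1)] bdP(2)[OF ends(1)] bdP(1)[OF ends(1)]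
          bdP(3)[OF z ends(2)] bdP(2)[OF ends(2)] bdP(1)[OF ends(2)] \<phi>])
      show "weak_identity T L (- 1 / s1) (?P (p n)) (\<lambda>t x. (s1 + s2) * A / s1 * ?Q (p n) t x) (\<lambda>t. ?P (p n) t 0) (\<lambda>t. ?P (p n) t L) \<phi> \<phi>t \<phi>x" for n
        by (rule classical_weak_identity[OF _ _ C1_test_wave(1)[OF p' kk] \<phi>]) (use T L k in \<open>auto simp: field_simps\<close>)
    qed
    moreover have "weak_identity T L (1 / s2) (?Q g) (\<lambda>t x. (- (s1 + s2) * B / s2) * ?P g t x) (\<lambda>t. ?Q g t 0) (\<lambda>t. ?Q g t L) \<phi> \<phi>t \<phi>x"
    proof (rule L2_approx_weak_identity[OF T L apQ L2_approx_cmult[OF apP] bdQ(3)[OF z ends(1)] bdQ(2)[OF ends(1)] bdQ(1)[OF ends(1)]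
          bdQ(3)[OF z ends(2)] bdQ(2)[OF ends(2)] bdQ(1)[OF ends(2)] \<phi>])
      show "weak_identity T L (1 / s2) (?Q (p n)) (\<lambda>t x. - (s1 + s2) * B / s2 * ?P (p n) t x) (\<lambda>t. ?Q (p n) t 0) (\<lambda>t. ?Q (p n) t L) \<phi> \<phi>t \<phi>x" for n
        by (rule classical_weak_identity[OF _ _ C1_test_wave(2)[OF p' kk] \<phi>]) (use T L k in \<open>auto simp: field_simps\<close>)
    qed
    ultimately show ?thesis by simp
  qed
  then show "weak_transport L (- 1 / s1) (wave_l s1 s2 A B g) (\<lambda>t x. ((s1 + s2) * A / s1) * wave_r s1 s2 A B g t x) g (\<lambda>t. wave_l s1 s2 A B g t L)"
    and "weak_transport L (1 / s2) (wave_r s1 s2 A B g) (\<lambda>t x. (- (s1 + s2) * B / s2) * wave_l s1 s2 A B g t x) g (\<lambda>t. wave_r s1 s2 A B g t L)"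
    unfolding weak_transport_iff by blast+
qed

lemma wave_regularity:
  assumes k: "s1 > 0" "s2 > 0" and L: "L > 0" and g: "locsq g"
    and W: "W = wave_l s1 s2 A B \<or> W = wave_r s1 s2 A B"
  shows "W g \<in> C0_L2 L" and "x \<in> {0..L} \<Longrightarrow> (\<lambda>t. W g t x) \<in> L2_loc"
proof -
  show "W g \<in> C0_L2 L"
  proof (rule L2_approx_C0_L2)
    fix T :: real assume T: "T > 0"
    obtain p where p: "\<And>n. real_polynomial_function (p n)"
      and lim: "L2_lim (T + (s1 + s2) * L + 1) p g"
      by (rule locsq_approx[OF g, of "T + (s1 + s2) * L + 1"], rule that[rotated], assumption) simp
    show "\<exists>yn. L2_approx T L yn (W g)" using wave_L2_approx[OF k L T g p lim W] by blast
  qed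
  assume x: "x \<in> {0..L}"
  have "(\<lambda>t. W g t x) \<in> L2_on {0<..<T}" if T: "T > 0" for T
  proof -
    have "(\<lambda>n::nat. LBINT s:S. (g s - g s)^2) \<longlonglongrightarrow> 0" for S
      by (simp add: set_lebesgue_integral_def)
    then show ?thesis by (rule wave_limit(4)[OF k L T g g _ W x])
  qed
  then show "(\<lambda>t. W g t x) \<in> L2_loc" by (simp add: L2_loc_def)
qed

section \<open>A Volterra equation for the trace\<close>

text \<open>A Neumann series in the norm weighted by \<open>w\<close>, in which the kernel has norm
  at most 1/2. The equation is solved for the correction \<open>v\<close> to \<open>f\<close>: no
  pointwise bound on \<open>f\<close> is available, but its image under the kernel is bounded by
  \<open>w\<close>.\<close>

lemma volterra_solution:
  fixes N :: "real \<Rightarrow> real \<Rightarrow> real" and w f :: "real \<Rightarrow> real"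
  assumes [measurable]: "(\<lambda>(s, r). N s r) \<in> borel_measurable (borel \<Otimes>\<^sub>M borel)" "w \<in> borel_measurable borel" "f \<in> borel_measurable borel"
    and w: "\<And>s. w s \<ge> 0" "\<And>s. integrable lborel (\<lambda>r. \<bar>N s r\<bar> * w r)" "\<And>s. (LBINT r. \<bar>N s r\<bar> * w r) \<le> w s / 2"
    and f: "\<And>s. integrable lborel (\<lambda>r. N s r * f r)" "\<And>s. \<bar>LBINT r. N s r * f r\<bar> \<le> w s"
  obtains v where "v \<in> borel_measurable borel" "\<And>s. \<bar>v s\<bar> \<le> 2 * w s"
    "\<And>s. v s = (LBINT r. N s r * (f r + v r))"
proof -
  have [measurable]: "(\<lambda>x. N (h x) (k x)) \<in> borel_measurable M" if [measurable]: "h \<in> borel_measurable M" "k \<in> borel_measurable M" for M :: "'b measure" and h k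
  proof -
    have "(\<lambda>x. (h x, k x)) \<in> measurable M (borel \<Otimes>\<^sub>M borel)" by measurable
    from measurable_compose[OF this assms(1)] show ?thesis by simp
  qed
  define Op where "Op u s = (LBINT r. N s r * u r)" for u :: "real \<Rightarrow> real" and s
  \<comment> \<open>The exponent starts at 1, because the term \<open>f\<close> itself is kept out
    of the series.\<close>
  define vn where "vn n = (Op ^^ Suc n) f" for n
  have vnS: "vn (Suc n) = Op (vn n)" and vn0: "vn 0 = Op f" for n by (simp_all add: vn_def)
  have Om: "Op u \<in> borel_measurable borel" if [measurable]: "u \<in> borel_measurable borel" for u
    unfolding Op_def by measurable
  have vm [measurable]: "vn n \<in> borel_measurable borel" for n
    by (induction n) (simp_all add: vnS vn0 Om)
  have step: "integrable lborel (\<lambda>r. N s r * u r)" "(LBINT r. norm (N s r * u r)) \<le> c * w s / 2"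
    if [measurable]: "u \<in> borel_measurable borel" and u: "\<And>r. \<bar>u r\<bar> \<le> c * w r" and c: "c \<ge> 0" for u c s
  proof -
    have bd: "norm (N s r * u r) \<le> c * (\<bar>N s r\<bar> * w r)" for r
      using mult_left_mono[OF u[of r], of "\<bar>N s r\<bar>"] by (simp add: abs_mult mult_ac)
    show i: "integrable lborel (\<lambda>r. N s r * u r)"
      by (rule Bochner_Integration.integrable_bound[OF integrable_mult_right[OF w(2), of c s]])
        (use bd in \<open>auto intro!: AE_I2 intro: order_trans[OF _ abs_ge_self]\<close>)
    have "(LBINT r. norm (N s r * u r)) \<le> (LBINT r. c * (\<bar>N s r\<bar> * w r))"
      using bd i w(2) by (intro integral_mono integrable_norm integrable_mult_right)
    also have "\<dots> = c * (LBINT r. \<bar>N s r\<bar> * w r)" by simp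
    also have "\<dots> \<le> c * w s / 2"
      using c mult_left_mono[OF w(3)[of s], of c] by auto
    finally show "(LBINT r. norm (N s r * u r)) \<le> c * w s / 2" .
  qed
  have vb: "\<bar>vn n s\<bar> \<le> (1 / 2) ^ n * w s" for n s
  proof (induction n arbitrary: s)
    case 0
    show ?case using f(2)[of s] by (simp add: vn0 Op_def)
  next
    case (Suc n)
    have "\<bar>vn (Suc n) s\<bar> \<le> (LBINT r. norm (N s r * vn n r))"
      unfolding vnS Op_def using integral_norm_bound[of lborel "\<lambda>r. N s r * vn n r"] by simp
    also have "\<dots> \<le> (1 / 2) ^ n * w s / 2" using step(2)[OF vm Suc.IH] by simp
    finally show ?case by simp
  qed
  have geo: "summable (\<lambda>n. (1 / 2) ^ n * c)" "(\<Sum>n. (1 / 2) ^ n * c) = 2 * c" for c :: real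
    using summable_mult2[OF summable_geometric[of "1/2::real"], of c]
      suminf_mult2[OF summable_geometric[of "1/2::real"], of c] suminf_geometric[of "1/2::real"] by simp_all
  have sn: "summable (\<lambda>n. \<bar>vn n s\<bar>)" for s
    by (rule summable_comparison_test'[OF geo(1)[of "w s"]]) (use vb in auto)
  define v where "v s = (\<Sum>n. vn n s)" for s
  have "v \<in> borel_measurable borel" unfolding v_def by measurable
  moreover have "\<bar>v s\<bar> \<le> 2 * w s" for s
  proof -
    have "\<bar>v s\<bar> \<le> (\<Sum>n. \<bar>vn n s\<bar>)" unfolding v_def by (rule summable_rabs[OF sn])
    also have "\<dots> \<le> (\<Sum>n. (1 / 2) ^ n * w s)" by (intro suminf_le vb sn geo)
    finally show ?thesis by (simp add: geo)
  qed
  moreover have "v s = (LBINT r. N s r * (f r + v r))" for s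
  proof -
    have i: "integrable lborel (\<lambda>r. N s r * vn n r)" for n by (rule step(1)[OF vm vb]) simp
    have "AE r in lborel. summable (\<lambda>n. norm (N s r * vn n r))"
      using summable_mult[OF sn] by (intro AE_I2) (simp add: abs_mult)
    moreover have "summable (\<lambda>n. LBINT r. norm (N s r * vn n r))"
    proof (rule summable_comparison_test'[OF geo(1)[of "w s / 2"]])
      show "norm (LBINT r. norm (N s r * vn n r)) \<le> (1 / 2) ^ n * (w s / 2)" for n
        using step(2)[OF vm vb, of n s] by simp
    qed
    ultimately have S: "(\<lambda>n. LBINT r. N s r * vn n r) sums (LBINT r. (\<Sum>n. N s r * vn n r))"
      and S': "integrable lborel (\<lambda>r. \<Sum>n. N s r * vn n r)"
      using sums_integral[of lborel "\<lambda>n r. N s r * vn n r"] integrable_suminf[of lborel "\<lambda>n r. N s r * vn n r"] i by blast+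
    have e: "(\<lambda>r. \<Sum>n. N s r * vn n r) = (\<lambda>r. N s r * v r)"
      unfolding v_def by (intro ext suminf_mult summable_rabs_cancel[OF sn])
    have "(\<lambda>n. vn (Suc n) s) sums (LBINT r. N s r * v r)"
      using S unfolding e by (simp add: vnS Op_def)
    then have "(\<lambda>n. vn n s) sums ((LBINT r. N s r * v r) + vn 0 s)" by (rule sums_Suc)
    then have "v s = (LBINT r. N s r * v r) + (LBINT r. N s r * f r)"
      unfolding v_def using sums_unique by (metis vn0 Op_def)
    also have "\<dots> = (LBINT r. N s r * f r + N s r * v r)"
      using f(1)[of s] S' unfolding e by simp
    finally show ?thesis by (simp add: distrib_left)
  qed
  ultimately show ?thesis by (rule that)
qed

lemma integral_exp_weight:
  fixes s1 \<gamma> c :: real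
  assumes "s1 > 0" "\<gamma> > 0" "c \<ge> 0"
  shows "integrable lborel (\<lambda>r. indicator {0..s1 * c} r * exp (\<gamma> * (r / s1)))"
    and "(LBINT r. indicator {0..s1 * c} r * exp (\<gamma> * (r / s1))) \<le> s1 / \<gamma> * exp (\<gamma> * c)"
proof -
  have c: "continuous_on {0..s1 * c} (\<lambda>r. exp (\<gamma> * (r / s1)))" using assms by (intro continuous_intros) auto
  show "integrable lborel (\<lambda>r. indicator {0..s1 * c} r * exp (\<gamma> * (r / s1)))"
    using borel_integrable_atLeastAtMost'[OF c] by (simp add: set_integrable_def)
  have "(LBINT r. indicator {0..s1 * c} r *\<^sub>R exp (\<gamma> * (r / s1)))
      = s1 / \<gamma> * exp (\<gamma> * (s1 * c / s1)) - s1 / \<gamma> * exp (\<gamma> * (0 / s1))"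
  proof (rule integral_FTC_atLeastAtMost[OF _ _ c])
    show "((\<lambda>r. s1 / \<gamma> * exp (\<gamma> * (r / s1))) has_vector_derivative exp (\<gamma> * (x / s1))) (at x within {0..s1 * c})" for x
      unfolding has_real_derivative_iff_has_vector_derivative[symmetric]
      using assms by (auto intro!: derivative_eq_intros)
  qed (use assms in auto)
  also have "\<dots> \<le> s1 / \<gamma> * exp (\<gamma> * c)" using assms by simp
  finally show "(LBINT r. indicator {0..s1 * c} r * exp (\<gamma> * (r / s1))) \<le> s1 / \<gamma> * exp (\<gamma> * c)" by simp
qed

lemma L2_on_UNIV_iff: "f \<in> L2_on UNIV \<longleftrightarrow> f \<in> borel_measurable borel \<and> integrable lborel (\<lambda>x. (f x)^2)"
  by (simp add: L2_on_def set_borel_measurable_def set_integrable_def)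

text \<open>
  Let \<open>\<rho> s\<close> be the smallest \<open>x\<close> at which \<open>g s\<close> enters the state at time \<open>0\<close>. Prescribing the state at
  time \<open>0\<close> and the control determines \<open>g s\<close> up to an integral over points \<open>r\<close> with \<open>\<rho> r < \<rho> s\<close>, and
  the weight \<open>exp (\<gamma> * \<rho> s)\<close> turns this into a contraction.
\<close>

lemma wave_trace_equation:
  assumes k: "s1 > 0" "s2 > 0" and L: "L > 0" and f: "f \<in> L2_on UNIV"
  obtains g where "locsq g"
    "\<And>t x. x > 0 \<Longrightarrow> t = 0 \<and> x \<le> L \<or> t > 0 \<and> x = L \<Longrightarrow> wave_l s1 s2 A B g t x = f (t + s1 * x)"
    "\<And>x. x > 0 \<Longrightarrow> x \<le> L \<Longrightarrow> wave_r s1 s2 A B g 0 x = f (- s2 * x)"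
proof -
  define k where "k = s1 + s2"
  define \<rho> where "\<rho> s = (if s \<ge> 0 then s / s1 else - s / s2)" for s
  \<comment> \<open>The position at which the equation for \<open>g s\<close> is posed: on the
    initial line while \<open>\<rho> s \<le> L\<close>, on the boundary \<open>x = L\<close> from
    there on.\<close>
  define \<xi> where "\<xi> s = min (\<rho> s) L" for s
  \<comment> \<open>The integral terms of \<open>wave_l\<close> (for \<open>s \<ge> 0\<close>) and
    of \<open>wave_r\<close> (for \<open>s < 0\<close>), moved to the other side of the equation,
    hence the minus signs.\<close>
  define N where "N s r = (if s \<ge> 0 
       then if 0 < s - r \<and> s - r < k * \<xi> s then - ker A B (s - r) (k * \<xi> s - (s - r)) else 0
       else if 0 < r - s \<and> r - s < k * \<xi> s then - ker B A (r - s) (k * \<xi> s - (r - s)) else 0)" for s r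
  have kpos: "k > 0" using k by (simp add: k_def)
  have rho0: "\<rho> s \<ge> 0" for s using k by (auto simp: \<rho>_def intro: divide_nonpos_pos)
  have xi: "0 \<le> \<xi> s" "\<xi> s \<le> \<rho> s" "\<xi> s \<le> L" for s using rho0[of s] L by (auto simp: \<xi>_def)
  have kxi: "k * \<xi> s \<le> k * L" "k * \<xi> s \<le> k * \<rho> s" for s using xi[of s] kpos by auto
  obtain M1 where M1: "M1 > 0" "\<And>p q. p \<in> {0..k * L} \<Longrightarrow> q \<in> {0..k * L} \<Longrightarrow> \<bar>ker A B p q\<bar> \<le> M1"
    by (rule ker_bound[of "k * L" A B]) blast
  obtain M2 where M2: "M2 > 0" "\<And>p q. p \<in> {0..k * L} \<Longrightarrow> q \<in> {0..k * L} \<Longrightarrow> \<bar>ker B A p q\<bar> \<le> M2"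
    by (rule ker_bound[of "k * L" B A]) blast
  define M where "M = M1 + M2"
  have M: "M > 0" using M1(1) M2(1) by (simp add: M_def)
  have NM: "\<bar>N s r\<bar> \<le> M" for s r
  proof -
    have "\<bar>ker A B d (k * \<xi> s - d)\<bar> \<le> M" "\<bar>ker B A d (k * \<xi> s - d)\<bar> \<le> M" if "0 < d" "d < k * \<xi> s" for d
      using M1(2)[of d "k * \<xi> s - d"] M2(2)[of d "k * \<xi> s - d"] M1(1) M2(1) that kxi(1)[of s] by (auto simp: M_def)
    then show ?thesis using M by (auto simp: N_def)
  qed
  \<comment> \<open>The first two bounds say \<open>\<rho> r < \<rho> s\<close>, the Volterra
    structure; the third gives each \<open>N s\<close> bounded support.\<close>
  have supp: "- s2 * \<rho> s < r \<and> r < s1 * \<rho> s \<and> \<bar>s - r\<bar> < k * L" if "N s r \<noteq> 0" for s r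
  proof (cases "s \<ge> 0")
    case True
    then have s: "s = s1 * \<rho> s" using k by (simp add: \<rho>_def)
    have "0 < s - r" "s - r < k * \<xi> s" using that True by (auto simp: N_def split: if_splits)
    then have "0 < s - r" "s - r < k * \<rho> s" "s - r < k * L" using kxi[of s] by auto
    then show ?thesis using s by (simp add: k_def distrib_right)
  next
    case False
    then have s: "s = - s2 * \<rho> s" using k by (simp add: \<rho>_def)
    have "0 < r - s" "r - s < k * \<xi> s" using that False by (auto simp: N_def split: if_splits)
    then have "0 < r - s" "r - s < k * \<rho> s" "r - s < k * L" using kxi[of s] by auto
    then show ?thesis using s by (simp add: k_def distrib_right)
  qed
  have [measurable]: "\<rho> \<in> borel_measurable borel" unfolding \<rho>_def by measurable
  have [measurable]: "\<xi> \<in> borel_measurable borel" unfolding \<xi>_def by measurable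
  have Nm [measurable]: "(\<lambda>(s, r). N s r) \<in> borel_measurable (borel \<Otimes>\<^sub>M borel)"
    unfolding N_def split_beta by measurable
  have Ns [measurable]: "N s \<in> borel_measurable borel" for s
    unfolding N_def by measurable
  have fm [measurable]: "f \<in> borel_measurable borel" and f2: "integrable lborel (\<lambda>x. (f x)^2)"
    using f by (auto simp: L2_on_UNIV_iff)
  have N2: "integrable lborel (\<lambda>r. (N s r)^2)" "(LBINT r. (N s r)^2) \<le> 2 * k * L * M^2" for s
  proof -
    have bd: "(N s r)^2 \<le> indicator {s - k * L..s + k * L} r * M^2" for r
    proof (cases "N s r = 0")
      case False
      have "\<bar>N s r\<bar>^2 \<le> M^2" using NM[of s r] by (intro power_mono) auto
      then show ?thesis using supp[OF False] by (auto simp: indicator_def)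
    qed simp
    have i: "integrable lborel (\<lambda>r. indicator {s - k * L..s + k * L} r * M^2)"
      by (intro integrable_mult_left integrable_real_indicator) (auto simp: emeasure_lborel_Icc_eq)
    show i2: "integrable lborel (\<lambda>r. (N s r)^2)"
      by (rule Bochner_Integration.integrable_bound[OF i]) (use bd in \<open>auto intro!: AE_I2\<close>)
    have "(LBINT r. (N s r)^2) \<le> (LBINT r. indicator {s - k * L..s + k * L} r * M^2)"
      by (intro integral_mono i i2 bd)
    also have "\<dots> = 2 * k * L * M^2" using kpos L by simp
    finally show "(LBINT r. (N s r)^2) \<le> 2 * k * L * M^2" .
  qed
  \<comment> \<open>Chosen so that \<open>(N s r)^2 + (f r)^2\<close>, which dominates
    \<open>N s r * f r\<close>, has integral at most \<open>W\<close> for every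
    \<open>s\<close>.\<close>
  define W where "W = 2 * k * L * M^2 + (LBINT r. (f r)^2)"
  have W: "W \<ge> 0" unfolding W_def using kpos L by (intro add_nonneg_nonneg mult_nonneg_nonneg integral_nonneg_AE) auto
  \<comment> \<open>Integrating the weight over positive and negative \<open>r\<close> gives
    \<open>s1 / \<gamma>\<close> and \<open>s2 / \<gamma>\<close>; with the kernel bound
    \<open>M\<close> the contraction factor is \<open>M * k / \<gamma>\<close>, here equal to
    1/2.\<close>
  define \<gamma> where "\<gamma> = 2 * M * k"
  have g: "\<gamma> > 0" using M kpos by (simp add: \<gamma>_def)
  define w where "w s = W * exp (\<gamma> * \<rho> s)" for s
  have wW: "W \<le> w s" for s
    unfolding w_def using W g rho0[of s] mult_left_mono[of 1 "exp (\<gamma> * \<rho> s)" W] by simp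
  have fN: "integrable lborel (\<lambda>r. N s r * f r)" "\<bar>LBINT r. N s r * f r\<bar> \<le> w s" for s
  proof -
    have bd: "\<bar>N s r * f r\<bar> \<le> (N s r)^2 + (f r)^2" for r
    proof -
      have "2 * \<bar>N s r\<bar> * \<bar>f r\<bar> \<le> \<bar>N s r\<bar>^2 + \<bar>f r\<bar>^2" by (rule sum_squares_bound)
      moreover have "0 \<le> \<bar>N s r\<bar> * \<bar>f r\<bar>" by simp
      ultimately have "\<bar>N s r\<bar> * \<bar>f r\<bar> \<le> \<bar>N s r\<bar>^2 + \<bar>f r\<bar>^2" by linarith
      then show ?thesis by (simp add: abs_mult)
    qed
    have i: "integrable lborel (\<lambda>r. (N s r)^2 + (f r)^2)" using N2(1) f2 by simp
    show i2: "integrable lborel (\<lambda>r. N s r * f r)"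
      by (rule Bochner_Integration.integrable_bound[OF i]) (use bd in \<open>auto intro!: AE_I2\<close>)
    have "\<bar>LBINT r. N s r * f r\<bar> \<le> (LBINT r. (N s r)^2 + (f r)^2)"
      by (intro order_trans[OF integral_abs_bound] integral_mono integrable_abs i i2 bd)
    also have "\<dots> \<le> W" using N2[of s] f2 by (simp add: W_def)
    finally show "\<bar>LBINT r. N s r * f r\<bar> \<le> w s" using wW[of s] by simp
  qed
  have wN: "integrable lborel (\<lambda>r. \<bar>N s r\<bar> * w r)" "(LBINT r. \<bar>N s r\<bar> * w r) \<le> w s / 2" for s
  proof -
    let ?a = "\<lambda>r. indicator {0..s1 * \<rho> s} r * exp (\<gamma> * (r / s1))"
    let ?b = "\<lambda>r. indicator {0..s2 * \<rho> s} (- r) * exp (\<gamma> * (- r / s2))"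
    have bd: "\<bar>N s r\<bar> * w r \<le> (M * W) * (?a r + ?b r)" for r
    proof (cases "N s r = 0")
      case False
      have "exp (\<gamma> * \<rho> r) \<le> ?a r + ?b r"
        using supp[OF False] by (auto simp: \<rho>_def indicator_def)
      then have "W * exp (\<gamma> * \<rho> r) \<le> W * (?a r + ?b r)" using W by (rule mult_left_mono)
      then have "M * (W * exp (\<gamma> * \<rho> r)) \<le> M * (W * (?a r + ?b r))" using M by simp
      moreover have "\<bar>N s r\<bar> * w r \<le> M * w r"
        using NM[of s r] W by (intro mult_right_mono) (auto simp: w_def)
      ultimately show ?thesis by (simp add: w_def mult.assoc)
    qed (use M W in auto)
    note ia = integral_exp_weight[OF k(1) g rho0[of s]]
    note ib0 = integral_exp_weight[OF k(2) g rho0[of s]]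
    have ib: "integrable lborel ?b" "(LBINT r. ?b r) \<le> s2 / \<gamma> * exp (\<gamma> * \<rho> s)"
      using lborel_integrable_real_affine[OF ib0(1), of "-1" 0] ib0(2)
        lborel_integral_real_affine[of "-1" "\<lambda>r. indicator {0..s2 * \<rho> s} r * exp (\<gamma> * (r / s2))" 0] by simp_all
    have i: "integrable lborel (\<lambda>r. (M * W) * (?a r + ?b r))"
      by (intro integrable_mult_right Bochner_Integration.integrable_add ia(1) ib(1))
    have [measurable]: "w \<in> borel_measurable borel" unfolding w_def by measurable
    have nn: "0 \<le> \<bar>N s r\<bar> * w r" for r using W by (simp add: w_def)
    show i2: "integrable lborel (\<lambda>r. \<bar>N s r\<bar> * w r)"
    proof (rule Bochner_Integration.integrable_bound[OF i _ AE_I2])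
      show "norm (\<bar>N s r\<bar> * w r) \<le> norm ((M * W) * (?a r + ?b r))" for r
        unfolding real_norm_def abs_of_nonneg[OF nn] by (rule order_trans[OF bd abs_ge_self])
    qed simp
    have "(LBINT r. \<bar>N s r\<bar> * w r) \<le> (LBINT r. (M * W) * (?a r + ?b r))"
      by (intro integral_mono i i2 bd)
    also have "\<dots> = (M * W) * ((LBINT r. ?a r) + (LBINT r. ?b r))"
      using ia(1) ib(1) by (simp only: integral_mult_right_zero Bochner_Integration.integral_add)
    also have "\<dots> \<le> (M * W) * (s1 / \<gamma> * exp (\<gamma> * \<rho> s) + s2 / \<gamma> * exp (\<gamma> * \<rho> s))"
      using ia(2) ib(2) M W by (intro mult_left_mono add_mono) auto
    also have "\<dots> = (M * k / \<gamma>) * w s"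
      by (simp only: w_def k_def) (simp add: add_divide_distrib algebra_simps)
    also have "M * k / \<gamma> = 1 / 2" using M kpos by (simp add: \<gamma>_def)
    also have "1 / 2 * w s = w s / 2" by simp
    finally show "(LBINT r. \<bar>N s r\<bar> * w r) \<le> w s / 2" .
  qed
  have w0: "w s \<ge> 0" for s using W by (simp add: w_def)
  have wm: "w \<in> borel_measurable borel" unfolding w_def by measurable
  obtain v where v: "v \<in> borel_measurable borel" "\<And>s. \<bar>v s\<bar> \<le> 2 * w s"
    "\<And>s. v s = (LBINT r. N s r * (f r + v r))"
    by (rule volterra_solution[OF Nm wm fm w0 wN fN], rule that)
  define g where "g s = f s + v s" for s
  have [measurable]: "v \<in> borel_measurable borel" by (rule v(1))
  have gm: "g \<in> borel_measurable borel" unfolding g_def by measurable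
  have geq: "g s = f s + (LBINT r. N s r * g r)" for s
    using v(3)[of s] by (simp add: g_def)
  have "v \<in> L2_on {-R<..<R}" for R
  proof (rule L2_on_bounded)
    show "set_borel_measurable lborel {-R<..<R} v" by (simp add: set_borel_measurable_def)
    fix s assume s: "s \<in> {-R<..<R}"
    have "\<rho> s \<le> R / s1 + R / s2"
    proof (cases "s \<ge> 0")
      case True
      then show ?thesis using s k by (simp add: \<rho>_def divide_right_mono add_increasing2)
    next
      case False
      have "0 \<le> R / s1" using s k by auto
      moreover have "- s / s2 \<le> R / s2" by (rule divide_right_mono) (use s k in auto)
      ultimately show ?thesis using False by (simp add: \<rho>_def)
    qed
    then have "w s \<le> W * exp (\<gamma> * (R / s1 + R / s2))"
      unfolding w_def using W g by (intro mult_left_mono) auto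
    then show "\<bar>v s\<bar> \<le> 2 * (W * exp (\<gamma> * (R / s1 + R / s2)))" using v(2)[of s] by simp
  qed
  then have gl: "locsq g"
    unfolding locsq_def using gm L2_on_subset[OF f] unfolding g_def by (auto intro!: L2_on_add)
  show ?thesis
  proof (rule that[OF gl])
    fix t x :: real assume x: "x > 0" and tx: "t = 0 \<and> x \<le> L \<or> t > 0 \<and> x = L"
    define s where "s = t + s1 * x"
    have s: "s \<ge> 0" using x tx k by (auto simp: s_def)
    have "\<xi> s = x"
      using tx s k x by (auto simp: \<xi>_def \<rho>_def s_def field_simps min_def)
    have "(LBINT r. N s r * g r) = (LBINT p. N s (s - p) * g (s - p))"
      using lborel_integral_real_affine[of "-1" "\<lambda>r. N s r * g r" s] by simp
    also have "(\<lambda>p. N s (s - p) * g (s - p)) = (\<lambda>p. - (indicator {0<..<k * x} p *\<^sub>R (ker A B p (k * x - p) * g (s - p))))"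
      using s by (auto simp: N_def \<open>\<xi> s = x\<close> indicator_def fun_eq_iff)
    finally have "(LBINT r. N s r * g r) = - (LBINT p:{0<..<k * x}. ker A B p (k * x - p) * g (s - p))"
      by (simp add: set_lebesgue_integral_def)
    then show "wave_l s1 s2 A B g t x = f (t + s1 * x)"
      using geq[of s] by (simp add: wave_l_def s_def k_def)
  next
    fix x :: real assume x: "x > 0" "x \<le> L"
    define s where "s = - s2 * x"
    have s: "s < 0" using x k by (simp add: s_def)
    have "\<rho> s = - s / s2" using s by (simp add: \<rho>_def)
    also have "\<dots> = x" using k by (simp add: s_def)
    finally have "\<xi> s = x" using x by (simp add: \<xi>_def)
    have "(LBINT r. N s r * g r) = (LBINT p. N s (s + p) * g (s + p))"
      using lborel_integral_real_affine[of 1 "\<lambda>r. N s r * g r" s] by simp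
    also have "(\<lambda>p. N s (s + p) * g (s + p)) = (\<lambda>p. - (indicator {0<..<k * x} p *\<^sub>R (ker B A p (k * x - p) * g (s + p))))"
      using s by (auto simp: N_def \<open>\<xi> s = x\<close> indicator_def fun_eq_iff)
    finally have "(LBINT r. N s r * g r) = - (LBINT p:{0<..<k * x}. ker B A p (k * x - p) * g (s + p))"
      by (simp add: set_lebesgue_integral_def)
    then show "wave_r s1 s2 A B g 0 x = f (- s2 * x)"
      using geq[of s] by (simp add: wave_r_def wave_l_def s_def k_def add.commute)
  qed
qed

lemma L2_on_cut:
  assumes "f \<in> L2_on S" and B [measurable]: "B \<in> sets borel"
  shows "(\<lambda>x. if x \<in> B then f x else 0) \<in> L2_on S"
proof -
  let ?f = "\<lambda>x. if x \<in> B then f x else 0"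
  have "(\<lambda>x. indicator B x * (indicator S x *\<^sub>R f x)) \<in> borel_measurable lborel"
    using assms(1) by (intro borel_measurable_times) (auto simp: L2_on_def set_borel_measurable_def)
  moreover have "(\<lambda>x. indicator B x * (indicator S x *\<^sub>R f x)) = (\<lambda>x. indicator S x *\<^sub>R ?f x)"
    by (auto simp: indicator_def fun_eq_iff)
  ultimately have m: "(\<lambda>x. indicator S x *\<^sub>R ?f x) \<in> borel_measurable lborel" by simp
  have i: "integrable lborel (\<lambda>x. indicator S x *\<^sub>R (f x)^2)"
    using assms(1) by (simp add: L2_on_def set_integrable_def)
  have "integrable lborel (\<lambda>x. indicator S x *\<^sub>R (?f x)^2)"
  proof (rule Bochner_Integration.integrable_bound[OF i])
    have "(\<lambda>x. (indicator S x *\<^sub>R ?f x)^2) \<in> borel_measurable lborel" using m by (rule borel_measurable_power)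
    moreover have "(\<lambda>x. (indicator S x *\<^sub>R ?f x)^2) = (\<lambda>x. indicator S x *\<^sub>R (?f x)^2)"
      by (auto simp: indicator_def fun_eq_iff)
    ultimately show "(\<lambda>x. indicator S x *\<^sub>R (?f x)^2) \<in> borel_measurable lborel" by simp
  qed (auto simp: indicator_def)
  with m show ?thesis by (simp add: L2_on_def set_borel_measurable_def set_integrable_def)
qed

lemma L2_on_extend_by_zero:
  assumes "f \<in> L2_on S"
  shows "(\<lambda>x. indicator S x * f x) \<in> L2_on UNIV"
proof -
  have "(\<lambda>x. (indicator S x * f x)^2) = (\<lambda>x. indicator S x *\<^sub>R (f x)^2)"
    by (auto simp: indicator_def fun_eq_iff)
  then show ?thesis
    using assms by (simp add: L2_on_UNIV_iff L2_on_def set_borel_measurable_def set_integrable_def)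
qed

lemma L2_on_UNIV_affine:
  assumes "f \<in> L2_on UNIV" "d \<noteq> 0"
  shows "(\<lambda>x. f (c + d * x)) \<in> L2_on UNIV"
proof -
  have [measurable]: "f \<in> borel_measurable borel" and i: "integrable lborel (\<lambda>x. (f x)^2)"
    using assms(1) by (auto simp: L2_on_UNIV_iff)
  have "(\<lambda>x. f (c + d * x)) \<in> borel_measurable borel" by measurable
  with lborel_integrable_real_affine[OF i assms(2)] show ?thesis by (simp add: L2_on_UNIV_iff)
qed

lemma locsq_cut:
  assumes "locsq g" and [measurable]: "B \<in> sets borel"
  shows "locsq (\<lambda>s. if s \<in> B then g s else 0)"
proof -
  have [measurable]: "g \<in> borel_measurable borel" using assms by (simp add: locsq_def)
  have "(\<lambda>s. if s \<in> B then g s else 0) \<in> borel_measurable borel" by measurable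
  then show ?thesis using assms by (auto simp: locsq_def intro: L2_on_cut)
qed

text \<open>The two initial profiles and the control are laid side by side on the time axis as one
  right-hand side for \<open>wave_trace_equation\<close>.\<close>

lemma wave_realizes_state_and_control:
  assumes k: "s1 > 0" "s2 > 0" and L: "L > 0"
    and u: "u1 \<in> L2_on {0<..<L}" "u2 \<in> L2_on {0<..<L}" and U: "U \<in> L2_on {0<..}"
  obtains g where "locsq g" "\<And>x. x \<in> {0<..<L} \<Longrightarrow> wave_l s1 s2 A B g 0 x = u1 x"
    "\<And>x. x \<in> {0<..<L} \<Longrightarrow> wave_r s1 s2 A B g 0 x = u2 x" "\<And>t. t > 0 \<Longrightarrow> wave_l s1 s2 A B g t L = U t"
proof -
  define v1 where "v1 x = indicator {0<..<L} x * u1 x" for x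
  define v2 where "v2 x = indicator {0<..<L} x * u2 x" for x
  define V where "V t = indicator {0<..} t * U t" for t
  \<comment> \<open>The three summands live on disjoint intervals: \<open>u1\<close> on
    \<open>(0, s1 * L)\<close>, \<open>u2\<close> on \<open>(- s2 * L, 0)\<close>, and
    \<open>U\<close> beyond \<open>s1 * L\<close>.\<close>
  define f where "f s = v1 (0 + (1 / s1) * s) + v2 (0 + (- 1 / s2) * s) + V (- (s1 * L) + 1 * s)" for s
  have fL: "f \<in> L2_on UNIV"
    unfolding f_def v1_def v2_def V_def
    using k by (intro L2_on_add L2_on_UNIV_affine[OF L2_on_extend_by_zero] u U) auto
  obtain g where g: "locsq g"
    and l: "\<And>t x. x > 0 \<Longrightarrow> t = 0 \<and> x \<le> L \<or> t > 0 \<and> x = L \<Longrightarrow> wave_l s1 s2 A B g t x = f (t + s1 * x)"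
    and r: "\<And>x. x > 0 \<Longrightarrow> x \<le> L \<Longrightarrow> wave_r s1 s2 A B g 0 x = f (- s2 * x)"
    by (rule wave_trace_equation[OF k L fL, of A B], rule that)
  show ?thesis
  proof (rule that[OF g])
    fix x assume x: "x \<in> {0<..<L}"
    have neg: "- s1 * x / s2 < 0" "- s2 * x / s1 < 0" "s1 * x < s1 * L" "0 < s2 * x" "0 < s1 * L"
      using x k L by (auto intro!: divide_neg_pos)
    have "f (s1 * x) = v1 x + v2 (- s1 * x / s2) + V (s1 * x - s1 * L)"
      using k by (simp add: f_def)
    also have "\<dots> = u1 x" using x neg by (simp add: v1_def v2_def V_def)
    finally show "wave_l s1 s2 A B g 0 x = u1 x" using l[of x 0] x by simp
    have "f (- s2 * x) = v1 (- s2 * x / s1) + v2 x + V (- (s1 * L) - s2 * x)"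
      using k by (simp add: f_def)
    also have "\<dots> = u2 x" using x neg by (simp add: v1_def v2_def V_def)
    finally show "wave_r s1 s2 A B g 0 x = u2 x" using r[of x] x by simp
  next
    fix t :: real assume t: "t > 0"
    have "f (t + s1 * L) = v1 (t / s1 + L) + v2 (- (t + s1 * L) / s2) + V t"
      using k by (simp add: f_def add_divide_distrib diff_divide_distrib)
    moreover have "0 < t / s1" using t k by simp
    moreover have "0 < t + s1 * L" using t k L by (intro add_pos_pos mult_pos_pos)
    then have "- (t + s1 * L) / s2 < 0" by (intro divide_neg_pos k) linarith
    ultimately have "f (t + s1 * L) = U t" using t by (simp add: v1_def v2_def V_def)
    then show "wave_l s1 s2 A B g t L = U t" using l[of L t] t L by simp
  qed
qed

lemma wave_null_control:
  assumes k: "s1 > 0" "s2 > 0" and L: "L > 0" and S: "S \<ge> 0"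
    and u: "u1 \<in> L2_on {0<..<L}" "u2 \<in> L2_on {0<..<L}"
  obtains g where "locsq g" "\<And>x. x \<in> {0<..<L} \<Longrightarrow> wave_l s1 s2 A B g 0 x = u1 x"
    "\<And>x. x \<in> {0<..<L} \<Longrightarrow> wave_r s1 s2 A B g 0 x = u2 x"
    "\<And>t. t \<in> {0<..<S} \<Longrightarrow> wave_l s1 s2 A B g t L = 0"
    "\<And>t x. t \<ge> S + (s1 + s2) * L \<Longrightarrow> x \<in> {0<..L} \<Longrightarrow> wave_l s1 s2 A B g t x = 0 \<and> wave_r s1 s2 A B g t x = 0"
proof -
  have z: "(\<lambda>_. 0) \<in> L2_on {0<..}" by (simp add: L2_on_def set_borel_measurable_def set_integrable_def)
  obtain g where g: "locsq g" and l: "\<And>x. x \<in> {0<..<L} \<Longrightarrow> wave_l s1 s2 A B g 0 x = u1 x"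
    and r: "\<And>x. x \<in> {0<..<L} \<Longrightarrow> wave_r s1 s2 A B g 0 x = u2 x" and c: "\<And>t. t > 0 \<Longrightarrow> wave_l s1 s2 A B g t L = 0"
    by (rule wave_realizes_state_and_control[OF k L u z, of A B], rule that)
  \<comment> \<open>The cut is strict so that \<open>h\<close> already vanishes at
    \<open>S + s1 * L\<close> itself: this point is sampled by \<open>wave_r\<close> at time
    \<open>S + (s1 + s2) * L\<close> and \<open>x = L\<close>.\<close>
  define h where "h s = (if s \<in> {..<S + s1 * L} then g s else 0)" for s
  have kx: "(s1 + s2) * x > 0" if "x > 0" for x using that k by simp
  have zero: "wave_l s1 s2 A B (\<lambda>_. 0) t x = 0" "wave_r s1 s2 A B (\<lambda>_. 0) t x = 0" for t x
    by (simp_all add: wave_r_def wave_l_def)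
  have hg: "h s = g s" if "s < S + s1 * L" for s using that by (simp add: h_def)
  have h0: "h s = 0" if "s \<ge> S + s1 * L" for s using that by (simp add: h_def)
  show ?thesis
  proof (rule that)
    show "locsq h" unfolding h_def by (rule locsq_cut[OF g]) simp
  next
    fix x assume x: "x \<in> {0<..<L}"
    have xx: "0 < x" "x < L" using x by auto
    have ax: "s1 * x < s1 * L" using x k by simp
    have "wave_l s1 s2 A B h 0 x = wave_l s1 s2 A B g 0 x"
      by (rule wave_l_cong[OF hg kx]) (use xx S ax in linarith)+
    then show "wave_l s1 s2 A B h 0 x = u1 x" using l[OF x] by simp
    have "wave_r s1 s2 A B h 0 x = wave_r s1 s2 A B g 0 x"
      by (rule wave_r_cong[OF hg kx]) (use xx S ax in linarith)+
    then show "wave_r s1 s2 A B h 0 x = u2 x" using r[OF x] by simp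
  next
    fix t assume t: "t \<in> {0<..<S}"
    then have tt: "t < S" by simp
    have "wave_l s1 s2 A B h t L = wave_l s1 s2 A B g t L"
      by (rule wave_l_cong[OF hg kx[OF L]]) (use tt in linarith)
    then show "wave_l s1 s2 A B h t L = 0" using c t by simp
  next
    fix t x assume t: "t \<ge> S + (s1 + s2) * L" and x: "x \<in> {0<..L}"
    have xx: "0 < x" using x by simp
    have "s2 * x \<le> s2 * L" using x k by simp
    then have b: "t - s2 * x \<ge> S + s1 * L" using t by (simp add: distrib_right)
    have "wave_l s1 s2 A B h t x = wave_l s1 s2 A B (\<lambda>_. 0) t x"
      by (rule wave_l_cong[OF h0 kx]) (use b xx in linarith)+
    moreover have "wave_r s1 s2 A B h t x = wave_r s1 s2 A B (\<lambda>_. 0) t x"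
      by (rule wave_r_cong[OF h0 kx]) (use b xx in linarith)+
    ultimately show "wave_l s1 s2 A B h t x = 0 \<and> wave_r s1 s2 A B h t x = 0" by (simp add: zero)
  qed
qed

lemma wave_time_reversal:
  "wave_l s1 s2 A B (\<lambda>s. g (T - s)) t x = wave_r s2 s1 B A g (T - t) x"
  "wave_r s1 s2 A B (\<lambda>s. g (T - s)) t x = wave_l s2 s1 B A g (T - t) x"
  by (simp_all add: wave_r_def wave_l_def algebra_simps)

lemma locsq_time_reversal: "locsq g \<Longrightarrow> locsq (\<lambda>s. g (T - s))"
  using locsq_reflect[OF locsq_shift, of g T] by simp

section \<open>Duality and uniqueness\<close>

text \<open>The constants \<open>a / k\<close> and \<open>- b / (lam * k)\<close> are what
  \<open>wave_weak_transport\<close> requires for slownesses \<open>1\<close> and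
  \<open>1 / lam\<close> to produce the couplings \<open>a\<close> and \<open>b\<close>. The
  condition at \<open>x = 0\<close> holds because both traces there are \<open>g\<close>.\<close>

lemma wave_open_loop_solution:
  fixes lam a b L :: real
  assumes lam: "lam > 0" and L: "L > 0" and g: "locsq g"
  defines "k \<equiv> 1 + 1 / lam"
  defines "P \<equiv> wave_l 1 (1 / lam) (a / k) (- b / (lam * k))" and "Q \<equiv> wave_r 1 (1 / lam) (a / k) (- b / (lam * k))"
  assumes u: "\<And>x. x \<in> {0<..<L} \<Longrightarrow> P g 0 x = u1 x"
      "\<And>x. x \<in> {0<..<L} \<Longrightarrow> Q g 0 x = u2 x"
    and U: "U \<in> L2_loc" "AE t in lborel. t > 0 \<longrightarrow> P g t L = U t"
  shows "open_loop_solution lam a b L u1 u2 U (\<lambda>t. Q g t L)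
     (P g) (Q g)"
proof -
  have lp: "1 / lam > 0" and kp: "k > 0" using lam by (auto simp: k_def add_pos_pos)
  have co: "(1 + 1 / lam) * (a / k) / 1 = a" "- (1 + 1 / lam) * (- b / (lam * k)) / (1 / lam) = b"
    using kp lam by (simp_all add: k_def[symmetric])
  note wt = wave_weak_transport[OF zero_less_one lp L g, of "a / k" "- b / (lam * k)", unfolded co, folded P_def Q_def]
  note reg = wave_regularity[OF zero_less_one lp L g, of _ "a / k" "- b / (lam * k)", folded P_def Q_def]
  have ends: "0 \<in> {0..L}" "L \<in> {0..L}" using L by auto
  have "(\<lambda>t. P g t 0) \<in> L2_loc" by (rule reg(2)[OF disjI1[OF refl] ends(1)])
  then have gl: "g \<in> L2_loc" by (simp add: P_def)
  show ?thesis
    unfolding open_loop_solution_def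
  proof (intro conjI bexI)
    show "weak_transport L (- 1) (P g) (\<lambda>t x. a * Q g t x) g (\<lambda>t. P g t L)" using wt(1) by simp
    show "weak_transport L lam (Q g) (\<lambda>t x. b * P g t x) g (\<lambda>t. Q g t L)" using wt(2) by simp
    show "AE x in lborel. x \<in> {0<..<L} \<longrightarrow> P g 0 x = u1 x \<and> Q g 0 x = u2 x" using u by auto
  qed (use U in \<open>auto intro: gl reg(1)[OF disjI1[OF refl]] reg(1)[OF disjI2[OF refl]]
      reg(2)[OF disjI1[OF refl] ends(2)] reg(2)[OF disjI2[OF refl] ends(2)]\<close>)
qed

lemma C0_L2_slice: "y \<in> C0_L2 L \<Longrightarrow> t \<ge> 0 \<Longrightarrow> y t \<in> L2_on {0<..<L}"
  by (simp add: C0_L2_def)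

text \<open>The pair \<open>(P h, Q h / lam)\<close> solves the adjoint system, which is of the same form with the two
  coupling constants exchanged. The zero-order terms then cancel pointwise when the two weak
  equations are added, so integrability of the double integrals is never needed.\<close>

lemma duality_identity:
  fixes lam a b L :: real
  assumes lam: "lam > 0" and L: "L > 0" and T: "T > 0" and sol: "open_loop_solution lam a b L u1 u2 U Y y1 y2"
    and h: "locsq h"
  defines "k \<equiv> 1 + 1 / lam"
  defines "P \<equiv> wave_l 1 (1 / lam) (- b / (lam * k)) (a / k)" and "Q \<equiv> wave_r 1 (1 / lam) (- b / (lam * k)) (a / k)"
  shows "(LBINT x:{0<..<L}. y1 T x * P h T x) + (1 / lam) * (LBINT x:{0<..<L}. y2 T x * Q h T x)
    - (LBINT x:{0<..<L}. y1 0 x * P h 0 x) - (1 / lam) * (LBINT x:{0<..<L}. y2 0 x * Q h 0 x)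
    - (LBINT t:{0<..<T}. U t * P h t L) + (LBINT t:{0<..<T}. Y t * Q h t L) = 0"
    (is "?\<Phi> h = 0")
proof -
  have lp: "1 / lam > 0" and kp: "k > 0" using lam by (auto simp: k_def add_pos_pos)
  obtain y10 y20 y1L where tr: "y10 \<in> L2_loc" "y20 \<in> L2_loc" "y1L \<in> L2_loc"
    and w1: "weak_transport L (- 1) y1 (\<lambda>t x. a * y2 t x) y10 y1L"
    and w2: "weak_transport L lam y2 (\<lambda>t x. b * y1 t x) y20 Y"
    and e0: "AE t in lborel. t > 0 \<longrightarrow> y20 t = y10 t" and eL: "AE t in lborel. t > 0 \<longrightarrow> y1L t = U t"
    using sol unfolding open_loop_solution_def by (elim conjE bexE) (rule that)
  have y: "y1 t \<in> L2_on {0<..<L}" "y2 t \<in> L2_on {0<..<L}" if "t \<ge> 0" for t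
    using sol that by (auto simp: open_loop_solution_def intro: C0_L2_slice)
  have tT: "U \<in> L2_on {0<..<T}" "Y \<in> L2_on {0<..<T}" "y10 \<in> L2_on {0<..<T}" "y20 \<in> L2_on {0<..<T}" "y1L \<in> L2_on {0<..<T}"
    using sol tr T by (auto simp: open_loop_solution_def L2_loc_def)
  \<comment> \<open>A C^1 trace yields an admissible test pair; general \<open>h\<close> follows at
    the end by polynomial approximation.\<close>
  have classical: "?\<Phi> p = 0" if p: "\<And>s. (p has_real_derivative p' s) (at s)" "continuous_on UNIV p'" for p p'
  proof -
    have kk: "1 + 1 / lam > 0" using kp by (simp add: k_def)
    note testP = C1_test_wave(1)[OF p kk, of T L "- b / (lam * k)" "a / k", folded P_def Q_def]
    \<comment> \<open>The factor \<open>1 / lam\<close> compensates the speed \<open>lam\<close> in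
      the boundary terms, so that those at \<open>x = 0\<close> cancel by
      \<open>y20 = y10\<close>.\<close>
    note testQ = C1_test_cmult[OF C1_test_wave(2)[OF p kk, of T L "- b / (lam * k)" "a / k", folded P_def Q_def], of "1 / lam"]
    have co: "(1 + 1 / lam) * (- b / (lam * k)) = - b / lam" "(1 + 1 / lam) * (a / k) = a"
      using kp lam by (simp_all add: k_def[symmetric])
    note I1 = w1[unfolded weak_transport_iff, rule_format, OF T testP, unfolded weak_identity_def co]
    note I2 = w2[unfolded weak_transport_iff, rule_format, OF T testQ, unfolded weak_identity_def co]
    define D where "D = (LBINT t:{0<..<T}. LBINT x:{0<..<L}. (b / lam) * (y1 t x * Q p t x) - a * (y2 t x * P p t x))"
    have "(LBINT t:{0<..<T}. LBINT x:{0<..<L}. y1 t x * (P p' t x + - 1 * (1 * P p' t x + - b / lam * Q p t x)) - a * y2 t x * P p t x) = D"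
      unfolding D_def by (simp add: algebra_simps)
    note I1 = I1[unfolded this]
    have "(LBINT t:{0<..<T}. LBINT x:{0<..<L}. y2 t x * (1 / lam * Q p' t x + lam * (1 / lam * (- (1 / lam) * Q p' t x + a * P p t x))) - b * y1 t x * (1 / lam * Q p t x)) = 
       (LBINT t:{0<..<T}. LBINT x:{0<..<L}. - ((b / lam) * (y1 t x * Q p t x) - a * (y2 t x * P p t x)))"
      using lam by (simp add: algebra_simps)
    also have "\<dots> = - D"
      by (simp only: D_def set_lebesgue_integral_def scaleR_minus_right Bochner_Integration.integral_minus)
    finally have "(LBINT t:{0<..<T}. LBINT x:{0<..<L}. y2 t x * (1 / lam * Q p' t x + lam * (1 / lam * (- (1 / lam) * Q p' t x + a * P p t x))) - b * y1 t x * (1 / lam * Q p t x)) = - D" .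
    note I2 = I2[unfolded this]
    have pc: "continuous_on UNIV p" by (intro continuous_at_imp_continuous_on ballI DERIV_isCont[OF p(1)])
    have cP: "(\<lambda>t. P p t x) \<in> L2_on {0<..<T}" "(\<lambda>t. Q p t x) \<in> L2_on {0<..<T}" if "x \<in> {0..L}" for x
    proof -
      show "(\<lambda>t. P p t x) \<in> L2_on {0<..<T}"
        by (rule L2_on_continuous[OF continuous_on_rectangle_slices(1)[OF C1_test_continuous(1)[OF testP] that]])
      show "(\<lambda>t. Q p t x) \<in> L2_on {0<..<T}"
        by (rule L2_on_continuous[OF continuous_on_rectangle_slices(1)[OF C1_test_continuous(1)[OF
            C1_test_wave(2)[OF p kk, of T L "- b / (lam * k)" "a / k", folded P_def Q_def]] that]])
    qed
    have P0: "P p t 0 = p t" "Q p t 0 = p t" for t by (simp_all add: P_def Q_def)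
    have pL: "p \<in> L2_on {0<..<T}" using cP(1)[of 0] L by (simp add: P0)
    have ends: "L \<in> {0..L}" using L by simp
    have B1: "(LBINT t:{0<..<T}. y1L t * P p t L - y10 t * P p t 0) =
       (LBINT t:{0<..<T}. U t * P p t L) - (LBINT t:{0<..<T}. y10 t * p t)"
    proof -
      have "(LBINT t:{0<..<T}. y1L t * P p t L) = (LBINT t:{0<..<T}. U t * P p t L)"
        using eL by (intro L2_on_AE_cong_integral tT cP ends) (auto elim: eventually_mono)
      then show ?thesis
        using L2_on_mult_integrable[OF tT(5) cP(1)[OF ends]] L2_on_mult_integrable[OF tT(3) pL] by (simp add: P0)
    qed
    have B2: "(LBINT t:{0<..<T}. Y t * (1 / lam * Q p t L) - y20 t * (1 / lam * Q p t 0)) =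
       (1 / lam) * ((LBINT t:{0<..<T}. Y t * Q p t L) - (LBINT t:{0<..<T}. y10 t * p t))"
    proof -
      have "(LBINT t:{0<..<T}. y20 t * p t) = (LBINT t:{0<..<T}. y10 t * p t)"
        using e0 by (intro L2_on_AE_cong_integral tT pL) (auto elim: eventually_mono)
      moreover have "(LBINT t:{0<..<T}. Y t * (1 / lam * Q p t L) - y20 t * (1 / lam * Q p t 0)) =
        (LBINT t:{0<..<T}. (1 / lam) * (Y t * Q p t L - y20 t * p t))"
        by (simp add: P0 algebra_simps)
      ultimately show ?thesis
        using L2_on_mult_integrable[OF tT(2) cP(2)[OF ends]] L2_on_mult_integrable[OF tT(4) pL] by simp
    qed
    have M2: "(LBINT x:{0<..<L}. y2 t x * (1 / lam * Q p t x)) = (1 / lam) * (LBINT x:{0<..<L}. y2 t x * Q p t x)" for t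
      by (simp add: mult.left_commute)
    from I1 I2 show ?thesis
      unfolding B1 B2 M2 using lam by (simp add: algebra_simps)
  qed
  obtain p where p: "\<And>n. real_polynomial_function (p n)"
    and lim: "L2_lim (T + (1 + 1 / lam) * L + 1) p h"
    by (rule locsq_approx[OF h, of "T + (1 + 1 / lam) * L + 1"], rule that[rotated], assumption) simp
  have pc: "continuous_on UNIV (p n)" for n by (rule real_polynomial_function_C1[OF p])
  have z: "?\<Phi> (p n) = 0" for n by (rule real_polynomial_function_C1[OF p[of n]]) (rule classical)
  note pl = locsq_continuous[OF pc]
  note apP = wave_L2_approx[where A = "- b / (lam * k)" and B = "a / k", OF zero_less_one lp L T h p lim disjI1[OF refl], folded P_def]
  note apQ = wave_L2_approx[where A = "- b / (lam * k)" and B = "a / k", OF zero_less_one lp L T h p lim disjI2[OF refl], folded Q_def]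
  have zz: "(\<lambda>n. LBINT s:S. (p m s - p m s)^2) \<longlonglongrightarrow> 0" for S m
    by (simp add: set_lebesgue_integral_def)
  note bdP = wave_limit(2,4)[where A = "- b / (lam * k)" and B = "a / k" and x = L, OF zero_less_one lp L T h pl lim disjI1[OF refl], folded P_def]
    wave_limit(4)[where A = "- b / (lam * k)" and B = "a / k" and x = L, OF zero_less_one lp L T pl pl zz disjI1[OF refl], folded P_def]
  note bdQ = wave_limit(2,4)[where A = "- b / (lam * k)" and B = "a / k" and x = L, OF zero_less_one lp L T h pl lim disjI2[OF refl], folded Q_def]
    wave_limit(4)[where A = "- b / (lam * k)" and B = "a / k" and x = L, OF zero_less_one lp L T pl pl zz disjI2[OF refl], folded Q_def]
  have s: "(\<lambda>n. LBINT x:{0<..<L}. v x * Wn n t x) \<longlonglongrightarrow> (LBINT x:{0<..<L}. v x * W t x)"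
    if "L2_approx T L Wn W" "t \<in> {0..T}" "v \<in> L2_on {0<..<L}" for Wn W t v
    using L2_on_tendsto[OF L2_approx_slice(1,2)[OF that(1,2)] that(3) L2_approx_slice(3)[OF that(1,2)]]
    by (simp add: mult.commute)
  have LL: "L \<in> {0..L}" using L by simp
  have bP: "(\<lambda>n. LBINT t:{0<..<T}. U t * P (p n) t L) \<longlonglongrightarrow> (LBINT t:{0<..<T}. U t * P h t L)"
    using L2_on_tendsto[OF bdP(3)[OF LL] bdP(2)[OF LL] tT(1) bdP(1)[OF LL]] by (simp add: mult.commute)
  have bQ: "(\<lambda>n. LBINT t:{0<..<T}. Y t * Q (p n) t L) \<longlonglongrightarrow> (LBINT t:{0<..<T}. Y t * Q h t L)"
    using L2_on_tendsto[OF bdQ(3)[OF LL] bdQ(2)[OF LL] tT(2) bdQ(1)[OF LL]] by (simp add: mult.commute)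
  have "(\<lambda>n. ?\<Phi> (p n)) \<longlonglongrightarrow> ?\<Phi> h"
    using T by (intro tendsto_intros s apP apQ bP bQ y) auto
  then show ?thesis unfolding z by (simp add: LIMSEQ_const_iff)
qed

text \<open>Reversing the adjoint in time pairs its state at time 0 with the difference of the
  solutions at time \<open>T\<close>. Its value at \<open>x = L\<close> that can be prescribed, that
  of \<open>p\<close>, is paired with the difference of the outputs; the term with \<open>q\<close>
  at \<open>x = L\<close> disappears because the controls agree.\<close>

lemma duality_identity_diff:
  fixes lam a b L :: real
  assumes lam: "lam > 0" and L: "L > 0" and T: "T > 0"
    and y: "open_loop_solution lam a b L u1 u2 U Y y1 y2" and z: "open_loop_solution lam a b L v1 v2 V Z z1 z2"
    and UV: "AE t in lborel. t \<in> {0<..<T} \<longrightarrow> U t = V t" and g: "locsq g"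
  defines "k \<equiv> 1 + 1 / lam"
  defines "p \<equiv> wave_l (1 / lam) 1 (a / k) (- b / (lam * k)) g" and "q \<equiv> wave_r (1 / lam) 1 (a / k) (- b / (lam * k)) g"
  shows "(LBINT x:{0<..<L}. (y1 T x - z1 T x) * q 0 x) + (1 / lam) * (LBINT x:{0<..<L}. (y2 T x - z2 T x) * p 0 x)
    - (LBINT x:{0<..<L}. (y1 0 x - z1 0 x) * q T x) - (1 / lam) * (LBINT x:{0<..<L}. (y2 0 x - z2 0 x) * p T x)
    + (LBINT t:{0<..<T}. (Y t - Z t) * p (T - t) L) = 0"
proof -
  let ?h = "\<lambda>s. g (T - s)"
  have lp: "1 / lam > 0" using lam by simp
  have h: "locsq ?h" by (rule locsq_time_reversal[OF g])
  have tr: "wave_l 1 (1 / lam) (- b / (lam * k)) (a / k) ?h t x = q (T - t) x"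
    "wave_r 1 (1 / lam) (- b / (lam * k)) (a / k) ?h t x = p (T - t) x" for t x
    by (simp_all add: wave_time_reversal p_def q_def)
  note reg = wave_regularity[OF zero_less_one lp L h, of _ "- b / (lam * k)" "a / k"]
  have qL: "q t \<in> L2_on {0<..<L}" "p t \<in> L2_on {0<..<L}" if "t \<le> T" for t
  proof -
    have "wave_l 1 (1 / lam) (- b / (lam * k)) (a / k) ?h (T - t) = q t"
      "wave_r 1 (1 / lam) (- b / (lam * k)) (a / k) ?h (T - t) = p t"
      by (rule ext, subst tr, simp)+
    then show "q t \<in> L2_on {0<..<L}" "p t \<in> L2_on {0<..<L}"
      using C0_L2_slice[OF reg(1)[OF disjI1[OF refl]], of "T - t"] C0_L2_slice[OF reg(1)[OF disjI2[OF refl]], of "T - t"] that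
      by (simp_all only:)
  qed
  have pT: "(\<lambda>t. q (T - t) L) \<in> L2_on {0<..<T}" "(\<lambda>t. p (T - t) L) \<in> L2_on {0<..<T}"
    using reg(2)[OF disjI1[OF refl], of L, unfolded tr] reg(2)[OF disjI2[OF refl], of L, unfolded tr] L T
    by (simp_all add: L2_loc_def)
  have m: "y1 t \<in> L2_on {0<..<L}" "y2 t \<in> L2_on {0<..<L}" "z1 t \<in> L2_on {0<..<L}" "z2 t \<in> L2_on {0<..<L}" if "t \<ge> 0" for t
    using y z that by (auto simp: open_loop_solution_def intro: C0_L2_slice)
  have tT: "U \<in> L2_on {0<..<T}" "Y \<in> L2_on {0<..<T}" "V \<in> L2_on {0<..<T}" "Z \<in> L2_on {0<..<T}"
    using y z T by (auto simp: open_loop_solution_def L2_loc_def)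
  note I1 = duality_identity[OF lam L T y h, folded k_def, unfolded tr]
  note I2 = duality_identity[OF lam L T z h, folded k_def, unfolded tr]
  have U: "(LBINT t:{0<..<T}. U t * q (T - t) L) = (LBINT t:{0<..<T}. V t * q (T - t) L)"
    by (rule L2_on_AE_cong_integral[OF UV tT(1,3) pT(1)])
  have sub: "(LBINT x:S. (v x - w x) * r x) = (LBINT x:S. v x * r x) - (LBINT x:S. w x * r x)"
    if "v \<in> L2_on S" "w \<in> L2_on S" "r \<in> L2_on S" for v w r :: "real \<Rightarrow> real" and S
    using L2_on_mult_integrable[OF that(1,3)] L2_on_mult_integrable[OF that(2,3)] by (simp add: left_diff_distrib)
  have T0: "0 \<le> T" "0 \<le> (0::real)" using T by auto
  show ?thesis
    unfolding sub[OF m(1,3)[OF T0(1)] qL(1)[OF T0(1)]] sub[OF m(2,4)[OF T0(1)] qL(2)[OF T0(1)]]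
      sub[OF m(1,3)[OF T0(2)] qL(1)[OF order_refl]] sub[OF m(2,4)[OF T0(2)] qL(2)[OF order_refl]]
      sub[OF tT(2,4) pT(2)]
    using I1 I2 U by (simp add: algebra_simps)
qed

lemma LINT_AE_zero:
  fixes f :: "real \<Rightarrow> real"
  assumes "AE x in lborel. x \<in> S \<longrightarrow> f x = 0"
  shows "(LBINT x:S. f x) = 0"
  unfolding set_lebesgue_integral_def
  by (rule integral_eq_zero_AE) (use assms in \<open>auto elim: eventually_mono simp: indicator_def\<close>)

text \<open>The adjoint wave is chosen with initial state and control equal to the very differences
  to be shown zero. The duality identity then becomes a vanishing sum of three squared
  norms.\<close>

lemma open_loop_unique:
  assumes lam: "lam > 0" and L: "L > 0" and T: "T > 0"
    and y: "open_loop_solution lam a b L u1 u2 U Y y1 y2" and z: "open_loop_solution lam a b L u1 u2 V Z z1 z2"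
    and UV: "AE t in lborel. t \<in> {0<..<T} \<longrightarrow> U t = V t"
  shows "AE x in lborel. x \<in> {0<..<L} \<longrightarrow> y1 T x = z1 T x \<and> y2 T x = z2 T x"
    and "AE t in lborel. t \<in> {0<..<T} \<longrightarrow> Y t = Z t"
proof -
  have lp: "1 / lam > 0" using lam by simp
  define B where "B = - b / (lam * (1 + 1 / lam))"
  let ?p = "wave_l (1 / lam) 1 (a / (1 + 1 / lam)) B" and ?q = "wave_r (1 / lam) 1 (a / (1 + 1 / lam)) B"
  define D1 where "D1 x = y1 T x - z1 T x" for x
  define D2 where "D2 x = y2 T x - z2 T x" for x
  define E where "E t = Y t - Z t" for t
  have D: "D1 \<in> L2_on {0<..<L}" "D2 \<in> L2_on {0<..<L}" "(\<lambda>x. lam * D2 x) \<in> L2_on {0<..<L}"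
    unfolding D1_def D2_def using y z T
    by (auto simp: open_loop_solution_def intro!: L2_on_diff L2_on_cmult intro: C0_L2_slice)
  have EL: "E \<in> L2_on {0<..<T}"
    unfolding E_def using y z T by (auto simp: open_loop_solution_def L2_loc_def intro!: L2_on_diff)
  \<comment> \<open>The output difference reversed in time, since the identity evaluates the adjoint
    trace at \<open>T - t\<close>.\<close>
  define V' where "V' t = indicator {0<..<T} (T + (-1) * t) * E (T + (-1) * t)" for t
  have VL: "V' \<in> L2_on {0<..}"
    unfolding V'_def by (rule L2_on_subset[OF L2_on_UNIV_affine[OF L2_on_extend_by_zero[OF EL]]]) auto
  obtain g where g: "locsq g"
    and l: "\<And>x. x \<in> {0<..<L} \<Longrightarrow> ?p g 0 x = lam * D2 x"
    and r: "\<And>x. x \<in> {0<..<L} \<Longrightarrow> ?q g 0 x = D1 x"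
    and c: "\<And>t. t > 0 \<Longrightarrow> ?p g t L = V' t"
    by (rule wave_realizes_state_and_control[OF lp zero_less_one L D(3,1) VL], rule that)
  have init: "AE x in lborel. x \<in> {0<..<L} \<longrightarrow> y1 0 x = z1 0 x \<and> y2 0 x = z2 0 x"
  proof -
    have "AE x in lborel. x \<in> {0<..<L} \<longrightarrow> y1 0 x = u1 x \<and> y2 0 x = u2 x"
      "AE x in lborel. x \<in> {0<..<L} \<longrightarrow> z1 0 x = u1 x \<and> z2 0 x = u2 x"
      using y z by (simp_all add: open_loop_solution_def)
    then show ?thesis by eventually_elim auto
  qed
  note I = duality_identity_diff[OF lam L T y z UV g, folded B_def]
  have 1: "(LBINT x:{0<..<L}. (y1 T x - z1 T x) * ?q g 0 x)
      = (LBINT x:{0<..<L}. (D1 x)^2)"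
    by (intro set_lebesgue_integral_cong) (auto simp: r D1_def power2_eq_square)
  have 2: "(LBINT x:{0<..<L}. (y2 T x - z2 T x) * ?p g 0 x)
      = lam * (LBINT x:{0<..<L}. (D2 x)^2)"
    by (subst set_integral_mult_right[symmetric], intro set_lebesgue_integral_cong) (auto simp: l D2_def power2_eq_square)
  have 3: "(LBINT x:{0<..<L}. (y1 0 x - z1 0 x) * r x) = 0" "(LBINT x:{0<..<L}. (y2 0 x - z2 0 x) * r x) = 0" for r
    by (rule LINT_AE_zero, use init in eventually_elim, simp)+
  have 4: "(LBINT t:{0<..<T}. (Y t - Z t) * ?p g (T - t) L)
      = (LBINT t:{0<..<T}. (E t)^2)"
    by (intro set_lebesgue_integral_cong) (auto simp: c V'_def E_def power2_eq_square)
  have "(LBINT x:{0<..<L}. (D1 x)^2) + (LBINT x:{0<..<L}. (D2 x)^2) + (LBINT t:{0<..<T}. (E t)^2) = 0"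
    using I[unfolded 1 2 3 4] lam by simp
  then have "(LBINT x:{0<..<L}. (D1 x)^2) = 0" "(LBINT x:{0<..<L}. (D2 x)^2) = 0" "(LBINT t:{0<..<T}. (E t)^2) = 0"
    using L2_on_integral_nonneg[of "{0<..<L}" D1] L2_on_integral_nonneg[of "{0<..<L}" D2] L2_on_integral_nonneg[of "{0<..<T}" E]
    by linarith+
  note zero = L2_on_zero[OF D(1) this(1)] L2_on_zero[OF D(2) this(2)] L2_on_zero[OF EL this(3)]
  from zero(1,2) show "AE x in lborel. x \<in> {0<..<L} \<longrightarrow> y1 T x = z1 T x \<and> y2 T x = z2 T x"
    by eventually_elim (simp add: D1_def D2_def)
  show "AE t in lborel. t \<in> {0<..<T} \<longrightarrow> Y t = Z t" using zero(3) by eventually_elim (simp add: E_def)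
qed

text \<open>
  The test pair is a null-controlled adjoint solution running backwards from time \<open>T\<close>: it vanishes
  at time \<open>0\<close>, so the unknown initial data drop out of the duality identity.
\<close>

lemma state_determined_by_output:
  fixes lam a b L :: real
  defines "\<tau> \<equiv> (1 + 1 / lam) * L"
  assumes lam: "lam > 0" and L: "L > 0" and T: "T \<ge> \<tau>"
    and y: "open_loop_solution lam a b L u1 u2 U Y y1 y2" and z: "open_loop_solution lam a b L v1 v2 V Z z1 z2"
    and UV: "AE t in lborel. t \<in> {0<..<T} \<longrightarrow> U t = V t"
    and YZ: "AE t in lborel. t \<in> {0<..<\<tau>} \<longrightarrow> Y t = Z t"
  shows "AE x in lborel. x \<in> {0<..<L} \<longrightarrow> y1 T x = z1 T x \<and> y2 T x = z2 T x"
proof -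
  have lp: "1 / lam > 0" using lam by simp
  define B where "B = - b / (lam * (1 + 1 / lam))"
  have tau: "\<tau> > 0" unfolding \<tau>_def using lp L by (intro mult_pos_pos add_pos_pos) auto
  then have T0: "T > 0" using T by simp
  define D1 where "D1 x = y1 T x - z1 T x" for x
  define D2 where "D2 x = y2 T x - z2 T x" for x
  have D: "D1 \<in> L2_on {0<..<L}" "D2 \<in> L2_on {0<..<L}" "(\<lambda>x. lam * D2 x) \<in> L2_on {0<..<L}"
    unfolding D1_def D2_def using y z T0
    by (auto simp: open_loop_solution_def intro!: L2_on_diff L2_on_cmult intro: C0_L2_slice)
  \<comment> \<open>The adjoint control idles for a time \<open>T - \<tau>\<close> before steering.
    Seen in the original time this is the interval \<open>(\<tau>, T)\<close>, so only outputs
    before \<open>\<tau>\<close> enter the identity.\<close>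
  have S: "0 \<le> T - \<tau>" using T by simp
  let ?p = "wave_l (1 / lam) 1 (a / (1 + 1 / lam)) B"
  let ?q = "wave_r (1 / lam) 1 (a / (1 + 1 / lam)) B"
  obtain g where g: "locsq g"
    and l: "\<And>x. x \<in> {0<..<L} \<Longrightarrow> ?p g 0 x = lam * D2 x"
    and r: "\<And>x. x \<in> {0<..<L} \<Longrightarrow> ?q g 0 x = D1 x"
    and c: "\<And>t. t \<in> {0<..<T - \<tau>} \<Longrightarrow> ?p g t L = 0"
    and n: "\<And>t x. t \<ge> T - \<tau> + (1 / lam + 1) * L \<Longrightarrow> x \<in> {0<..L} \<Longrightarrow> ?p g t x = 0 \<and> ?q g t x = 0"
    by (rule wave_null_control[OF lp zero_less_one L S D(3,1)], rule that)
  have nT: "?p g T x = 0" "?q g T x = 0" if "x \<in> {0<..<L}" for x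
    using n[of T x] that by (simp_all add: \<tau>_def algebra_simps)
  note I = duality_identity_diff[OF lam L T0 y z UV g, folded B_def]
  have 1: "(LBINT x:{0<..<L}. (y1 T x - z1 T x) * ?q g 0 x) = (LBINT x:{0<..<L}. (D1 x)^2)"
    by (intro set_lebesgue_integral_cong) (auto simp: r D1_def power2_eq_square)
  have 2: "(LBINT x:{0<..<L}. (y2 T x - z2 T x) * ?p g 0 x) = lam * (LBINT x:{0<..<L}. (D2 x)^2)"
    by (subst set_integral_mult_right[symmetric], intro set_lebesgue_integral_cong) (auto simp: l D2_def power2_eq_square)
  have 3: "(LBINT x:{0<..<L}. v x * ?p g T x) = 0" "(LBINT x:{0<..<L}. v x * ?q g T x) = 0" for v
    by (rule LINT_AE_zero, intro AE_I2, simp add: nT)+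
  have 4: "(LBINT t:{0<..<T}. (Y t - Z t) * ?p g (T - t) L) = 0"
  proof (rule LINT_AE_zero)
    have "AE t in lborel. t \<noteq> \<tau>" by (rule AE_lborel_singleton)
    with YZ show "AE t in lborel. t \<in> {0<..<T} \<longrightarrow> (Y t - Z t) * ?p g (T - t) L = 0"
    proof eventually_elim
      case (elim t)
      show ?case
      proof (cases "t < \<tau>")
        case False
        then show ?thesis using elim(2) c[of "T - t"] by auto
      qed (use elim(1) in auto)
    qed
  qed
  have "(LBINT x:{0<..<L}. (D1 x)^2) + (LBINT x:{0<..<L}. (D2 x)^2) = 0"
    using I[unfolded 1 2 3 4] lam by simp
  then have "(LBINT x:{0<..<L}. (D1 x)^2) = 0" "(LBINT x:{0<..<L}. (D2 x)^2) = 0"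
    using L2_on_integral_nonneg[of "{0<..<L}" D1] L2_on_integral_nonneg[of "{0<..<L}" D2] by linarith+
  note zero = L2_on_zero[OF D(1) this(1)] L2_on_zero[OF D(2) this(2)]
  from zero(1,2) show "AE x in lborel. x \<in> {0<..<L} \<longrightarrow> y1 T x = z1 T x \<and> y2 T x = z2 T x"
    by eventually_elim (simp add: D1_def D2_def)
qed

section \<open>The feedback law\<close>

text \<open>The initial data are quantified away, so the predicate sees \<open>Y\<close> only
  through its class on \<open>(0, \<tau>)\<close> with \<open>\<tau> = (1 + 1 / lam) * L\<close>.
  Vanishing is required at every point up to and including \<open>\<tau>\<close>, as causality is a
  pointwise condition; vanishing after \<open>T_opt lam L\<close> puts \<open>U\<close> in L^2 of
  the half line.\<close>

definition steering_control :: "real \<Rightarrow> real \<Rightarrow> real \<Rightarrow> real \<Rightarrow> (real \<Rightarrow> real) \<Rightarrow> (real \<Rightarrow> real) \<Rightarrow> bool" where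
  "steering_control lam a b L Y U \<longleftrightarrow>
     U \<in> L2_loc \<and> (\<forall>t. t \<le> (1 + 1 / lam) * L \<or> t \<ge> T_opt lam L \<longrightarrow> U t = 0) \<and>
     (\<exists>u1 u2 Z y1 y2. open_loop_solution lam a b L u1 u2 U Z y1 y2 \<and>
        (AE s in lborel. s \<in> {0<..<(1 + 1 / lam) * L} \<longrightarrow> Z s = Y s) \<and>
        (\<forall>t\<ge>T_opt lam L. AE x in lborel. x \<in> {0<..<L} \<longrightarrow> y1 t x = 0 \<and> y2 t x = 0))"

text \<open>The default 0 serves signals that are no output of the system under zero control, for
  which the law still has to return a function in \<open>L2_loc\<close>.\<close>

definition observe_then_steer :: "real \<Rightarrow> real \<Rightarrow> real \<Rightarrow> real \<Rightarrow> (real \<Rightarrow> real) \<Rightarrow> real \<Rightarrow> real" where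
  "observe_then_steer lam a b L Y =
     (if \<exists>U. steering_control lam a b L Y U then SOME U. steering_control lam a b L Y U else (\<lambda>_. 0))"

text \<open>Equality of the whole predicates, not just of their satisfiability, makes
  \<open>SOME\<close> select the same control for both outputs.\<close>

lemma steering_control_cong:
  assumes "AE s in lborel. s \<in> {0<..<(1 + 1 / lam) * L} \<longrightarrow> Y s = Z s"
  shows "steering_control lam a b L Y = steering_control lam a b L Z"
proof -
  have "(AE s in lborel. s \<in> {0<..<(1 + 1 / lam) * L} \<longrightarrow> X s = Y s) \<longleftrightarrow>
        (AE s in lborel. s \<in> {0<..<(1 + 1 / lam) * L} \<longrightarrow> X s = Z s)" for X
    using assms by (auto elim: AE_mp)
  then show ?thesis unfolding steering_control_def[abs_def] by simp
qed

lemma steering_control_zero: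
  assumes "steering_control lam a b L Y U" "t \<le> (1 + 1 / lam) * L"
  shows "U t = 0"
  using assms by (auto simp: steering_control_def)

lemma zero_in_L2_loc: "(\<lambda>_. 0) \<in> L2_loc"
  by (simp add: L2_loc_def L2_on_def set_borel_measurable_def set_integrable_def)

lemma observe_then_steer_cases:
  "steering_control lam a b L Y (observe_then_steer lam a b L Y) \<or> observe_then_steer lam a b L Y = (\<lambda>_. 0)"
  unfolding observe_then_steer_def using someI_ex[of "steering_control lam a b L Y"] by auto

lemma observe_then_steer_steers:
  assumes "steering_control lam a b L Y U"
  shows "steering_control lam a b L Y (observe_then_steer lam a b L Y)"
  using assms someI_ex[of "steering_control lam a b L Y"] by (auto simp: observe_then_steer_def)

lemma observe_then_steer_zero:
  "t \<le> (1 + 1 / lam) * L \<Longrightarrow> observe_then_steer lam a b L Y t = 0"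
  using observe_then_steer_cases[of lam a b L Y] steering_control_zero by fastforce

text \<open>Up to time \<open>\<tau>\<close> the law is constantly 0; afterwards the observed
  interval contains \<open>(0, \<tau>)\<close>, which determines the chosen control.\<close>

lemma output_feedback_law_observe_then_steer:
  "output_feedback_law (observe_then_steer lam a b L)"
  unfolding output_feedback_law_def
proof (intro conjI ballI allI impI)
  show "observe_then_steer lam a b L Y \<in> L2_loc" for Y
    using observe_then_steer_cases[of lam a b L Y] zero_in_L2_loc by (auto simp: steering_control_def)
next
  fix Y Z :: "real \<Rightarrow> real" and t :: real
  assume t: "AE s in lborel. s \<in> {0<..<t} \<longrightarrow> Y s = Z s"
  show "observe_then_steer lam a b L Y t = observe_then_steer lam a b L Z t"
  proof (cases "t \<le> (1 + 1 / lam) * L")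
    case False
    with t have "AE s in lborel. s \<in> {0<..<(1 + 1 / lam) * L} \<longrightarrow> Y s = Z s"
      by (auto elim!: eventually_mono)
    from steering_control_cong[OF this, of a b] show ?thesis by (simp add: observe_then_steer_def)
  qed (simp add: observe_then_steer_zero)
qed

lemma open_loop_exists:
  fixes lam a b L :: real
  assumes lam: "lam > 0" and L: "L > 0" and u: "u1 \<in> L2_on {0<..<L}" "u2 \<in> L2_on {0<..<L}"
    and U: "U \<in> L2_loc" "U \<in> L2_on {0<..}"
  shows "\<exists>Y y1 y2. open_loop_solution lam a b L u1 u2 U Y y1 y2"
proof -
  have lp: "1 / lam > 0" using lam by simp
  let ?P = "wave_l 1 (1 / lam) (a / (1 + 1 / lam)) (- b / (lam * (1 + 1 / lam)))"
  let ?Q = "wave_r 1 (1 / lam) (a / (1 + 1 / lam)) (- b / (lam * (1 + 1 / lam)))"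
  obtain g where g: "locsq g"
    and l: "\<And>x. x \<in> {0<..<L} \<Longrightarrow> ?P g 0 x = u1 x"
    and r: "\<And>x. x \<in> {0<..<L} \<Longrightarrow> ?Q g 0 x = u2 x"
    and c: "\<And>t. t > 0 \<Longrightarrow> ?P g t L = U t"
    by (rule wave_realizes_state_and_control[OF zero_less_one lp L u U(2)], rule that)
  have "AE t in lborel. t > 0 \<longrightarrow> ?P g t L = U t"
    using c by (intro AE_I2 impI)
  from wave_open_loop_solution[OF lam L g l r U(1) this] show ?thesis by (intro exI)
qed

text \<open>Idling for \<open>S = \<tau>\<close> and then steering for another \<open>\<tau>\<close>
  ends exactly at \<open>T_opt lam L\<close>. The trajectory serves as its own witness in
  \<open>steering_control\<close>, so the choice in the law is never empty for true outputs.\<close>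

lemma null_controllable:
  fixes lam a b L :: real
  assumes lam: "lam > 0" and L: "L > 0" and u: "u1 \<in> L2_on {0<..<L}" "u2 \<in> L2_on {0<..<L}"
  shows "\<exists>U Y y1 y2. open_loop_solution lam a b L u1 u2 U Y y1 y2 \<and> steering_control lam a b L Y U"
proof -
  define \<tau> where "\<tau> = (1 + 1 / lam) * L"
  have lp: "1 / lam > 0" using lam by simp
  have tau: "\<tau> > 0" unfolding \<tau>_def using lp L by (intro mult_pos_pos add_pos_pos) auto
  have Topt: "T_opt lam L = \<tau> + (1 + 1 / lam) * L" using lam by (simp add: T_opt_def \<tau>_def field_simps)
  let ?P = "wave_l 1 (1 / lam) (a / (1 + 1 / lam)) (- b / (lam * (1 + 1 / lam)))"
  let ?Q = "wave_r 1 (1 / lam) (a / (1 + 1 / lam)) (- b / (lam * (1 + 1 / lam)))"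
  obtain g where g: "locsq g"
    and l: "\<And>x. x \<in> {0<..<L} \<Longrightarrow> ?P g 0 x = u1 x" and r: "\<And>x. x \<in> {0<..<L} \<Longrightarrow> ?Q g 0 x = u2 x"
    and c: "\<And>t. t \<in> {0<..<\<tau>} \<Longrightarrow> ?P g t L = 0"
    and n: "\<And>t x. t \<ge> \<tau> + (1 + 1 / lam) * L \<Longrightarrow> x \<in> {0<..L} \<Longrightarrow> ?P g t x = 0 \<and> ?Q g t x = 0"
    by (rule wave_null_control[OF zero_less_one lp L less_imp_le[OF tau] u], rule that)
  \<comment> \<open>For \<open>t > 0\<close> this changes the trace at \<open>x = L\<close> at most
    at the single time \<open>\<tau>\<close>.\<close>
  define U where "U t = (if t \<in> {\<tau><..<T_opt lam L} then ?P g t L else 0)" for t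
  have "(\<lambda>t. ?P g t L) \<in> L2_loc" by (rule wave_regularity(2)[OF zero_less_one lp L g]) (use L in auto)
  then have "U \<in> L2_on {0<..<T}" if "T > 0" for T
    unfolding U_def using that by (intro L2_on_cut) (simp_all add: L2_loc_def)
  then have UL: "U \<in> L2_loc" by (simp add: L2_loc_def)
  have "AE t in lborel. t \<noteq> \<tau>" by (rule AE_lborel_singleton)
  then have UA: "AE t in lborel. t > 0 \<longrightarrow> ?P g t L = U t"
  proof eventually_elim
    case (elim t)
    then show ?case using c[of t] n[of t L] L by (auto simp: U_def Topt)
  qed
  note sol = wave_open_loop_solution[OF lam L g l r UL UA]
  moreover have "steering_control lam a b L (\<lambda>t. ?Q g t L) U"
    unfolding steering_control_def \<tau>_def[symmetric]
  proof (intro conjI exI)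
    show "open_loop_solution lam a b L u1 u2 U (\<lambda>t. ?Q g t L) (?P g) (?Q g)" by (rule sol)
    show "\<forall>t\<ge>T_opt lam L. AE x in lborel. x \<in> {0<..<L} \<longrightarrow> ?P g t x = 0 \<and> ?Q g t x = 0"
      using n by (auto simp: Topt)
  qed (use UL in \<open>auto simp: U_def\<close>)
  ultimately show ?thesis by blast
qed

theorem theorem5p1:
  fixes lam a b L :: real
  assumes "lam > 0" and "L > 0"
  shows "\<exists>F. output_feedback_law F \<and>
    (\<forall>u1\<in>L2_on {0<..<L}. \<forall>u2\<in>L2_on {0<..<L}.
       (\<exists>y1 y2. closed_loop_solution lam a b L F u1 u2 y1 y2) \<and>
       (\<forall>y1 y2 z1 z2.
          closed_loop_solution lam a b L F u1 u2 y1 y2 \<and>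
          closed_loop_solution lam a b L F u1 u2 z1 z2 \<longrightarrow>
          (\<forall>t\<ge>0. AE x in lborel. x \<in> {0<..<L} \<longrightarrow> y1 t x = z1 t x \<and> y2 t x = z2 t x)) \<and>
       (\<forall>y1 y2.
          closed_loop_solution lam a b L F u1 u2 y1 y2 \<longrightarrow>
          (\<forall>t\<ge>T_opt lam L. AE x in lborel. x \<in> {0<..<L} \<longrightarrow> y1 t x = 0 \<and> y2 t x = 0)))"
proof (rule exI[of _ "observe_then_steer lam a b L"], intro conjI ballI)
  let ?F = "observe_then_steer lam a b L"
  define \<tau> where "\<tau> = (1 + 1 / lam) * L"
  have tau: "\<tau> > 0" unfolding \<tau>_def using assms by (intro mult_pos_pos add_pos_pos) auto
  have Topt: "T_opt lam L = 2 * \<tau>" using assms by (simp add: T_opt_def \<tau>_def field_simps)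
  show "output_feedback_law ?F" by (rule output_feedback_law_observe_then_steer)
  fix u1 u2 assume u: "u1 \<in> L2_on {0<..<L}" "u2 \<in> L2_on {0<..<L}"
  obtain U0 Y0 w1 w2 where w: "open_loop_solution lam a b L u1 u2 U0 Y0 w1 w2" and good0: "steering_control lam a b L Y0 U0"
    using null_controllable[OF assms u, of a b] by (elim exE conjE) (rule that)
  \<comment> \<open>The only control that any closed loop starting from \<open>u1\<close>,
    \<open>u2\<close> can produce, as \<open>agree\<close> shows.\<close>
  define V where "V = ?F Y0"
  have good: "steering_control lam a b L Y0 V" unfolding V_def by (rule observe_then_steer_steers[OF good0])
  \<comment> \<open>The reference trajectory may start from other data \<open>v1\<close>,
    \<open>v2\<close>; it shares with the true one the control \<open>V\<close> and the output on
    \<open>(0, \<tau>)\<close>.\<close>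
  then obtain v1 v2 Z' z1' z2' where s': "open_loop_solution lam a b L v1 v2 V Z' z1' z2'"
    and Z': "AE s in lborel. s \<in> {0<..<\<tau>} \<longrightarrow> Z' s = Y0 s"
    and null: "\<forall>t\<ge>T_opt lam L. AE x in lborel. x \<in> {0<..<L} \<longrightarrow> z1' t x = 0 \<and> z2' t x = 0"
    unfolding steering_control_def \<tau>_def[symmetric] by (elim exE conjE) (rule that)
  \<comment> \<open>Both \<open>U\<close> and \<open>U0\<close> vanish before \<open>\<tau>\<close>,
    so uniqueness fixes the output there and thereby the control returned by the law. This is
    applied to \<open>V\<close> itself for existence and to an arbitrary closed loop
    otherwise.\<close>
  have agree: "(AE t in lborel. t \<in> {0<..<\<tau>} \<longrightarrow> Y t = Y0 t) \<and> ?F Y = V"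
    if "open_loop_solution lam a b L u1 u2 U Y y1 y2" "\<And>t. t \<le> \<tau> \<Longrightarrow> U t = 0" for U Y y1 y2
  proof -
    have "U t = U0 t" if "t \<in> {0<..<\<tau>}" for t
      using \<open>\<And>t. t \<le> \<tau> \<Longrightarrow> U t = 0\<close>[of t] steering_control_zero[OF good0, of t] that by (simp add: \<tau>_def)
    then have "AE t in lborel. t \<in> {0<..<\<tau>} \<longrightarrow> U t = U0 t" by (intro AE_I2 impI)
    from open_loop_unique(2)[OF assms tau that(1) w this]
    have *: "AE t in lborel. t \<in> {0<..<\<tau>} \<longrightarrow> Y t = Y0 t" .
    moreover have "?F Y = V"
      using steering_control_cong[OF *[unfolded \<tau>_def], of a b] by (simp add: V_def observe_then_steer_def)
    ultimately show ?thesis by simp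
  qed
  have closed: "\<exists>Y. open_loop_solution lam a b L u1 u2 V Y y1 y2 \<and> (AE t in lborel. t \<in> {0<..<\<tau>} \<longrightarrow> Y t = Y0 t)"
    if c: "closed_loop_solution lam a b L ?F u1 u2 y1 y2" for y1 y2
  proof -
    obtain Y where Y: "open_loop_solution lam a b L u1 u2 (?F Y) Y y1 y2"
      using c unfolding closed_loop_solution_def by (elim exE)
    have "?F Y t = 0" if "t \<le> \<tau>" for t using that by (simp add: observe_then_steer_zero \<tau>_def)
    from agree[OF Y this] Y show ?thesis by auto
  qed
  show "\<exists>y1 y2. closed_loop_solution lam a b L ?F u1 u2 y1 y2"
  proof -
    have VL: "V \<in> L2_loc" and V0: "\<And>t. t \<le> \<tau> \<or> t \<ge> T_opt lam L \<Longrightarrow> V t = 0"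
      using good by (auto simp: steering_control_def \<tau>_def)
    \<comment> \<open>\<open>open_loop_exists\<close> asks for square integrability on the whole
      half line, which follows from the bounded support of \<open>V\<close>.\<close>
    have "(\<lambda>t. indicator {0<..<T_opt lam L} t * V t) \<in> L2_on UNIV"
      using VL tau by (intro L2_on_extend_by_zero) (simp add: L2_loc_def Topt)
    moreover have "(\<lambda>t. indicator {0<..<T_opt lam L} t * V t) = V"
    proof
      fix t
      have "V t = 0" if "t \<notin> {0<..<T_opt lam L}" using that tau by (intro V0) auto
      then show "indicator {0<..<T_opt lam L} t * V t = V t" by (auto simp: indicator_def)
    qed
    ultimately have "V \<in> L2_on UNIV" by simp
    then have "V \<in> L2_on {0<..}" by (rule L2_on_subset) auto
    from open_loop_exists[OF assms u VL this, of a b]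
    obtain Y y1 y2 where Y: "open_loop_solution lam a b L u1 u2 V Y y1 y2" by (elim exE)
    have "?F Y = V" by (rule conjunct2[OF agree[OF Y]]) (simp add: V0)
    with Y have "open_loop_solution lam a b L u1 u2 (?F Y) Y y1 y2" by (simp only:)
    then show ?thesis unfolding closed_loop_solution_def by (intro exI)
  qed
  show "\<forall>y1 y2 z1 z2.
          closed_loop_solution lam a b L ?F u1 u2 y1 y2 \<and>
          closed_loop_solution lam a b L ?F u1 u2 z1 z2 \<longrightarrow>
          (\<forall>t\<ge>0. AE x in lborel. x \<in> {0<..<L} \<longrightarrow> y1 t x = z1 t x \<and> y2 t x = z2 t x)"
  proof (intro allI impI)
    fix y1 y2 z1 z2 and t :: real
    assume *: "closed_loop_solution lam a b L ?F u1 u2 y1 y2 \<and> closed_loop_solution lam a b L ?F u1 u2 z1 z2"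
      and t: "t \<ge> 0"
    obtain Y Z where Y: "open_loop_solution lam a b L u1 u2 V Y y1 y2" and Z: "open_loop_solution lam a b L u1 u2 V Z z1 z2"
      using closed[OF conjunct1[OF *]] closed[OF conjunct2[OF *]] by blast
    show "AE x in lborel. x \<in> {0<..<L} \<longrightarrow> y1 t x = z1 t x \<and> y2 t x = z2 t x"
    proof (cases "t = 0")
      case True
      have "AE x in lborel. x \<in> {0<..<L} \<longrightarrow> y1 0 x = u1 x \<and> y2 0 x = u2 x"
        "AE x in lborel. x \<in> {0<..<L} \<longrightarrow> z1 0 x = u1 x \<and> z2 0 x = u2 x"
        using Y Z by (simp_all add: open_loop_solution_def)
      then show ?thesis unfolding True by eventually_elim auto
    next
      case False
      then show ?thesis using t by (intro open_loop_unique(1)[OF assms _ Y Z]) auto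
    qed
  qed
  show "\<forall>y1 y2. closed_loop_solution lam a b L ?F u1 u2 y1 y2 \<longrightarrow>
          (\<forall>t\<ge>T_opt lam L. AE x in lborel. x \<in> {0<..<L} \<longrightarrow> y1 t x = 0 \<and> y2 t x = 0)"
  proof (intro allI impI)
    fix y1 y2 and t :: real assume y: "closed_loop_solution lam a b L ?F u1 u2 y1 y2" and t: "t \<ge> T_opt lam L"
    obtain Y where Y: "open_loop_solution lam a b L u1 u2 V Y y1 y2" and YY: "AE t in lborel. t \<in> {0<..<\<tau>} \<longrightarrow> Y t = Y0 t"
      using closed[OF y] by blast
    have "t \<ge> (1 + 1 / lam) * L" using t tau by (simp add: Topt flip: \<tau>_def)
    moreover have "AE t in lborel. t \<in> {0<..<(1 + 1 / lam) * L} \<longrightarrow> Y t = Z' t"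
      using YY Z' unfolding \<tau>_def[symmetric] by eventually_elim auto
    \<comment> \<open>The comparison with the reference trajectory is made at each \<open>t\<close>
      separately, with \<open>T = t\<close>, so no restart of the system at time
      \<open>\<tau>\<close> is involved.\<close>
    ultimately have "AE x in lborel. x \<in> {0<..<L} \<longrightarrow> y1 t x = z1' t x \<and> y2 t x = z2' t x"
      by (intro state_determined_by_output[OF assms _ Y s']) auto
    with null[rule_format, OF t] show "AE x in lborel. x \<in> {0<..<L} \<longrightarrow> y1 t x = 0 \<and> y2 t x = 0"
      by eventually_elim auto
  qed
qed

end
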